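(* Let $f,g\in\mathbb{Q}[t]$ be coprime such that $\max\{\tfrac14\deg f,\tfrac16\deg g\}=n/m$ for positive integers $n,m$ with $m=1$ or $n=1$. For $t\in\mathbb{Q}$ let $\mathcal{E}_t:y^2=x^3+f(t)x+g(t)$. Fix $\beta>\kappa_1(f,g)$. Then for all $H\ge3$, \[\frac1{H^{\frac{m+1}{12n}}}\#\left\{\frac a{b^m}\in\mathbb{Q}: |a|\le H^{\frac m{12n}},\ |b|\le H^{\frac1{12n}},\ \sigma(\mathcal{E}_{a/b^m})\ge\beta\right\}\ll\frac{(\log\log H)^2}{(\log H)^{1/2}},\] where $a,b$ range over integers (with $b\ne0$ and $\mathcal{E}_{a/b^m}$ non-singular), and the implied constant depends on $f,g,\beta$.
   Context: The Szpiro ratio of an elliptic curve $E/\mathbb{Q}$ is $\sigma(E)=\log|\Delta_{\min}(E)|/\log N(E)$, with $\Delta_{\min}$ the minimal discriminant and $N(E)$ the conductor. Definition of $\kappa_1$: let $d(t)=4f^3+27g^2$ and $D(x,y)=y^{12n/m}d(x/y)$. Factor $D=c_0y^{e_0}F_1^{e_1}\cdots F_\psi^{e_\psi}$ ($c_0\in\mathbb{Q}$, $e_0\ge0$, $e_i\ge1$, $F_i\in\mathbb{Z}[x,y]$ homogeneous, irreducible over $\mathbb{Q}$, pairwise coprime and coprime to $y$). Let $\delta_0=1$ if $e_0\ge1$ else $0$, $\delta_i=m\deg F_i$; $w_0=1$, and $w_i=1$ if $x\mid F_i$, else $w_i=\max\{1,\delta_i-2\}$. Then $\kappa_1(f,g)=12n/\sum_{i=0}^\psi(\delta_i/w_i)$.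 *)

theory Defs
  imports
    "HOL-Analysis.Infinite_Sum"
    "HOL-Algebra.Generated_Fields"
    "HOL-Algebra.Ideal_Product"
    "HOL-Algebra.QuotRing"
    "HOL-Algebra.Algebraic_Closure_Type"
    "HOL-Computational_Algebra.Computational_Algebra"
begin

section \<open>Weierstrass equations\<close>

text \<open>\<open>Weierstrass a1 a2 a3 a4 a6\<close> stands for
  \<open>y^2 + a1 x y + a3 y = x^3 + a2 x^2 + a4 x + a6\<close>.\<close>

datatype 'a weierstrass = Weierstrass (a1: 'a) (a2: 'a) (a3: 'a) (a4: 'a) (a6: 'a)

definition disc :: "'a::comm_ring_1 weierstrass \<Rightarrow> 'a" where
  "disc W =
    (let b2 = a1 W ^ 2 + 4 * a2 W;
         b4 = 2 * a4 W + a1 W * a3 W;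
         b6 = a3 W ^ 2 + 4 * a6 W;
         b8 = a1 W ^ 2 * a6 W + 4 * a2 W * a6 W - a1 W * a3 W * a4 W + a2 W * a3 W ^ 2 - a4 W ^ 2
     in - (b2 ^ 2 * b8) - 8 * b4 ^ 3 - 27 * b6 ^ 2 + 9 * b2 * b4 * b6)"

text \<open>The substitution \<open>x = u^2 x' + r\<close>, \<open>y = u^3 y' + s u^2 x' + t\<close>.\<close>

definition change_vars :: "'a::field \<Rightarrow> 'a \<Rightarrow> 'a \<Rightarrow> 'a \<Rightarrow> 'a weierstrass \<Rightarrow> 'a weierstrass" where
  "change_vars u r s t W = Weierstrass
     ((a1 W + 2 * s) / u)
     ((a2 W - s * a1 W + 3 * r - s ^ 2) / u ^ 2)
     ((a3 W + r * a1 W + 2 * t) / u ^ 3)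
     ((a4 W - s * a3 W + 2 * r * a2 W - (t + r * s) * a1 W + 3 * r ^ 2 - 2 * s * t) / u ^ 4)
     ((a6 W + r * a4 W + r ^ 2 * a2 W + r ^ 3 - t * a3 W - t ^ 2 - r * t * a1 W) / u ^ 6)"

definition integral_models :: "rat weierstrass \<Rightarrow> int weierstrass set" where
  "integral_models E =
     {W. \<exists>u r s t. u \<noteq> 0 \<and> map_weierstrass of_int W = change_vars u r s t E}"

text \<open>Since \<open>\<rat>\<close> has class number one, an integral model with least \<open>\<bar>disc W\<bar>\<close> is minimal at
  every prime simultaneously.\<close>

definition minimal_model :: "rat weierstrass \<Rightarrow> int weierstrass" where
  "minimal_model E = arg_min (\<lambda>W. nat \<bar>disc W\<bar>) (\<lambda>W. W \<in> integral_models E)"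

definition minimal_disc :: "rat weierstrass \<Rightarrow> int" where
  "minimal_disc E = disc (minimal_model E)"

section \<open>Points and torsion\<close>

datatype 'a point = Infinity | Affine 'a 'a

fun on_curve :: "'a::comm_ring_1 weierstrass \<Rightarrow> 'a point \<Rightarrow> bool" where
  "on_curve W Infinity \<longleftrightarrow> True"
| "on_curve W (Affine x y) \<longleftrightarrow>
     y ^ 2 + a1 W * x * y + a3 W * y = x ^ 3 + a2 W * x ^ 2 + a4 W * x + a6 W"

fun point_add :: "'a::field weierstrass \<Rightarrow> 'a point \<Rightarrow> 'a point \<Rightarrow> 'a point" where
  "point_add W Infinity Q = Q"
| "point_add W P Infinity = P"
| "point_add W (Affine x1 y1) (Affine x2 y2) =
    (if x1 = x2 \<and> y1 + y2 + a1 W * x2 + a3 W = 0 then Infinity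
     else
       let l = (if x1 \<noteq> x2 then (y2 - y1) / (x2 - x1)
                else (3 * x1 ^ 2 + 2 * a2 W * x1 + a4 W - a1 W * y1) /
                       (2 * y1 + a1 W * x1 + a3 W));
           x3 = l ^ 2 + a1 W * l - a2 W - x1 - x2
       in Affine x3 (- (l + a1 W) * x3 - (y1 - l * x1) - a3 W))"

definition complex_torsion :: "rat weierstrass \<Rightarrow> nat \<Rightarrow> complex point set" where
  "complex_torsion E l =
     (let W = map_weierstrass of_rat E
      in {P. on_curve W P \<and> (point_add W P ^^ l) Infinity = Infinity})"

section \<open>The conductor\<close>

text \<open>The exponent of the conductor at \<open>p\<close> is 0, 1 or \<open>2 + \<delta>\<^sub>p\<close> according to whether the reduction is
  good, multiplicative or additive, where, for any prime \<open>l \<noteq> p\<close>,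
  \<open>\<delta>\<^sub>p = (\<Sum>i\<ge>1. \<bar>G\<^sub>i\<bar> / \<bar>G\<^sub>0\<bar> * dim (E[l] / E[l]\<^bsup>G\<^sub>i\<^esup>))\<close>
  with \<open>G\<^sub>i\<close> the ramification groups at a prime above \<open>p\<close> of the field \<open>\<rat>(E[l])\<close>, taken inside
  the complex numbers. These coincide with the ramification groups of the corresponding extension
  of the \<open>p\<close>-adic field.\<close>

definition torsion_field :: "rat weierstrass \<Rightarrow> nat \<Rightarrow> complex set" where
  "torsion_field E l =
     generate_field ring_of_type_algebra (\<Union>P\<in>complex_torsion E l. set_point P)"

abbreviation sub_ring :: "complex set \<Rightarrow> complex ring" where
  "sub_ring A \<equiv> ring_of_type_algebra\<lparr>carrier := A\<rparr>"

definition ring_of_integers :: "complex set \<Rightarrow> complex ring" where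
  "ring_of_integers L = sub_ring {x \<in> L. algebraic_int x}"

text \<open>Automorphisms are made extensional so that each is represented by exactly one function.\<close>

definition galois_group :: "complex set \<Rightarrow> (complex \<Rightarrow> complex) set" where
  "galois_group L = ring_iso (sub_ring L) (sub_ring L) \<inter> extensional L"

definition ramification_group ::
    "complex set \<Rightarrow> complex set \<Rightarrow> nat \<Rightarrow> (complex \<Rightarrow> complex) set" where
  "ramification_group L \<P> i =
     {\<sigma> \<in> galois_group L. \<forall>x \<in> carrier (ring_of_integers L).
        \<sigma> x - x \<in> \<P> [^]\<^bsub>ideals_set (ring_of_integers L)\<^esub> (i + 1)}"

text \<open>By Galois conjugacy the choice of the prime above \<open>p\<close> is irrelevant to \<open>\<delta>\<^sub>p\<close>. Only finitely
  many terms of the sum are nonzero, and the dimension of an \<open>l\<close>-torsion group is the logarithm to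
  base \<open>l\<close> of its order.\<close>

definition prime_above :: "complex set \<Rightarrow> nat \<Rightarrow> complex set" where
  "prime_above L p = (SOME \<P>. maximalideal \<P> (ring_of_integers L) \<and> of_nat p \<in> \<P>)"

definition wild_exponent :: "rat weierstrass \<Rightarrow> nat \<Rightarrow> real" where
  "wild_exponent E p =
     (let l = (if p = 2 then 3 else 2);
          L = torsion_field E l;
          T = complex_torsion E l;
          G = ramification_group L (prime_above L p)
      in \<Sum>\<^sub>\<infinity>i\<in>{1..}. real (card (G i)) / real (card (G 0)) *
           log (real l) (real (card T) / real (card {P \<in> T. \<forall>\<sigma>\<in>G i. map_point \<sigma> P = P})))"

text \<open>The reduction of \<open>W\<close> modulo \<open>p\<close> has a node: there is a singular point \<open>(x, y)\<close>, and its
  tangent cone \<open>Y^2 + a1 X Y - (a2 + 3 x) X^2\<close> has nonzero discriminant. A singular point is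
  always rational over the prime field.\<close>

definition has_node_mod :: "nat \<Rightarrow> int weierstrass \<Rightarrow> bool" where
  "has_node_mod p W \<longleftrightarrow> (\<exists>x y.
     int p dvd y ^ 2 + a1 W * x * y + a3 W * y - x ^ 3 - a2 W * x ^ 2 - a4 W * x - a6 W \<and>
     int p dvd a1 W * y - 3 * x ^ 2 - 2 * a2 W * x - a4 W \<and>
     int p dvd 2 * y + a1 W * x + a3 W \<and>
     \<not> int p dvd a1 W ^ 2 + 4 * (a2 W + 3 * x))"

definition conductor_exponent :: "rat weierstrass \<Rightarrow> nat \<Rightarrow> real" where
  "conductor_exponent E p =
     (if \<not> int p dvd minimal_disc E then 0
      else if has_node_mod p (minimal_model E) then 1
      else 2 + wild_exponent E p)"

text \<open>The exponents are in fact integers; they are kept real because that is a theorem.\<close>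

definition conductor :: "rat weierstrass \<Rightarrow> real" where
  "conductor E =
     (\<Prod>p | Factorial_Ring.prime p \<and> int p dvd minimal_disc E. real p powr conductor_exponent E p)"

definition szpiro_ratio :: "rat weierstrass \<Rightarrow> real" where
  "szpiro_ratio E = ln \<bar>real_of_int (minimal_disc E)\<bar> / ln (conductor E)"

section \<open>The constant \<open>\<kappa>\<^sub>1\<close>\<close>

text \<open>An element of \<open>'a poly poly\<close> is read as a polynomial in \<open>y\<close> whose coefficients are
  polynomials in \<open>x\<close>.\<close>

definition form_x :: "'a::comm_ring_1 poly poly" where
  "form_x = [:[:0, 1:]:]"

definition form_y :: "'a::comm_ring_1 poly poly" where
  "form_y = [:0, 1:]"

definition total_degree :: "'a::zero poly poly \<Rightarrow> nat" where
  "total_degree F = Max {i + j | i j. poly.coeff (poly.coeff F j) i \<noteq> 0}"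

definition homogeneous :: "'a::zero poly poly \<Rightarrow> bool" where
  "homogeneous F \<longleftrightarrow>
     (\<forall>i j. poly.coeff (poly.coeff F j) i \<noteq> 0 \<longrightarrow> i + j = total_degree F)"

abbreviation over_rat :: "int poly poly \<Rightarrow> rat poly poly" where
  "over_rat \<equiv> map_poly (map_poly of_int)"

text \<open>\<open>y^k d(x/y)\<close>, for \<open>k \<ge> degree d\<close>.\<close>

definition homogenize :: "nat \<Rightarrow> rat poly \<Rightarrow> rat poly poly" where
  "homogenize k d =
     (\<Sum>i\<le>Polynomial.degree d. [:[:poly.coeff d i:]:] * form_x ^ i * form_y ^ (k - i))"

definition disc_poly :: "rat poly \<Rightarrow> rat poly \<Rightarrow> rat poly" where
  "disc_poly f g = 4 * f ^ 3 + 27 * g ^ 2"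

definition form_factorization ::
    "rat poly poly \<Rightarrow> rat \<Rightarrow> nat \<Rightarrow> nat \<Rightarrow> (nat \<Rightarrow> int poly poly) \<Rightarrow> (nat \<Rightarrow> nat) \<Rightarrow> bool" where
  "form_factorization D c0 e0 \<psi> F e \<longleftrightarrow>
     D = [:[:c0:]:] * form_y ^ e0 * (\<Prod>i\<in>{1..\<psi>}. over_rat (F i) ^ e i) \<and>
     (\<forall>i\<in>{1..\<psi>}. e i \<ge> 1 \<and> homogeneous (F i) \<and> Factorial_Ring.irreducible (over_rat (F i)) \<and>
        coprime (over_rat (F i)) form_y) \<and>
     (\<forall>i\<in>{1..\<psi>}. \<forall>j\<in>{1..\<psi>}. i \<noteq> j \<longrightarrow> coprime (over_rat (F i)) (over_rat (F j)))"

definition form_weight :: "nat \<Rightarrow> int poly poly \<Rightarrow> real" where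
  "form_weight m F =
     (if form_x dvd F then 1 else max 1 (real (m * total_degree F) - 2))"

text \<open>The factorization exists and is unique up to order and scalars, so the value does not depend
  on it. For \<open>n\<close>, \<open>m\<close> as in the theorem \<open>12 n / m\<close> is an integer and at least the degree of
  \<open>disc_poly f g\<close>.\<close>

definition kappa1 :: "nat \<Rightarrow> nat \<Rightarrow> rat poly \<Rightarrow> rat poly \<Rightarrow> real" where
  "kappa1 n m f g = (SOME \<kappa>. \<exists>c0 e0 \<psi> F e.
     form_factorization (homogenize (12 * n div m) (disc_poly f g)) c0 e0 \<psi> F e \<and>
     \<kappa> = 12 * real n /
       ((if e0 \<ge> 1 then 1 else 0) +
        (\<Sum>i=1..\<psi>. real (m * total_degree (F i)) / form_weight m (F i))))"

section \<open>The family\<close>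

definition fibre :: "rat poly \<Rightarrow> rat poly \<Rightarrow> rat \<Rightarrow> rat weierstrass" where
  "fibre f g t = Weierstrass 0 0 0 (poly f t) (poly g t)"

end

(*
  Put B = H^(1/(12 n)) and count pairs (a, b) with |a| <= B^m, |b| <= B. The discriminant of the
  fibre at a / b^m is, up to bounded factors, a product of values N_i = F_i(a, b^m) of pairwise
  coprime irreducible forms and of a power of b, and N_i has size about B^(delta_i).

  Let y = (log B)^(1/2). Outside a set of O(B^(m+1) / y) pairs, |N_i| is not much smaller than
  B^(delta_i), primes p <= y contribute only B^o(1) to N_i, and every prime p > y divides N_i at
  most w_i times. Hence the radical of N_i is at least B^(delta_i / w_i - o(1)). A prime p > y
  dividing N_i also divides the minimal discriminant, unless it divides both a and b, so the
  conductor is at least B^(12 n / kappa1 - o(1)), while the minimal discriminant is O(B^(12 n)).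

  The exceptional pairs are counted elementarily. For p < B^(m - eps) the solutions a of
  p^2 | N_i with b fixed lie in at most deg F_i classes mod p^2. For larger p the size of N_i rules
  out p^(w_i + 1) | N_i unless m = 1; then the coprime pairs (a, b) with a in a fixed class
  rho * b mod p^2 are primitive points of a lattice of determinant p^2, and there are O(B^2 / p^2 + 1) of them
  in the box. No input on the distribution of primes is needed: all sums over p are bounded by
  sums over integers.
*)
theory Submission
  imports Defs "HOL-Real_Asymp.Real_Asymp"
begin

section \<open>Divided differences and values of binary forms\<close>

text \<open>Small primes may divide the discriminant of a form, so the roots modulo
  \<open>p^k\<close> cannot be controlled by Hensel lifting. Instead, for \<open>r + 1\<close>
  integers in a short window, with \<open>r\<close> the degree, the product of their differences
  limits how large a modulus can divide all their values. This needs no hypothesis on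
  \<open>p\<close> and is uniform in the second argument of the form. For \<open>p > y\<close> the
  same product, read modulo \<open>p\<close>, combines with the lift to \<open>p^2\<close>. The
  obstacle is the \<open>+ 1\<close> in every count \<open>B^m / p^2 + 1\<close>: summed over
  \<open>p\<close> it costs as much as there are primes, so counting with \<open>b\<close> fixed
  must stop at \<open>B^(m - \<epsilon>)\<close>. Beyond that the size of the value must help, and
  the weight \<open>\<delta> - 2\<close> is what makes this possible. For \<open>m \<ge> 2\<close> a
  power \<open>p^(r + 1)\<close> is already too large. For \<open>m = 1\<close> divisibility by
  \<open>p^(r - 1)\<close> with \<open>r \<ge> 3\<close> still allows \<open>p\<close> up to order
  \<open>B^(3/2)\<close>; this is affordable against \<open>B^2\<close> pairs once the pairs are
  counted for all \<open>b\<close> together, which is the purpose of the lattices.\<close>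

fun vandermonde :: "int list \<Rightarrow> int" where
  "vandermonde [] = 1"
| "vandermonde (x # xs) = (\<Prod>y\<leftarrow>xs. y - x) * vandermonde xs"

text \<open>The top divided difference of \<open>P\<close> at \<open>r + 1\<close> nodes is
  \<open>coeff P r\<close>, and the product of all node differences clears its denominators. In the
  induction \<open>P\<close> is divided by \<open>X - x\<close>: the quotient keeps the coefficient,
  and its values at the other nodes become multiples of \<open>q\<close> after scaling by the
  differences \<open>z - x\<close>.\<close>

lemma dvd_lead_coeff_vandermonde:
  fixes P :: "int poly"
  assumes "distinct xs" "length xs = Suc r" "degree P \<le> r" "\<forall>x\<in>set xs. q dvd poly P x"
  shows "q dvd coeff P r * vandermonde xs"
  using assms
proof (induction xs arbitrary: P r)
  case Nil
  then show ?case by simp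
next
  case (Cons x xs)
  show ?case
  proof (cases r)
    case 0
    then have "xs = []" using Cons.prems by simp
    moreover from 0 have "P = [:coeff P 0:]" using Cons.prems(3)
      by (metis degree_0_id le_zero_eq of_nat_0 degree_eq_zeroE coeff_pCons_0)
    then have "poly P x = coeff P 0" by (metis poly_const_conv)
    ultimately show ?thesis using Cons.prems 0 by simp
  next
    case (Suc s)
    define Q where "Q = synthetic_div P x"
    have PQ: "P = [:-x, 1:] * Q + [:poly P x:]"
      unfolding Q_def using synthetic_div_correct'[of x P] by (simp add: algebra_simps)
    have dQ: "degree Q \<le> s"
      using Cons.prems(3) Suc by (simp add: Q_def degree_synthetic_div)
    have cQ: "coeff Q s = coeff P r"
    proof -
      have "coeff P (Suc s) = coeff ([:-x, 1:] * Q) (Suc s)"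
        by (subst PQ) simp
      also have "\<dots> = - x * coeff Q (Suc s) + coeff Q s" by (simp add: coeff_pCons)
      also have "coeff Q (Suc s) = 0" using dQ by (simp add: coeff_eq_0)
      finally show ?thesis using Suc by simp
    qed
    define D where "D = (\<Prod>y\<leftarrow>xs. y - x)"
    have "q dvd poly (smult D Q) z" if z: "z \<in> set xs" for z
    proof -
      have "poly P z = (z - x) * poly Q z + poly P x" by (subst PQ) (simp add: algebra_simps)
      then have "(z - x) * poly Q z = poly P z - poly P x" by simp
      also have "q dvd \<dots>" using Cons.prems z by (intro dvd_diff) auto
      finally have "q dvd (z - x) * poly Q z" .
      moreover have "(z - x) dvd D" unfolding D_def
        using z by (induction xs) auto
      ultimately show ?thesis by (metis dvd_refl dvd_trans mult_dvd_mono poly_smult)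
    qed
    then have "q dvd coeff (smult D Q) s * vandermonde xs"
      using Cons.prems Suc dQ by (intro Cons.IH) (auto intro: order.trans[OF degree_smult_le])
    then show ?thesis using cQ by (simp add: D_def mult_ac)
  qed
qed

lemma vandermonde_nonzero: "distinct xs \<Longrightarrow> vandermonde xs \<noteq> 0"
  by (induction xs) (auto simp: prod_list_zero_iff)

text \<open>There are only \<open>n (n - 1) / 2\<close> differences; the exponent \<open>n^2\<close>
  is a convenient overestimate, as any fixed power of \<open>L\<close> serves the later
  counts.\<close>

lemma abs_vandermonde_le:
  assumes "\<forall>x\<in>set xs. \<forall>y\<in>set xs. \<bar>real_of_int (x - y)\<bar> \<le> L" "L \<ge> 1"
  shows "\<bar>real_of_int (vandermonde xs)\<bar> \<le> L ^ (length xs ^ 2)"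
  using assms(1)
proof (induction xs)
  case Nil
  then show ?case by simp
next
  case (Cons x xs)
  have *: "\<bar>real_of_int (\<Prod>y\<leftarrow>ys. y - x)\<bar> \<le> L ^ length ys" if "set ys \<subseteq> set xs" for ys
    using that
  proof (induction ys)
    case (Cons y ys)
    have "\<bar>real_of_int (y - x)\<bar> \<le> L" using Cons.prems \<open>\<forall>x\<in>set (x # xs). _\<close> by auto
    then have "\<bar>real_of_int (y - x)\<bar> * \<bar>real_of_int (\<Prod>y\<leftarrow>ys. y - x)\<bar> \<le> L * L ^ length ys"
      using Cons assms(2) by (intro mult_mono) auto
    then show ?case by (simp add: abs_mult)
  qed auto
  have "\<bar>real_of_int (vandermonde (x # xs))\<bar> \<le> L ^ length xs * L ^ (length xs ^ 2)"
    using *[of xs] Cons assms(2) by (simp add: abs_mult mult_mono)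
  also have "\<dots> \<le> L ^ (length (x # xs) ^ 2)"
    unfolding power_add[symmetric] using assms(2) by (intro power_increasing) (auto simp: power2_eq_square)
  finally show ?case .
qed

lemma prime_dvd_vandermonde:
  assumes "Factorial_Ring.prime p" "p dvd vandermonde xs" "distinct xs"
  shows "\<exists>x\<in>set xs. \<exists>y\<in>set xs. x \<noteq> y \<and> p dvd y - x"
  using assms(2,3)
proof (induction xs)
  case Nil
  then show ?case using assms(1) by auto
next
  case (Cons x xs)
  then consider "p dvd (\<Prod>y\<leftarrow>xs. y - x)" | "p dvd vandermonde xs"
    using assms(1) prime_dvd_mult_iff by auto
  then show ?case
  proof cases
    case 1
    then have "\<exists>y\<in>set xs. p dvd y - x"
      using assms(1) by (induction xs) (auto simp: prime_dvd_mult_iff)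
    then show ?thesis using Cons.prems by auto
  next
    case 2
    then show ?thesis using Cons by auto
  qed
qed

text \<open>The value at \<open>(a, c)\<close> of the binary form \<open>y^r h(x/y)\<close> with \<open>r = degree h\<close>.\<close>

definition fval :: "int poly \<Rightarrow> int \<Rightarrow> int \<Rightarrow> int" where
  "fval h a c = (\<Sum>i\<le>degree h. coeff h i * a ^ i * c ^ (degree h - i))"

definition fval_poly :: "int poly \<Rightarrow> int \<Rightarrow> int poly" where
  "fval_poly h c = (\<Sum>i\<le>degree h. monom (coeff h i * c ^ (degree h - i)) i)"

lemma poly_fval_poly: "poly (fval_poly h c) a = fval h a c"
  by (simp add: fval_poly_def fval_def poly_sum poly_monom mult_ac)

lemma degree_fval_poly: "degree (fval_poly h c) \<le> degree h"
  unfolding fval_poly_def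
  by (intro degree_sum_le) (auto intro: order.trans[OF degree_monom_le])

text \<open>The coefficient does not involve \<open>c\<close>: this makes the window bounds uniform
  in the denominator.\<close>

lemma coeff_fval_poly: "coeff (fval_poly h c) (degree h) = lead_coeff h"
  by (simp add: fval_poly_def coeff_sum sum.delta)

text \<open>Otherwise \<open>q\<close> divides the nonzero integer
  \<open>lead_coeff h * vandermonde xs\<close>, which is smaller than \<open>q\<close>. As
  \<open>q\<close> is arbitrary, this covers powers of primes dividing the discriminant of
  \<open>h\<close>, where roots need not lift uniquely.\<close>

lemma fval_window_bound:
  assumes "finite S" "\<forall>x\<in>S. q dvd fval h x c" "\<forall>x\<in>S. \<forall>y\<in>S. \<bar>real_of_int (x - y)\<bar> \<le> L" "L \<ge> 1" "h \<noteq> 0"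
    and "\<bar>real_of_int (lead_coeff h)\<bar> * L ^ ((degree h + 1) ^ 2) < real_of_int q"
  shows "card S \<le> degree h"
proof (rule ccontr)
  assume "\<not> ?thesis"
  then obtain Y where Y: "Y \<subseteq> S" "card Y = Suc (degree h)" 
    by (metis not_less_eq_eq obtain_subset_with_card_n)
  then have "finite Y" using assms(1) finite_subset by blast
  then obtain xs where xs: "set xs = Y" "distinct xs" using finite_distinct_list by blast
  then have len: "length xs = Suc (degree h)" using Y distinct_card by metis
  have "q dvd coeff (fval_poly h c) (degree h) * vandermonde xs"
    using xs len assms(2) Y degree_fval_poly
    by (intro dvd_lead_coeff_vandermonde) (auto simp: poly_fval_poly)
  then have "q dvd lead_coeff h * vandermonde xs" by (simp add: coeff_fval_poly)
  moreover have "lead_coeff h * vandermonde xs \<noteq> 0"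
    using vandermonde_nonzero xs assms(5) by simp
  ultimately have "\<bar>q\<bar> \<le> \<bar>lead_coeff h * vandermonde xs\<bar>" by (rule dvd_imp_le_int[rotated])
  then have "real_of_int q \<le> \<bar>real_of_int (lead_coeff h)\<bar> * \<bar>real_of_int (vandermonde xs)\<bar>"
    unfolding abs_mult[symmetric] of_int_mult[symmetric] of_int_abs[symmetric] of_int_le_iff by simp
  also have "\<dots> \<le> \<bar>real_of_int (lead_coeff h)\<bar> * L ^ (length xs ^ 2)"
    using assms xs Y by (intro mult_left_mono abs_vandermonde_le) auto
  finally show False using assms(6) len by simp
qed

section \<open>Counting pairs in boxes\<close>

lemma finite_int_abs_le: "finite {a::int. \<bar>real_of_int a\<bar> \<le> A}"
proof (rule finite_subset)
  show "{a::int. \<bar>real_of_int a\<bar> \<le> A} \<subseteq> {-\<lceil>A\<rceil>..\<lceil>A\<rceil>}" by (auto simp: abs_le_iff) linarith+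
qed auto

lemma card_int_interval_le: "u \<le> v + 1 \<Longrightarrow> real (card {a::int. u \<le> of_int a \<and> of_int a \<le> v}) \<le> v - u + 1"
proof -
  assume uv: "u \<le> v + 1"
  have "{a::int. u \<le> of_int a \<and> of_int a \<le> v} = {\<lceil>u\<rceil>..\<lfloor>v\<rfloor>}" by (auto simp: le_floor_iff ceiling_le_iff)
  moreover have "real (nat (\<lfloor>v\<rfloor> - \<lceil>u\<rceil> + 1)) \<le> v - u + 1"
    using uv by (cases "\<lfloor>v\<rfloor> - \<lceil>u\<rceil> + 1 \<ge> 0") (auto, linarith)
  ultimately show ?thesis by simp
qed

lemma card_int_abs_le: "A \<ge> 0 \<Longrightarrow> real (card {a::int. \<bar>real_of_int a\<bar> \<le> A}) \<le> 2 * A + 1"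
proof -
  assume "A \<ge> 0"
  moreover have "{a::int. \<bar>real_of_int a\<bar> \<le> A} = {a::int. - A \<le> of_int a \<and> of_int a \<le> A}" by auto
  ultimately show ?thesis using card_int_interval_le[of "-A" A] by simp
qed

text \<open>Dropping 0 removes the \<open>+ 1\<close> from the count, so that the bounds for nonzero
  multiples of \<open>d\<close> decay like \<open>1 / d\<close> even when \<open>d\<close> exceeds
  the box, and can be summed over \<open>d\<close>.\<close>

lemma card_nonzero_int_abs_le: "B \<ge> 0 \<Longrightarrow> real (card {b::int. b \<noteq> 0 \<and> \<bar>real_of_int b\<bar> \<le> B}) \<le> 2 * B"
proof -
  assume B: "B \<ge> 0"
  have "{b::int. b \<noteq> 0 \<and> \<bar>real_of_int b\<bar> \<le> B} = {b::int. \<bar>real_of_int b\<bar> \<le> B} - {0}" by auto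
  moreover have "0 \<in> {b::int. \<bar>real_of_int b\<bar> \<le> B}" using B by auto
  moreover have "card {b::int. \<bar>real_of_int b\<bar> \<le> B} > 0"
    using finite_int_abs_le[of B] calculation(2) unfolding card_gt_0_iff by blast
  ultimately show ?thesis using card_int_abs_le[OF B] by (auto simp: card_Diff_singleton)
qed

lemma card_multiples_le:
  assumes "d > 0" "A \<ge> 0"
  shows "real (card {a::int. d dvd a \<and> \<bar>real_of_int a\<bar> \<le> A}) \<le> 2 * A / of_int d + 1"
proof -
  have "{a::int. d dvd a \<and> \<bar>real_of_int a\<bar> \<le> A} \<subseteq> (\<lambda>x. d * x) ` {a::int. \<bar>real_of_int a\<bar> \<le> A / of_int d}"
    using assms by (auto simp: dvd_def abs_mult field_simps)
  then have "card {a::int. d dvd a \<and> \<bar>real_of_int a\<bar> \<le> A} \<le> card {a::int. \<bar>real_of_int a\<bar> \<le> A / of_int d}"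
    by (intro order.trans[OF card_mono card_image_le] finite_imageI finite_int_abs_le)
  also have "real \<dots> \<le> 2 * (A / of_int d) + 1" using assms by (intro card_int_abs_le) auto
  finally show ?thesis by simp
qed

lemma card_nonzero_multiples_le:
  assumes "d > 0" "A \<ge> 0"
  shows "real (card {a::int. a \<noteq> 0 \<and> d dvd a \<and> \<bar>real_of_int a\<bar> \<le> A}) \<le> 2 * A / of_int d"
proof -
  have "{a::int. a \<noteq> 0 \<and> d dvd a \<and> \<bar>real_of_int a\<bar> \<le> A} \<subseteq> (\<lambda>x. d * x) ` {a::int. a \<noteq> 0 \<and> \<bar>real_of_int a\<bar> \<le> A / of_int d}"
    using assms by (auto simp: dvd_def abs_mult field_simps)
  moreover have fin: "finite {a::int. a \<noteq> 0 \<and> \<bar>real_of_int a\<bar> \<le> A / of_int d}"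
    by (rule finite_subset[OF _ finite_int_abs_le]) auto
  ultimately have "card {a::int. a \<noteq> 0 \<and> d dvd a \<and> \<bar>real_of_int a\<bar> \<le> A} \<le> card {a::int. a \<noteq> 0 \<and> \<bar>real_of_int a\<bar> \<le> A / of_int d}"
    by (intro order.trans[OF card_mono card_image_le] finite_imageI)
  also have "real \<dots> \<le> 2 * (A / of_int d)" using assms by (intro card_nonzero_int_abs_le) auto
  finally show ?thesis by simp
qed

text \<open>Cut \<open>[-A, A]\<close> into at most \<open>2 * A / L + 1\<close> half-open windows
  of length \<open>L\<close>, indexed by \<open>\<phi>\<close>.\<close>

lemma card_le_windows:
  fixes S :: "int set"
  assumes "\<forall>x\<in>S. \<bar>real_of_int x\<bar> \<le> A" "A \<ge> 0" "L > 0"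
    and "\<And>Y. Y \<subseteq> S \<Longrightarrow> finite Y \<Longrightarrow> \<forall>x\<in>Y. \<forall>y\<in>Y. \<bar>real_of_int (x - y)\<bar> < L \<Longrightarrow> card Y \<le> r"
  shows "real (card S) \<le> real r * (2 * A / L + 1)"
proof -
  have finS: "finite S" by (rule finite_subset[OF _ finite_int_abs_le[of A]]) (use assms in auto)
  define \<phi> where "\<phi> = (\<lambda>x::int. \<lfloor>(of_int x + A) / L\<rfloor>)"
  define I where "I = {0..\<lfloor>2 * A / L\<rfloor>}"
  define Y where "Y = (\<lambda>j. {x\<in>S. \<phi> x = j})"
  have cov: "S \<subseteq> (\<Union>j\<in>I. Y j)"
  proof
    fix x assume x: "x \<in> S"
    then have "0 \<le> of_int x + A" "of_int x + A \<le> 2 * A" using assms(1) by (force simp: abs_le_iff)+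
    then have "0 \<le> (of_int x + A) / L" "(of_int x + A) / L \<le> 2 * A / L"
      using assms(3) by (auto intro: divide_right_mono)
    then have "\<phi> x \<in> I" unfolding \<phi>_def I_def by (auto intro: floor_mono)
    then show "x \<in> (\<Union>j\<in>I. Y j)" using x by (auto simp: Y_def)
  qed
  have fib: "card (Y j) \<le> r" for j
  proof (rule assms(4))
    show "\<forall>x\<in>Y j. \<forall>y\<in>Y j. \<bar>real_of_int (x - y)\<bar> < L"
    proof (intro ballI)
      fix x y assume "x \<in> Y j" "y \<in> Y j"
      then have "\<lfloor>(of_int x + A) / L\<rfloor> = j" "\<lfloor>(of_int y + A) / L\<rfloor> = j" by (auto simp: Y_def \<phi>_def)
      then have "\<bar>(of_int x + A) / L - (of_int y + A) / L\<bar> < 1" by linarith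
      then have "\<bar>(of_int x - of_int y) / L\<bar> < 1" by (simp add: diff_divide_distrib add_divide_distrib)
      then show "\<bar>real_of_int (x - y)\<bar> < L" using assms(3) by (simp add: abs_divide field_simps)
    qed
  qed (use finS in \<open>auto simp: Y_def\<close>)
  have "card S \<le> card (\<Union>j\<in>I. Y j)" using cov finS by (intro card_mono) (auto simp: Y_def I_def)
  also have "\<dots> \<le> (\<Sum>j\<in>I. card (Y j))" by (intro card_UN_le) (auto simp: I_def)
  also have "\<dots> \<le> (\<Sum>j\<in>I. r)" by (intro sum_mono fib)
  also have "\<dots> = card I * r" by simp
  also have "real \<dots> \<le> (2 * A / L + 1) * real r"
  proof -
    have "real (card I) \<le> 2 * A / L + 1" using assms(2,3) unfolding I_def by simp
    then show ?thesis by (simp add: mult_right_mono)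
  qed
  finally show ?thesis by (simp add: mult.commute)
qed

section \<open>Boxes of pairs and their fibres over the denominator\<close>

definition box :: "nat \<Rightarrow> real \<Rightarrow> (int \<times> int) set" where
  "box m B = {(a, b). b \<noteq> 0 \<and> \<bar>real_of_int a\<bar> \<le> B ^ m \<and> \<bar>real_of_int b\<bar> \<le> B}"

lemma finite_box [simp]: "finite (box m B)"
proof (rule finite_subset)
  show "box m B \<subseteq> {a. \<bar>real_of_int a\<bar> \<le> B ^ m} \<times> {b. \<bar>real_of_int b\<bar> \<le> B}" by (auto simp: box_def)
qed (intro finite_cartesian_product finite_int_abs_le)

lemma card_fibres_le:
  fixes S :: "(int \<times> int) set" and M :: real
  assumes "finite Q" "S \<subseteq> UNIV \<times> Q" "\<And>b. b \<in> Q \<Longrightarrow> finite {a. (a, b) \<in> S}"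
    "\<And>b. b \<in> Q \<Longrightarrow> real (card {a. (a, b) \<in> S}) \<le> M"
  shows "real (card S) \<le> real (card Q) * M"
proof -
  have S: "S = (\<Union>b\<in>Q. (\<lambda>a. (a, b)) ` {a. (a, b) \<in> S})" using assms(2) by auto
  have "card S \<le> (\<Sum>b\<in>Q. card ((\<lambda>a. (a, b)) ` {a. (a, b) \<in> S}))"
    by (subst S) (intro card_UN_le assms)
  also have "\<dots> \<le> (\<Sum>b\<in>Q. card {a. (a, b) \<in> S})" using assms(3) by (intro sum_mono card_image_le)
  also have "real \<dots> \<le> (\<Sum>b\<in>Q. M)" unfolding of_nat_sum by (intro sum_mono assms)
  finally show ?thesis by simp
qed

lemma finite_fibre_box: "S \<subseteq> box m B \<Longrightarrow> finite {a. (a, b) \<in> S}"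
  by (rule finite_subset[of _ "fst ` box m B"]) force+

lemma card_box_fibres_le:
  assumes "S \<subseteq> box m B" "B \<ge> 0" "M \<ge> 0"
    "\<And>b. b \<noteq> 0 \<Longrightarrow> \<bar>real_of_int b\<bar> \<le> B \<Longrightarrow> real (card {a. (a, b) \<in> S}) \<le> M"
  shows "real (card S) \<le> 2 * B * M"
proof -
  have "real (card S) \<le> real (card {b::int. b \<noteq> 0 \<and> \<bar>real_of_int b\<bar> \<le> B}) * M"
  proof (rule card_fibres_le)
    show "finite {b::int. b \<noteq> 0 \<and> \<bar>real_of_int b\<bar> \<le> B}"
      by (rule finite_subset[OF _ finite_int_abs_le]) auto
  qed (use assms finite_fibre_box[OF assms(1)] in \<open>auto simp: box_def\<close>)
  also have "\<dots> \<le> 2 * B * M" using assms by (intro mult_right_mono card_nonzero_int_abs_le)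
  finally show ?thesis .
qed

lemma card_box_le:
  assumes "B \<ge> 1"
  shows "real (card (box m B)) \<le> 6 * B ^ (m + 1)"
proof -
  have "real (card (box m B)) \<le> 2 * B * (3 * B ^ m)"
  proof (rule card_box_fibres_le)
    fix b :: int assume "b \<noteq> 0" "\<bar>real_of_int b\<bar> \<le> B"
    then have "{a. (a, b) \<in> box m B} = {a. \<bar>real_of_int a\<bar> \<le> B ^ m}" by (auto simp: box_def)
    moreover have "B ^ m \<ge> 1" using assms by (rule one_le_power)
    ultimately show "real (card {a. (a, b) \<in> box m B}) \<le> 3 * B ^ m"
      using card_int_abs_le[of "B ^ m"] by simp
  qed (use assms in auto)
  then show ?thesis by simp
qed

text \<open>A telescoping sum over all integers above \<open>M\<close>, the floor of
  \<open>y\<close>. The factor 2 comes from \<open>M \<ge> y / 2\<close>, which holds because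
  \<open>y < M + 1 \<le> 2 * M\<close>.\<close>

lemma sum_inverse_squares_le:
  assumes "finite P" "\<forall>p\<in>P. y < real_of_int p" "y \<ge> 1"
  shows "(\<Sum>p\<in>P. 1 / real_of_int p ^ 2) \<le> 2 / y"
proof -
  define M where "M = \<lfloor>y\<rfloor>"
  have M: "M \<ge> 1" "\<forall>p\<in>P. p > M"
    using assms unfolding M_def by (auto simp: floor_less_iff le_floor_iff)
  have "y < real_of_int M + 1" unfolding M_def by linarith
  with M(1) have M2: "real_of_int M \<ge> y / 2" by linarith
  have *: "(\<Sum>p\<in>{M<..N}. 1 / real_of_int p ^ 2) \<le> 1 / real_of_int M - 1 / real_of_int N" if "N \<ge> M" for N
    using that
  proof (induction N rule: int_ge_induct)
    case base
    then show ?case by simp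
  next
    case (step i)
    have "{M<..i + 1} = insert (i + 1) {M<..i}" using step by auto
    then have "(\<Sum>p\<in>{M<..i + 1}. 1 / real_of_int p ^ 2) = 1 / real_of_int (i + 1) ^ 2 + (\<Sum>p\<in>{M<..i}. 1 / real_of_int p ^ 2)"
      by simp
    moreover have "1 / real_of_int (i + 1) ^ 2 \<le> 1 / real_of_int i - 1 / real_of_int (i + 1)"
    proof -
      define t where "t = real_of_int i"
      have t: "t \<ge> 1" using step.hyps M(1) by (simp add: t_def)
      have "1 / (t + 1) ^ 2 \<le> 1 / (t * (t + 1))"
        using t by (intro divide_left_mono) (auto simp: power2_eq_square)
      also have "\<dots> = 1 / t - 1 / (t + 1)" using t by (simp add: field_simps)
      finally show ?thesis by (simp add: t_def)
    qed
    ultimately show ?case using step by linarith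
  qed
  define N where "N = Max (insert M P)"
  have "P \<subseteq> {M<..N}" using M assms(1) by (auto simp: N_def)
  then have "(\<Sum>p\<in>P. 1 / real_of_int p ^ 2) \<le> (\<Sum>p\<in>{M<..N}. 1 / real_of_int p ^ 2)"
    by (intro sum_mono2) auto
  also have "\<dots> \<le> 1 / real_of_int M - 1 / real_of_int N" using assms(1) by (intro *) (auto simp: N_def)
  also have "\<dots> \<le> 1 / real_of_int M" using M assms(1) by (simp add: N_def Max_ge_iff)
  also have "\<dots> \<le> 1 / (y / 2)" using M M2 assms(3) by (intro divide_left_mono) auto
  finally show ?thesis by simp
qed

section \<open>Families of pairs of density \<open>O(1 / sqrt (ln B))\<close>\<close>

definition negligible :: "nat \<Rightarrow> (real \<Rightarrow> (int \<times> int) set) \<Rightarrow> bool" where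
  "negligible m S \<longleftrightarrow> (\<exists>C. \<forall>\<^sub>F B in at_top. real (card (S B)) \<le> B ^ (m + 1) * (C / sqrt (ln B)))"

lemma negligibleI:
  assumes "\<forall>\<^sub>F B in at_top. real (card (S B)) \<le> B ^ (m + 1) * q B" "q \<in> O(\<lambda>B. 1 / sqrt (ln B))"
  shows "negligible m S"
proof -
  from assms(2) obtain C where "\<forall>\<^sub>F B in at_top. norm (q B) \<le> C * norm (1 / sqrt (ln B))"
    by (elim landau_o.bigE)
  then have "\<forall>\<^sub>F B in at_top. real (card (S B)) \<le> B ^ (m + 1) * (C / sqrt (ln B))"
    using assms(1) eventually_ge_at_top[of 1]
  proof eventually_elim
    case (elim B)
    have "q B \<le> C / sqrt (ln B)" using elim by auto
    then have "B ^ (m + 1) * q B \<le> B ^ (m + 1) * (C / sqrt (ln B))" using elim by (intro mult_left_mono) auto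
    then show ?case using elim by linarith
  qed
  then show ?thesis by (auto simp: negligible_def)
qed

lemma negligible_Un:
  assumes "negligible m S" "negligible m T"
  shows "negligible m (\<lambda>B. S B \<union> T B)"
proof -
  from assms obtain C D where "\<forall>\<^sub>F B in at_top. real (card (S B)) \<le> B ^ (m + 1) * (C / sqrt (ln B))"
    "\<forall>\<^sub>F B in at_top. real (card (T B)) \<le> B ^ (m + 1) * (D / sqrt (ln B))" by (auto simp: negligible_def)
  then have "\<forall>\<^sub>F B in at_top. real (card (S B \<union> T B)) \<le> B ^ (m + 1) * ((C + D) / sqrt (ln B))"
  proof eventually_elim
    case (elim B)
    have "real (card (S B \<union> T B)) \<le> real (card (S B)) + real (card (T B))"
      using card_Un_le[of "S B" "T B"] by linarith
    then show ?case using elim by (simp add: add_divide_distrib distrib_left)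
  qed
  then show ?thesis by (auto simp: negligible_def)
qed

lemma negligible_empty: "negligible m (\<lambda>B. {})"
  by (auto simp: negligible_def intro!: exI[of _ 0])

lemma negligible_UN:
  assumes "finite I" "\<And>i. i \<in> I \<Longrightarrow> negligible m (S i)"
  shows "negligible m (\<lambda>B. \<Union>i\<in>I. S i B)"
  using assms by (induction I rule: finite_induct) (auto intro: negligible_empty negligible_Un)

text \<open>For conditions in which \<open>a\<close> is counted with \<open>b\<close> fixed; there
  are at most \<open>2 * B\<close> values of \<open>b\<close>.\<close>

lemma negligible_fibresI:
  assumes "\<And>B. S B \<subseteq> box m B" "q \<in> O(\<lambda>B. 1 / sqrt (ln B))" "\<forall>\<^sub>F B in at_top. q B \<ge> 0"
    "\<forall>\<^sub>F B in at_top. \<forall>b. b \<noteq> 0 \<longrightarrow> \<bar>real_of_int b\<bar> \<le> B \<longrightarrow> real (card {a. (a, b) \<in> S B}) \<le> B ^ m * q B"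
  shows "negligible m S"
proof (rule negligibleI)
  show "(\<lambda>B. 2 * q B) \<in> O(\<lambda>B. 1 / sqrt (ln B))" using assms(2) by simp
  show "\<forall>\<^sub>F B in at_top. real (card (S B)) \<le> B ^ (m + 1) * (2 * q B)"
    using assms(3,4) eventually_ge_at_top[of 0]
  proof eventually_elim
    case (elim B)
    have "real (card (S B)) \<le> 2 * B * (B ^ m * q B)"
      using elim assms(1) by (intro card_box_fibres_le) auto
    then show ?case by (simp add: mult_ac)
  qed
qed

text \<open>For conditions on \<open>b\<close> alone: every \<open>b\<close> in \<open>Q B\<close>
  is charged a full fibre of at most \<open>3 * B ^ m\<close> values of \<open>a\<close>.\<close>

lemma negligible_box_snd:
  assumes "\<And>B. S B \<subseteq> box m B \<inter> UNIV \<times> Q B" "q \<in> O(\<lambda>B. 1 / sqrt (ln B))"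
    "\<forall>\<^sub>F B in at_top. finite (Q B)" "\<forall>\<^sub>F B in at_top. real (card (Q B)) \<le> B * q B"
  shows "negligible m S"
proof (rule negligibleI)
  show "(\<lambda>B. 3 * q B) \<in> O(\<lambda>B. 1 / sqrt (ln B))" using assms(2) by simp
  show "\<forall>\<^sub>F B in at_top. real (card (S B)) \<le> B ^ (m + 1) * (3 * q B)"
    using assms(3,4) eventually_ge_at_top[of 1]
  proof eventually_elim
    case (elim B)
    have Bm: "B ^ m \<ge> 1" using elim by (intro one_le_power)
    have "real (card (S B)) \<le> real (card (Q B)) * (3 * B ^ m)"
    proof (rule card_fibres_le)
      fix b
      have "real (card {a. (a, b) \<in> S B}) \<le> real (card {a::int. \<bar>real_of_int a\<bar> \<le> B ^ m})"
        using assms(1)[of B] unfolding of_nat_le_iff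
        by (intro card_mono finite_int_abs_le) (auto simp: box_def)
      also have "\<dots> \<le> 3 * B ^ m" using card_int_abs_le[of "B ^ m"] Bm by linarith
      finally show "real (card {a. (a, b) \<in> S B}) \<le> 3 * B ^ m" .
      show "finite {a. (a, b) \<in> S B}" using assms(1)[of B] by (intro finite_fibre_box[of _ m B]) auto
    qed (use elim assms(1) in auto)
    also have "\<dots> \<le> (B * q B) * (3 * B ^ m)" using elim Bm by (intro mult_right_mono) auto
    finally show ?case by (simp add: mult_ac)
  qed
qed

lemma real_card_UN_le:
  assumes "finite I" "\<And>i. i \<in> I \<Longrightarrow> real (card (S i)) \<le> M i"
  shows "real (card (\<Union>i\<in>I. S i)) \<le> (\<Sum>i\<in>I. M i)"
proof -
  have "real (card (\<Union>i\<in>I. S i)) \<le> real (\<Sum>i\<in>I. card (S i))" using card_UN_le[OF assms(1)] of_nat_le_iff by blast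
  also have "\<dots> \<le> (\<Sum>i\<in>I. M i)" unfolding of_nat_sum by (intro sum_mono assms)
  finally show ?thesis .
qed

section \<open>Exceptional pairs\<close>

text \<open>The bound \<open>y\<close> below which primes count as small, and the exponent \<open>k\<close> such that divisibility by
  \<open>p^k\<close> for some \<open>p \<le> y\<close> is exceptional. The choice makes both \<open>y / 2^(\<eta> k)\<close> smaller than any power of
  \<open>1 / y\<close> and \<open>y^(k y) = B^o(1)\<close>.\<close>

definition sbound :: "real \<Rightarrow> real" where
  "sbound B = sqrt (ln B)"

definition sexponent :: "real \<Rightarrow> nat" where
  "sexponent B = nat \<lceil>sqrt (sbound B)\<rceil>"

lemma sbound_at_top: "filterlim sbound at_top at_top"
  unfolding sbound_def by real_asymp

lemma eventually_sbound_ge: "\<forall>\<^sub>F B in at_top. sbound B \<ge> C"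
  using sbound_at_top by (auto simp: filterlim_at_top)

lemma inverse_sbound_bigo: "(\<lambda>B. 1 / sbound B) \<in> O(\<lambda>B. 1 / sqrt (ln B))"
  by (simp add: sbound_def)

lemma powr_neg_bigo: "\<epsilon> > 0 \<Longrightarrow> (\<lambda>B. B powr - \<epsilon>) \<in> O(\<lambda>B. 1 / sqrt (ln B))"
  by real_asymp

lemma bigo_cmult: "f \<in> O[F](g) \<Longrightarrow> (\<lambda>x. C * f x :: real) \<in> O[F](g)"
  by (cases "C = 0") auto

text \<open>There are at most \<open>y\<close> primes up to \<open>y\<close>, and each will
  contribute a proportion of order \<open>2^(-\<eta> k)\<close>. As \<open>k\<close> is at least
  \<open>(ln B)^(1/4)\<close>, the exponential beats every power of \<open>ln B\<close>.\<close>

lemma sbound_powr_sexponent_bigo: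
  assumes "\<eta> > 0"
  shows "(\<lambda>B. sbound B * 2 powr (- \<eta> * real (sexponent B))) \<in> O(\<lambda>B. 1 / sqrt (ln B))"
proof -
  have "(\<lambda>B. sbound B * 2 powr (- \<eta> * real (sexponent B))) \<in> O(\<lambda>B. sqrt (ln B) * 2 powr (- \<eta> * sqrt (sqrt (ln B))))"
  proof (rule bigoI[of _ 1], use eventually_ge_at_top[of 1] in eventually_elim)
    case (elim B)
    have "sqrt (sbound B) \<le> real (sexponent B)" unfolding sexponent_def by linarith
    then have "2 powr (- \<eta> * real (sexponent B)) \<le> 2 powr (- \<eta> * sqrt (sqrt (ln B)))"
      using assms by (intro powr_mono) (auto simp: sbound_def)
    then have "sqrt (ln B) * 2 powr (- \<eta> * real (sexponent B)) \<le> sqrt (ln B) * 2 powr (- \<eta> * sqrt (sqrt (ln B)))"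
      using elim by (intro mult_left_mono) auto
    then show ?case using elim by (simp add: sbound_def)
  qed
  also have "(\<lambda>B. sqrt (ln B) * 2 powr (- \<eta> * sqrt (sqrt (ln B)))) \<in> O(\<lambda>B. 1 / sqrt (ln B))"
    using assms by real_asymp
  finally show ?thesis .
qed

section \<open>Exceptional common factors and denominators\<close>

lemma negligible_common_factor:
  assumes "m \<ge> 1"
  shows "negligible m (\<lambda>B. {(a, b)\<in>box m B. \<exists>p. sbound B < real_of_int p \<and> p dvd a \<and> p dvd b})" (is "negligible _ ?S")
proof (rule negligibleI)
  show "(\<lambda>B. 12 * (1 / sbound B)) \<in> O(\<lambda>B. 1 / sqrt (ln B))"
    using inverse_sbound_bigo by (simp only: landau_o.big.cmult_in_iff)
  show "\<forall>\<^sub>F B in at_top. real (card (?S B))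
          \<le> B ^ (m + 1) * (12 * (1 / sbound B))"
    using eventually_sbound_ge[of 1] eventually_ge_at_top[of 1]
  proof eventually_elim
    case (elim B)
    define P where "P = {p::int. sbound B < real_of_int p \<and> real_of_int p \<le> B}"
    have finP: "finite P" by (rule finite_subset[OF _ finite_int_abs_le[of B]]) (use elim in \<open>auto simp: P_def\<close>)
    define S where "S = (\<lambda>p. {(a, b)\<in>box m B. p dvd a \<and> p dvd b})"
    have BA: "B \<le> B ^ m" using power_increasing[of 1 m B] assms elim by simp
    have le: "real_of_int p \<le> B" if "p dvd b" "b \<noteq> 0" "\<bar>real_of_int b\<bar> \<le> B" for p b :: int
      using dvd_imp_le_int[OF that(2,1)] that(3) by linarith
    have "(?S B) \<subseteq> (\<Union>p\<in>P. S p)"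
      using le by (auto simp: P_def S_def box_def)
    then have "real (card (?S B))
        \<le> real (card (\<Union>p\<in>P. S p))"
      using finP unfolding of_nat_le_iff by (intro card_mono finite_UN_I) (auto simp: S_def intro: finite_subset[OF _ finite_box[of m B]])
    also have "\<dots> \<le> (\<Sum>p\<in>P. 6 * B ^ (m + 1) * (1 / real_of_int p ^ 2))"
    proof (rule real_card_UN_le[OF finP])
      fix p assume "p \<in> P"
      then have p: "p > 0" "real_of_int p \<le> B" using elim by (auto simp: P_def)
      have "real (card (S p)) \<le> real (card {b::int. b \<noteq> 0 \<and> p dvd b \<and> \<bar>real_of_int b\<bar> \<le> B}) * (3 * B ^ m / p)"
      proof (rule card_fibres_le)
        show "finite {b::int. b \<noteq> 0 \<and> p dvd b \<and> \<bar>real_of_int b\<bar> \<le> B}"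
          by (rule finite_subset[OF _ finite_int_abs_le]) auto
        show "S p \<subseteq> UNIV \<times> {b::int. b \<noteq> 0 \<and> p dvd b \<and> \<bar>real_of_int b\<bar> \<le> B}"
          by (auto simp: S_def box_def)
        fix b assume b: "b \<in> {b::int. b \<noteq> 0 \<and> p dvd b \<and> \<bar>real_of_int b\<bar> \<le> B}"
        have eq: "{a. (a, b) \<in> S p} = {a. p dvd a \<and> \<bar>real_of_int a\<bar> \<le> B ^ m}"
          using b by (auto simp: S_def box_def)
        show "finite {a. (a, b) \<in> S p}" unfolding eq by (rule finite_subset[OF _ finite_int_abs_le]) auto
        have "real (card {a. (a, b) \<in> S p}) \<le> 2 * B ^ m / real_of_int p + 1"
          unfolding eq using p elim by (intro card_multiples_le) auto
        \<comment> \<open>Since \<open>p\<close> divides some \<open>b \<noteq> 0\<close> of the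
          box, \<open>p \<le> B \<le> B ^ m\<close>, and the \<open>+ 1\<close> is absorbed.\<close>
        also have "1 \<le> B ^ m / real_of_int p" using p BA by simp
        finally show "real (card {a. (a, b) \<in> S p}) \<le> 3 * B ^ m / real_of_int p" by simp
      qed
      also have "\<dots> \<le> (2 * B / p) * (3 * B ^ m / p)"
        using p elim by (intro mult_right_mono card_nonzero_multiples_le) auto
      finally show "real (card (S p)) \<le> 6 * B ^ (m + 1) * (1 / real_of_int p ^ 2)"
        by (simp add: power2_eq_square mult_ac)
    qed
    also have "\<dots> = 6 * B ^ (m + 1) * (\<Sum>p\<in>P. 1 / real_of_int p ^ 2)" by (simp add: sum_distrib_left)
    also have "\<dots> \<le> 6 * B ^ (m + 1) * (2 / sbound B)"
      using elim finP by (intro mult_left_mono sum_inverse_squares_le) (auto simp: P_def)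
    also have "\<dots> = B ^ (m + 1) * (12 * (1 / sbound B))" by simp
    finally show ?case .
  qed
qed

text \<open>Makes \<open>b\<close>, the value attached to the factor \<open>y\<close> of the
  discriminant form, almost as large as \<open>B\<close>.\<close>

lemma negligible_small_denominator:
  assumes "\<epsilon> > 0"
  shows "negligible m (\<lambda>B. {(a, b)\<in>box m B. \<bar>real_of_int b\<bar> \<le> B powr (1 - \<epsilon>)})"
proof (rule negligible_box_snd)
  show "(\<lambda>B. 2 * B powr - \<epsilon>) \<in> O(\<lambda>B. 1 / sqrt (ln B))" using powr_neg_bigo[OF assms] by simp
  define Q where "Q = (\<lambda>B. {b::int. b \<noteq> 0 \<and> \<bar>real_of_int b\<bar> \<le> B powr (1 - \<epsilon>)})"
  show "{(a, b)\<in>box m B. \<bar>real_of_int b\<bar> \<le> B powr (1 - \<epsilon>)} \<subseteq> box m B \<inter> UNIV \<times> Q B" for B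
    by (auto simp: Q_def box_def)
  show "\<forall>\<^sub>F B in at_top. finite (Q B)"
    unfolding Q_def by (intro always_eventually allI finite_subset[OF _ finite_int_abs_le]) auto
  show "\<forall>\<^sub>F B in at_top. real (card (Q B)) \<le> B * (2 * B powr - \<epsilon>)"
    using eventually_gt_at_top[of 0]
  proof eventually_elim
    case (elim B)
    have "B powr (1 - \<epsilon>) = B * B powr - \<epsilon>" using elim powr_add[of B 1 "-\<epsilon>"] by simp
    then show ?case using card_nonzero_int_abs_le[of "B powr (1 - \<epsilon>)", OF powr_ge_zero] by (simp only: Q_def mult_ac)
  qed
qed

text \<open>Justifies the weight 1 of the factor \<open>y\<close>: outside this set a large prime
  divides \<open>b\<close> at most once.\<close>

lemma negligible_denominator_square:
  shows "negligible m (\<lambda>B. {(a, b)\<in>box m B. \<exists>p. sbound B < real_of_int p \<and> p ^ 2 dvd b})"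
proof (rule negligible_box_snd)
  show "(\<lambda>B. 4 * (1 / sbound B)) \<in> O(\<lambda>B. 1 / sqrt (ln B))"
    using inverse_sbound_bigo by (simp only: landau_o.big.cmult_in_iff)
  define Q where "Q = (\<lambda>B. {b::int. b \<noteq> 0 \<and> \<bar>real_of_int b\<bar> \<le> B \<and> (\<exists>p. sbound B < real_of_int p \<and> p ^ 2 dvd b)})"
  show "{(a, b)\<in>box m B. \<exists>p. sbound B < real_of_int p \<and> p ^ 2 dvd b} \<subseteq> box m B \<inter> UNIV \<times> Q B" for B
    by (auto simp: Q_def box_def)
  show "\<forall>\<^sub>F B in at_top. finite (Q B)"
    unfolding Q_def by (intro always_eventually allI finite_subset[OF _ finite_int_abs_le]) auto
  show "\<forall>\<^sub>F B in at_top. real (card (Q B)) \<le> B * (4 * (1 / sbound B))"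
    using eventually_sbound_ge[of 1] eventually_ge_at_top[of 1]
  proof eventually_elim
    case (elim B)
    define P where "P = {p::int. sbound B < real_of_int p \<and> real_of_int p \<le> B}"
    have finP: "finite P" by (rule finite_subset[OF _ finite_int_abs_le[of B]]) (use elim in \<open>auto simp: P_def\<close>)
    have pos: "p > 0" if "sbound B < real_of_int p" for p using that elim by linarith
    have le: "real_of_int p \<le> B" if "p ^ 2 dvd b" "b \<noteq> 0" "\<bar>real_of_int b\<bar> \<le> B" "p > 0" for p b :: int
    proof -
      have "p \<le> p ^ 2" using that(4) by (simp add: power2_eq_square)
      with dvd_imp_le_int[OF that(2,1)] have "p \<le> \<bar>b\<bar>" by simp
      with that(3) show ?thesis by linarith
    qed
    have "Q B \<subseteq> (\<Union>p\<in>P. {b. b \<noteq> 0 \<and> p ^ 2 dvd b \<and> \<bar>real_of_int b\<bar> \<le> B})"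
      using le pos by (auto simp: P_def Q_def)
    then have "real (card (Q B)) \<le> real (card (\<Union>p\<in>P. {b. b \<noteq> 0 \<and> p ^ 2 dvd b \<and> \<bar>real_of_int b\<bar> \<le> B}))"
      using finP unfolding of_nat_le_iff by (intro card_mono finite_UN_I) (auto intro: finite_subset[OF _ finite_int_abs_le[of B]])
    also have "\<dots> \<le> (\<Sum>p\<in>P. 2 * B * (1 / real_of_int p ^ 2))"
    proof (rule real_card_UN_le[OF finP])
      fix p assume "p \<in> P"
      then have "p > 0" using pos by (auto simp: P_def)
      then show "real (card {b. b \<noteq> 0 \<and> p ^ 2 dvd b \<and> \<bar>real_of_int b\<bar> \<le> B}) \<le> 2 * B * (1 / real_of_int p ^ 2)"
        using card_nonzero_multiples_le[of "p ^ 2" B] elim by simp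
    qed
    also have "\<dots> = 2 * B * (\<Sum>p\<in>P. 1 / real_of_int p ^ 2)" by (simp add: sum_distrib_left)
    also have "\<dots> \<le> 2 * B * (2 / sbound B)"
      using elim finP by (intro mult_left_mono sum_inverse_squares_le) (auto simp: P_def)
    also have "\<dots> = B * (4 * (1 / sbound B))" by simp
    finally show ?case .
  qed
qed

text \<open>Serves as the trivial bound for the number of primes up to \<open>u\<close>; starting at
  2 avoids a \<open>+ 1\<close>.\<close>

lemma card_int_between_le: "u \<ge> 1 \<Longrightarrow> finite {p::int. 2 \<le> p \<and> real_of_int p \<le> u} \<and> real (card {p::int. 2 \<le> p \<and> real_of_int p \<le> u}) \<le> u"
proof -
  assume u: "u \<ge> 1"
  have "{p::int. 2 \<le> p \<and> real_of_int p \<le> u} = {2..\<lfloor>u\<rfloor>}" by (auto simp: le_floor_iff)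
  then show ?thesis using u by (auto simp: le_floor_iff) linarith
qed

lemma negligible_denominator_small_primes:
  shows "negligible m (\<lambda>B. {(a, b)\<in>box m B. \<exists>p\<ge>2. real_of_int p \<le> sbound B \<and> p ^ sexponent B dvd b})"
proof (rule negligible_box_snd)
  show "(\<lambda>B. 2 * (sbound B * 2 powr (- 1 * real (sexponent B)))) \<in> O(\<lambda>B. 1 / sqrt (ln B))"
    by (rule landau_o.big.cmult_in_iff[THEN iffD2, OF _ sbound_powr_sexponent_bigo]) simp_all
  define Q where "Q = (\<lambda>B. {b::int. b \<noteq> 0 \<and> \<bar>real_of_int b\<bar> \<le> B \<and> (\<exists>p\<ge>2. real_of_int p \<le> sbound B \<and> p ^ sexponent B dvd b)})"
  show "{(a, b)\<in>box m B. \<exists>p\<ge>2. real_of_int p \<le> sbound B \<and> p ^ sexponent B dvd b} \<subseteq> box m B \<inter> UNIV \<times> Q B" for B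
    by (auto simp: Q_def box_def)
  show "\<forall>\<^sub>F B in at_top. finite (Q B)"
    unfolding Q_def by (intro always_eventually allI finite_subset[OF _ finite_int_abs_le]) auto
  show "\<forall>\<^sub>F B in at_top. real (card (Q B)) \<le> B * (2 * (sbound B * 2 powr (- 1 * real (sexponent B))))"
    using eventually_sbound_ge[of 1] eventually_ge_at_top[of 1]
  proof eventually_elim
    case (elim B)
    define k where "k = sexponent B"
    define P where "P = {p::int. 2 \<le> p \<and> real_of_int p \<le> sbound B}"
    have P: "finite P" "real (card P) \<le> sbound B" using card_int_between_le[of "sbound B"] elim by (auto simp: P_def)
    have "Q B \<subseteq> (\<Union>p\<in>P. {b. b \<noteq> 0 \<and> p ^ k dvd b \<and> \<bar>real_of_int b\<bar> \<le> B})"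
      by (auto simp: P_def Q_def k_def)
    then have "real (card (Q B)) \<le> real (card (\<Union>p\<in>P. {b. b \<noteq> 0 \<and> p ^ k dvd b \<and> \<bar>real_of_int b\<bar> \<le> B}))"
      using P unfolding of_nat_le_iff by (intro card_mono finite_UN_I) (auto intro: finite_subset[OF _ finite_int_abs_le[of B]])
    also have "\<dots> \<le> (\<Sum>p\<in>P. 2 * B / 2 ^ k)"
    proof (rule real_card_UN_le[OF P(1)])
      fix p assume "p \<in> P"
      then have p: "p \<ge> 2" by (auto simp: P_def)
      then have "real (card {b. b \<noteq> 0 \<and> p ^ k dvd b \<and> \<bar>real_of_int b\<bar> \<le> B}) \<le> 2 * B / real_of_int (p ^ k)"
        using elim by (intro card_nonzero_multiples_le) auto
      also have "\<dots> \<le> 2 * B / 2 ^ k" using p elim by (intro divide_left_mono) (auto intro!: power_mono)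
      finally show "real (card {b. b \<noteq> 0 \<and> p ^ k dvd b \<and> \<bar>real_of_int b\<bar> \<le> B}) \<le> 2 * B / 2 ^ k" .
    qed
    also have "\<dots> = real (card P) * (2 * B / 2 ^ k)" by simp
    also have "\<dots> \<le> sbound B * (2 * B / 2 ^ k)" using P elim by (intro mult_right_mono) auto
    also have "\<dots> = B * (2 * (sbound B * (1 / 2 ^ k)))" by simp
    also have "1 / 2 ^ k = (2::real) powr (- 1 * real (sexponent B))"
      by (simp add: k_def powr_minus powr_realpow divide_inverse)
    finally show ?case .
  qed
qed

section \<open>Pairs at which a form takes an unusually small value\<close>

lemma of_int_fval:
  assumes "c \<noteq> 0"
  shows "(of_int (fval h a c) :: 'a :: field_char_0) =
    of_int c ^ degree h * poly (map_poly of_int h) (of_int a / of_int c)"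
proof -
  have "poly (map_poly of_int h) (of_int a / of_int c :: 'a) = (\<Sum>i\<le>degree h. of_int (coeff h i) * (of_int a / of_int c) ^ i)"
    by (simp add: poly_altdef coeff_map_poly degree_map_poly)
  also have "of_int c ^ degree h * \<dots> = (\<Sum>i\<le>degree h. of_int (coeff h i) * of_int a ^ i * of_int c ^ (degree h - i))"
    unfolding sum_distrib_left
  proof (rule sum.cong[OF refl], goal_cases)
    case (1 i)
    then have "(of_int c :: 'a) ^ degree h = of_int c ^ i * of_int c ^ (degree h - i)"
      by (simp flip: power_add)
    then show ?case using assms by (simp add: power_divide)
  qed
  finally show ?thesis by (simp add: fval_def)
qed

lemma fval_linear_factors:
  obtains root :: "nat \<Rightarrow> complex" where
    "\<And>a c. c \<noteq> 0 \<Longrightarrow> of_int (fval h a c) = of_int (lead_coeff h) * (\<Prod>i<degree h. of_int a - root i * of_int c)"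
proof -
  let ?h = "map_poly of_int h :: complex poly"
  obtain root where root: "smult (lead_coeff ?h) (\<Prod>i<degree ?h. [:- root i, 1:]) = ?h"
    using complex_poly_decompose' by blast
  have deg: "degree ?h = degree h" "lead_coeff ?h = of_int (lead_coeff h)"
    by (simp_all add: coeff_map_poly degree_map_poly)
  show ?thesis
  proof (rule that)
    fix a c :: int assume c: "c \<noteq> 0"
    have "poly ?h (of_int a / of_int c) = of_int (lead_coeff h) * (\<Prod>i<degree h. of_int a / of_int c - root i)"
      by (subst root[symmetric]) (simp add: deg(1) deg(2)[unfolded deg(1)] poly_prod)
    then have "of_int (fval h a c) = of_int (lead_coeff h) * ((\<Prod>i<degree h. of_int c) * (\<Prod>i<degree h. of_int a / of_int c - root i))"
      using of_int_fval[OF c, of h a, where 'a = complex] by simp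
    also have "(\<Prod>i<degree h. of_int c) * (\<Prod>i<degree h. of_int a / of_int c - root i) = (\<Prod>i<degree h. of_int a - root i * of_int c)"
      unfolding prod.distrib[symmetric] using c by (intro prod.cong) (auto simp: field_simps)
    finally show "of_int (fval h a c) = of_int (lead_coeff h) * (\<Prod>i<degree h. of_int a - root i * of_int c)" .
  qed
qed

text \<open>If the value is small, some complex linear factor \<open>a - root j * b ^ m\<close> has
  modulus at most \<open>L\<close>, since otherwise the product exceeds \<open>L ^ r\<close>. The
  real part alone then confines \<open>a\<close> to an interval of length
  \<open>2 * L\<close>.\<close>

lemma negligible_small_value:
  assumes "degree h \<ge> 1" "\<epsilon> > 0" "m \<ge> 1"
  shows "negligible m (\<lambda>B. {(a, b)\<in>box m B. \<bar>real_of_int (fval h a (b ^ m))\<bar> \<le> B powr (real (m * degree h) - \<epsilon>)})" (is "negligible _ ?S")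
proof -
  obtain root :: "nat \<Rightarrow> complex" where root: "\<And>a c. c \<noteq> 0 \<Longrightarrow> of_int (fval h a c) = of_int (lead_coeff h) * (\<Prod>i<degree h. of_int a - root i * of_int c)"
    using fval_linear_factors[of h] by blast
  define r where "r = degree h"
  \<comment> \<open>\<open>\<eta> * r \<le> \<epsilon>\<close> makes \<open>L ^ r\<close> at least
    the threshold; \<open>\<eta> \<le> 1\<close> keeps \<open>L \<ge> 1\<close>, so that an interval
    of length \<open>2 * L\<close> holds at most \<open>3 * L\<close> integers.\<close>
  define \<eta> where "\<eta> = min \<epsilon> 1 / real r"
  have r: "r \<ge> 1" using assms by (simp add: r_def)
  then have "\<eta> * real r = min \<epsilon> 1" by (simp add: \<eta>_def)
  moreover from this r have "\<eta> * 1 \<le> \<eta> * real r" using assms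
    by (intro mult_left_mono) (auto simp: \<eta>_def)
  ultimately have \<eta>: "\<eta> > 0" "\<eta> \<le> 1" "\<eta> * real r \<le> \<epsilon>"
    using assms r by (simp_all add: \<eta>_def)
  have lc: "\<bar>real_of_int (lead_coeff h)\<bar> \<ge> 1"
  proof -
    have "lead_coeff h \<noteq> 0" using assms by auto
    then have "\<bar>lead_coeff h\<bar> \<ge> 1" by linarith
    then show ?thesis by linarith
  qed
  show ?thesis
  proof (rule negligible_fibresI)
    show "(\<lambda>B. 3 * real r * B powr - \<eta>) \<in> O(\<lambda>B. 1 / sqrt (ln B))"
      by (rule landau_o.big.cmult_in_iff[THEN iffD2, OF _ powr_neg_bigo[OF \<eta>(1)]]) (use r in simp)
    show "\<forall>\<^sub>F B in at_top. 0 \<le> 3 * real r * B powr - \<eta>" by simp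
    show "\<forall>\<^sub>F B in at_top. \<forall>b. b \<noteq> 0 \<longrightarrow> \<bar>real_of_int b\<bar> \<le> B \<longrightarrow>
        real (card {a. (a, b) \<in> (?S B)})
          \<le> B ^ m * (3 * real r * B powr - \<eta>)"
      using eventually_ge_at_top[of 1]
    proof eventually_elim
      case B: (elim B)
      show ?case
      proof (intro allI impI)
        fix b :: int assume b: "b \<noteq> 0" "\<bar>real_of_int b\<bar> \<le> B"
        note elim = B b
        define L where "L = B ^ m * B powr - \<eta>"
        have L: "L = B powr (real m - \<eta>)" using elim powr_add[of B "real m" "-\<eta>"] by (simp add: L_def powr_realpow)
        then have L1: "L \<ge> 1" using elim \<eta> assms(3) by (simp add: ge_one_powr_ge_zero)
        have Lr: "L ^ r \<ge> B powr (real (m * degree h) - \<epsilon>)"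
        proof -
          have "L ^ r = B powr ((real m - \<eta>) * real r)" unfolding L using B by (simp add: powr_powr[symmetric] powr_realpow)
          also have "\<dots> \<ge> B powr (real (m * degree h) - \<epsilon>)"
            using elim \<eta> by (intro powr_mono) (auto simp: r_def algebra_simps)
          finally show ?thesis .
        qed
        define I where "I = (\<lambda>j. {a::int. Re (root j * of_int (b ^ m)) - L \<le> of_int a \<and> of_int a \<le> Re (root j * of_int (b ^ m)) + L})"
        have finI: "finite (I j)" for j
          by (rule finite_subset[OF _ finite_int_abs_le[of "\<bar>Re (root j * of_int (b ^ m))\<bar> + L"]]) (auto simp: I_def)
        have "{a. \<bar>real_of_int (fval h a (b ^ m))\<bar> \<le> B powr (real (m * degree h) - \<epsilon>)} \<subseteq> (\<Union>j<r. I j)"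
        proof (rule subsetI, rule ccontr)
          fix a assume a: "a \<in> {a. \<bar>real_of_int (fval h a (b ^ m))\<bar> \<le> B powr (real (m * degree h) - \<epsilon>)}"
            and notin: "a \<notin> (\<Union>j<r. I j)"
          have far: "L < cmod (of_int a - root j * of_int (b ^ m))" if "j < r" for j
          proof -
            have "a \<notin> I j" using notin that by auto
            then have "L < \<bar>Re (of_int a - root j * of_int (b ^ m))\<bar>" by (auto simp: I_def)
            also have "\<dots> \<le> cmod (of_int a - root j * of_int (b ^ m))" by (rule abs_Re_le_cmod)
            finally show ?thesis .
          qed
          have "\<bar>real_of_int (fval h a (b ^ m))\<bar> = cmod (of_int (fval h a (b ^ m)))"
            by (simp only: norm_of_int)
          also have "\<dots> = \<bar>real_of_int (lead_coeff h)\<bar> * (\<Prod>j<r. cmod (of_int a - root j * of_int (b ^ m)))"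
            using elim by (subst root) (simp_all add: norm_mult prod_norm r_def del: of_int_power)
          finally have v1: "\<bar>real_of_int (fval h a (b ^ m))\<bar> = \<bar>real_of_int (lead_coeff h)\<bar> * (\<Prod>j<r. cmod (of_int a - root j * of_int (b ^ m)))" .
          have v2: "\<bar>real_of_int (lead_coeff h)\<bar> * (\<Prod>j<r. cmod (of_int a - root j * of_int (b ^ m))) \<ge> 1 * (\<Prod>j<r. cmod (of_int a - root j * of_int (b ^ m)))"
            using lc by (intro mult_right_mono prod_nonneg) auto
          have v3: "(\<Prod>j<r. L) < (\<Prod>j<r. cmod (of_int a - root j * of_int (b ^ m)))"
          proof (rule prod_mono_strict[of 0])
            show "0 < cmod (of_int a - root j * of_int (b ^ m))" if "j \<in> {..<r}" for j
              using order.strict_trans2[OF order.strict_trans2[OF zero_less_one L1] less_imp_le[OF far[of j]]] that by blast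
            show "0 \<le> L \<and> L \<le> cmod (of_int a - root j * of_int (b ^ m))" if "j \<in> {..<r}" for j
              using far[of j] L1 that by simp
          qed (use far[of 0] r in auto)
          have "\<bar>real_of_int (fval h a (b ^ m))\<bar> > L ^ r" using v1 v2 v3 by simp
          with a Lr show False by simp
        qed
        then have "{a. (a, b) \<in> (?S B)} \<subseteq> (\<Union>j<r. I j)"
          by auto
        then have "real (card {a. (a, b) \<in> (?S B)})
            \<le> real (card (\<Union>j<r. I j))"
          unfolding of_nat_le_iff using finI by (intro card_mono) auto
        also have "\<dots> \<le> (\<Sum>j<r. 3 * L)"
        proof (rule real_card_UN_le)
          fix j
          show "real (card (I j)) \<le> 3 * L" unfolding I_def
            using card_int_interval_le[of "Re (root j * of_int (b ^ m)) - L" "Re (root j * of_int (b ^ m)) + L"] L1 by linarith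
        qed auto
        also have "\<dots> = B ^ m * (3 * real r * B powr - \<eta>)" by (simp add: L_def)
        finally show "real (card {a. (a, b) \<in> (?S B)})
            \<le> B ^ m * (3 * real r * B powr - \<eta>)" .
      qed
    qed
  qed auto
qed

section \<open>High powers of small primes dividing a value\<close>

lemma eventually_two_power_sexponent_ge: "\<forall>\<^sub>F B in at_top. 2 ^ sexponent B \<ge> (C :: real)"
  using eventually_sbound_ge[of "max C 0 ^ 2"]
proof eventually_elim
  case (elim B)
  have "C \<le> sqrt (max C 0 ^ 2)" by simp
  also have "\<dots> \<le> sqrt (sbound B)" using elim by (rule real_sqrt_le_mono)
  also have "\<dots> \<le> real (sexponent B)" unfolding sexponent_def by linarith
  also have "\<dots> \<le> 2 ^ sexponent B" by (metis less_imp_le of_nat_less_two_power)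
  finally show ?case .
qed

text \<open>A window of length \<open>L\<close> contains at most \<open>r\<close> solutions, with
  the same \<open>L\<close> for all \<open>p \<ge> 2\<close>. So each prime costs a proportion of
  order \<open>1 / L\<close>, a fixed negative power of \<open>2 ^ k\<close>.\<close>

lemma negligible_value_small_primes:
  assumes "h \<noteq> 0" "m \<ge> 1"
  shows "negligible m (\<lambda>B. {(a, b)\<in>box m B. \<exists>p\<ge>2. real_of_int p \<le> sbound B \<and> p ^ sexponent B dvd fval h a (b ^ m)})" (is "negligible _ ?S")
proof -
  define r where "r = degree h"
  define l where "l = \<bar>real_of_int (lead_coeff h)\<bar>"
  define e where "e = 1 / real ((r + 1) ^ 2)"
  have l: "l \<ge> 1"
  proof -
    have "lead_coeff h \<noteq> 0" using assms by auto
    then have "\<bar>lead_coeff h\<bar> \<ge> 1" by linarith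
    then show ?thesis unfolding l_def by linarith
  qed
  have e: "e > 0" by (simp add: e_def)
  define c where "c = 2 * real r * (2 * l) powr e"
  define q where "q = (\<lambda>B. c * (sbound B * 2 powr (- e * real (sexponent B))) + real r * (sbound B / B))"
  show ?thesis
  proof (rule negligible_fibresI)
    have "(\<lambda>B. sbound B / B) \<in> O(\<lambda>B. 1 / sqrt (ln B))" unfolding sbound_def by real_asymp
    then show "q \<in> O(\<lambda>B. 1 / sqrt (ln B))" unfolding q_def
      by (intro sum_in_bigo(1) bigo_cmult sbound_powr_sexponent_bigo[OF e])
    show "\<forall>\<^sub>F B in at_top. 0 \<le> q B" using eventually_sbound_ge[of 0] eventually_ge_at_top[of 1]
      by eventually_elim (use l in \<open>auto simp: q_def c_def\<close>)
    show "\<forall>\<^sub>F B in at_top. \<forall>b. b \<noteq> 0 \<longrightarrow> \<bar>real_of_int b\<bar> \<le> B \<longrightarrow>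
        real (card {a. (a, b) \<in> (?S B)})
          \<le> B ^ m * q B"
      using eventually_two_power_sexponent_ge[of "2 * l"] eventually_sbound_ge[of 1] eventually_ge_at_top[of 1]
    proof eventually_elim
      case (elim B)
      define k where "k = sexponent B"
      \<comment> \<open>Chosen so that \<open>l * L ^ ((r + 1) ^ 2) = 2 ^ k / 2 < p ^ k\<close>,
        which is what \<open>fval_window_bound\<close> asks for.\<close>
      define L where "L = (2 ^ k / (2 * l)) powr e"
      have L1: "L \<ge> 1" using elim l e by (simp add: L_def k_def ge_one_powr_ge_zero)
      have Lpow: "L ^ ((r + 1) ^ 2) = 2 ^ k / (2 * l)"
      proof -
        have "L ^ ((r + 1) ^ 2) = L powr real ((r + 1) ^ 2)" using L1 by (subst powr_realpow) auto
        also have "\<dots> = 2 ^ k / (2 * l)" using l by (simp add: L_def powr_powr e_def)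
        finally show ?thesis .
      qed
      have invL: "1 / L = (2 * l) powr e * 2 powr (- e * real k)"
      proof -
        have "L = 2 powr (real k * e) / (2 * l) powr e"
          using l by (simp add: L_def powr_divide powr_powr[symmetric] powr_realpow)
        then show ?thesis by (simp add: powr_minus divide_inverse mult_ac)
      qed
      have BB: "B \<le> B ^ m" using power_increasing[of 1 m B] assms elim by simp
      define P where "P = {p::int. 2 \<le> p \<and> real_of_int p \<le> sbound B}"
      have P: "finite P" "real (card P) \<le> sbound B" using card_int_between_le[of "sbound B"] elim by (auto simp: P_def)
      show ?case
      proof (intro allI impI)
        fix b :: int
        define S where "S = (\<lambda>p. {a::int. \<bar>real_of_int a\<bar> \<le> B ^ m \<and> p ^ k dvd fval h a (b ^ m)})"
        have "{a. (a, b) \<in> (?S B)} \<subseteq> (\<Union>p\<in>P. S p)"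
          by (auto simp: box_def P_def S_def k_def)
        moreover have "finite (S p)" for p by (rule finite_subset[OF _ finite_int_abs_le]) (auto simp: S_def)
        ultimately have "real (card {a. (a, b) \<in> (?S B)})
            \<le> real (card (\<Union>p\<in>P. S p))"
          unfolding of_nat_le_iff using P by (intro card_mono) auto
        also have "\<dots> \<le> (\<Sum>p\<in>P. real r * (2 * B ^ m / L + 1))"
        proof (rule real_card_UN_le[OF P(1)])
          fix p assume "p \<in> P"
          then have p: "p \<ge> 2" by (simp add: P_def)
          show "real (card (S p)) \<le> real r * (2 * B ^ m / L + 1)"
          proof (rule card_le_windows)
            fix Y assume Y: "Y \<subseteq> S p" "finite Y" "\<forall>x\<in>Y. \<forall>y\<in>Y. \<bar>real_of_int (x - y)\<bar> < L"
            have "l * L ^ ((r + 1) ^ 2) < 2 ^ k" unfolding Lpow using l by simp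
            also have "(2::real) ^ k \<le> real_of_int p ^ k" using p by (intro power_mono) auto
            finally show "card Y \<le> r"
              using Y L1 assms(1) unfolding r_def l_def
              by (intro fval_window_bound[where q = "p ^ k" and c = "b ^ m" and L = L]) (auto simp: S_def intro: less_imp_le)
          qed (use L1 elim in \<open>auto simp: S_def\<close>)
        qed
        also have "\<dots> = real (card P) * (real r * (2 * B ^ m / L + 1))" by simp
        also have "\<dots> \<le> sbound B * (real r * (2 * B ^ m / L + 1))"
          using P L1 elim by (intro mult_right_mono) auto
        also have "\<dots> \<le> sbound B * (real r * (2 * B ^ m / L + B ^ m / B))"
          using BB elim by (intro mult_left_mono add_left_mono) auto
        also have "\<dots> = B ^ m * (2 * real r * (sbound B * (1 / L)) + real r * (sbound B / B))"
          by (simp add: algebra_simps)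
        also have "\<dots> = B ^ m * q B" unfolding invL by (simp add: q_def c_def k_def mult_ac)
        finally show "real (card {a. (a, b) \<in> (?S B)}) \<le> B ^ m * q B" .
      qed
    qed
  qed auto
qed

section \<open>Bezout identities and squares of medium primes\<close>

lemma map_poly_mult_hom:
  assumes "f 0 = 0" "\<And>x y. f (x + y) = f x + f y" "\<And>x y. f (x * y) = f x * f y"
  shows "map_poly f (p * q) = map_poly f p * map_poly f q"
proof -
  have "f (sum g A) = (\<Sum>x\<in>A. f (g x))" for g and A :: "nat set"
    by (induction A rule: infinite_finite_induct) (auto simp: assms)
  then show ?thesis by (intro poly_eqI) (simp add: coeff_map_poly coeff_mult assms)
qed

lemma map_poly_add_hom:
  assumes "f 0 = 0" "\<And>x y. f (x + y) = f x + f y"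
  shows "map_poly f (p + q) = map_poly f p + map_poly f q"
  by (intro poly_eqI) (simp add: coeff_map_poly assms)

lemma fval_bezout:
  assumes "[:R:] = u * h + v * g" "c \<noteq> 0"
  shows "\<exists>N x y. R * c ^ N = x * fval h a c + y * fval g a c"
proof -
  define e where "e = (\<lambda>p. poly (map_poly rat_of_int p) (of_int a / of_int c))"
  define d where "d = (\<lambda>p::int poly. degree p)"
  have fv: "rat_of_int (fval p a c) = of_int c ^ d p * e p" for p
    unfolding e_def d_def using of_int_fval[OF assms(2), where 'a = rat] by simp
  have "e [:R:] = e u * e h + e v * e g"
    unfolding assms(1) by (simp add: e_def map_poly_add_hom map_poly_mult_hom)
  then have R: "rat_of_int R = e u * e h + e v * e g" by (simp add: e_def map_poly_pCons)
  \<comment> \<open>The sum of all four degrees is an exponent that homogenizes both products at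
    once, without comparing the degrees of \<open>u * h\<close> and \<open>v * g\<close>.\<close>
  have "rat_of_int (R * c ^ (d u + d h + d v + d g)) =
      rat_of_int ((fval u a c * c ^ (d v + d g)) * fval h a c + (fval v a c * c ^ (d u + d h)) * fval g a c)"
    by (simp add: fv R algebra_simps power_add)
  then have "R * c ^ (d u + d h + d v + d g) =
      (fval u a c * c ^ (d v + d g)) * fval h a c + (fval v a c * c ^ (d u + d h)) * fval g a c"
    unfolding of_int_eq_iff .
  then show ?thesis by blast
qed

lemma prime_dvd_fval_both:
  assumes "[:R:] = u * h + v * g" "Factorial_Ring.prime p" "p dvd fval h a c" "p dvd fval g a c" "\<not> p dvd c"
  shows "p dvd R"
proof -
  have "c \<noteq> 0" using assms(5) by auto
  with fval_bezout[OF assms(1)] obtain N x y where N: "R * c ^ N = x * fval h a c + y * fval g a c" by blast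
  have "p dvd R * c ^ N" unfolding N using assms by (intro dvd_add dvd_mult)
  then show ?thesis using assms(2,5) by (auto simp: prime_dvd_mult_iff dest: prime_dvd_power)
qed

text \<open>The remainder \<open>k\<close> lies in the ring itself, with no division by 2; this is
  what lets divisibility by a square be read off.\<close>

lemma poly_taylor_square:
  fixes P :: "'a::idom poly"
  shows "\<exists>k. poly P y = poly P x + (y - x) * poly (pderiv P) x + (y - x) ^ 2 * k"
proof (induction P)
  case 0
  then show ?case by (auto intro: exI[of _ 0])
next
  case (pCons c P)
  then obtain k where k: "poly P y = poly P x + (y - x) * poly (pderiv P) x + (y - x) ^ 2 * k" by blast
  have "poly (pCons c P) y = poly (pCons c P) x + (y - x) * poly (pderiv (pCons c P)) x + (y - x) ^ 2 * (poly (pderiv P) x + y * k)"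
    by (simp add: k pderiv_pCons power2_eq_square algebra_simps)
  then show ?case by blast
qed

lemma pderiv_fval_poly: "pderiv (fval_poly h c) = fval_poly (pderiv h) c"
proof (rule poly_eqI)
  fix i
  have *: "coeff (fval_poly g c) j = (if j \<le> degree g then coeff g j * c ^ (degree g - j) else 0)" for g :: "int poly" and j
    by (simp add: fval_poly_def coeff_sum)
  have "degree (pderiv h) = degree h - 1" by (simp add: degree_pderiv)
  then show "coeff (pderiv (fval_poly h c)) i = coeff (fval_poly (pderiv h) c) i"
    by (auto simp: coeff_pderiv * coeff_eq_0)
qed

text \<open>Uniqueness in Hensel's lemma: modulo \<open>p ^ 2\<close> the Taylor expansion at the
  root \<open>x\<close> reduces to \<open>y - x\<close> times the derivative, and the Bezout
  identity makes the derivative at \<open>x\<close> a unit modulo \<open>p\<close>.\<close>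

lemma simple_root_lift:
  assumes "[:R:] = u * h + v * pderiv h" "Factorial_Ring.prime p" "\<not> p dvd R" "\<not> p dvd c"
    and "p ^ 2 dvd fval h x c" "p ^ 2 dvd fval h y c" "p dvd y - x"
  shows "p ^ 2 dvd y - x"
proof -
  obtain k where k: "fval h y c = fval h x c + (y - x) * fval (pderiv h) x c + (y - x) ^ 2 * k"
    using poly_taylor_square[of "fval_poly h c" y x] by (auto simp: pderiv_fval_poly poly_fval_poly)
  have "p ^ 2 dvd (y - x) ^ 2 * k" using assms(7) by (intro dvd_mult2 dvd_power_same)
  then have "p ^ 2 dvd (y - x) * fval (pderiv h) x c"
    using k assms(5,6) by (metis add_diff_cancel_left' add_diff_cancel_right' dvd_diff)
  moreover have "\<not> p dvd fval (pderiv h) x c"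
    using prime_dvd_fval_both[OF assms(1,2) _ _ assms(4)] assms(3,5) by (meson dvd_power dvd_trans zero_less_numeral)
  then have "coprime (p ^ 2) (fval (pderiv h) x c)"
    using assms(2) by (simp add: prime_imp_coprime)
  ultimately show ?thesis by (simp add: coprime_dvd_mult_left_iff)
qed

text \<open>Among \<open>degree h + 1\<close> solutions the Vandermonde product, divisible by
  \<open>p\<close>, exhibits two that agree modulo \<open>p\<close>. They then agree modulo
  \<open>p ^ 2\<close>, which the window excludes. Compared with \<open>fval_window_bound\<close>
  the window has grown to the full modulus.\<close>

lemma card_square_roots_window:
  assumes "[:R:] = u * h + v * pderiv h" "Factorial_Ring.prime p" "\<not> p dvd R" "\<not> p dvd c" "\<not> p dvd lead_coeff h"
    and "finite S" "\<forall>x\<in>S. p ^ 2 dvd fval h x c" "\<forall>x\<in>S. \<forall>y\<in>S. \<bar>x - y\<bar> < p ^ 2"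
  shows "card S \<le> degree h"
proof (rule ccontr)
  assume "\<not> ?thesis"
  then obtain Y where Y: "Y \<subseteq> S" "card Y = Suc (degree h)"
    by (metis not_less_eq_eq obtain_subset_with_card_n)
  then have "finite Y" using assms(6) finite_subset by blast
  then obtain xs where xs: "set xs = Y" "distinct xs" using finite_distinct_list by blast
  then have len: "length xs = Suc (degree h)" using Y distinct_card by metis
  have "\<forall>x\<in>S. p dvd fval h x c" using assms(7) dvd_trans[of p "p ^ 2"] by simp
  then have "p dvd coeff (fval_poly h c) (degree h) * vandermonde xs"
    using xs len Y degree_fval_poly
    by (intro dvd_lead_coeff_vandermonde) (auto simp: poly_fval_poly)
  then have "p dvd vandermonde xs" using assms(2,5) by (simp add: coeff_fval_poly prime_dvd_mult_iff)
  then obtain x y where xy: "x \<in> S" "y \<in> S" "x \<noteq> y" "p dvd y - x"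
    using prime_dvd_vandermonde[OF assms(2) _ xs(2)] xs Y by blast
  then have "p ^ 2 dvd y - x" using assms(7) by (intro simple_root_lift[OF assms(1-4)]) auto
  then have "\<bar>p ^ 2\<bar> \<le> \<bar>y - x\<bar>" using xy by (intro dvd_imp_le_int) auto
  moreover have "\<bar>y - x\<bar> < p ^ 2" using assms(8) xy by blast
  ultimately show False by simp
qed

text \<open>For each \<open>b\<close> a prime costs \<open>r * (2 * B ^ m / p ^ 2 + 1)\<close>. The
  first terms sum to order \<open>B ^ m / y\<close>; the second ones count the primes and force the
  cutoff \<open>B powr (m - \<epsilon>)\<close>.\<close>

lemma negligible_value_medium_squares:
  assumes bez: "[:R:] = u * h + v * pderiv h" "R \<noteq> 0" and h: "h \<noteq> 0" and m: "m \<ge> 1" and \<epsilon>: "0 < \<epsilon>" "\<epsilon> \<le> 1"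
  shows "negligible m (\<lambda>B. {(a, b)\<in>box m B. \<exists>p. Factorial_Ring.prime p \<and> sbound B < real_of_int p \<and>
    real_of_int p \<le> B powr (real m - \<epsilon>) \<and> \<not> p dvd b \<and> p ^ 2 dvd fval h a (b ^ m)})"
proof -
  define r where "r = degree h"
  define q where "q = (\<lambda>B. real r * 4 * (1 / sbound B) + real r * B powr - \<epsilon>)"
  define E where "E = (\<lambda>B. {(a, b)\<in>box m B. \<exists>p. Factorial_Ring.prime p \<and> sbound B < real_of_int p \<and>
    real_of_int p \<le> B powr (real m - \<epsilon>) \<and> \<not> p dvd b \<and> p ^ 2 dvd fval h a (b ^ m)})"
  have "negligible m E"
  proof (rule negligible_fibresI)
    show "q \<in> O(\<lambda>B. 1 / sqrt (ln B))" unfolding q_def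
      by (intro sum_in_bigo(1) bigo_cmult inverse_sbound_bigo powr_neg_bigo \<epsilon>)
    show "\<forall>\<^sub>F B in at_top. 0 \<le> q B" using eventually_sbound_ge[of 0]
      by eventually_elim (auto simp: q_def)
    show "\<forall>\<^sub>F B in at_top. \<forall>b. b \<noteq> 0 \<longrightarrow> \<bar>real_of_int b\<bar> \<le> B \<longrightarrow> real (card {a. (a, b) \<in> E B}) \<le> B ^ m * q B"
      \<comment> \<open>A prime above this bound divides neither \<open>R\<close> nor the leading
        coefficient of \<open>h\<close>.\<close>
      using eventually_sbound_ge[of "max 1 (max \<bar>real_of_int R\<bar> \<bar>real_of_int (lead_coeff h)\<bar>)"] eventually_ge_at_top[of 1]
    proof eventually_elim
      case (elim B)
      define U where "U = B powr (real m - \<epsilon>)"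
      have U: "U = B ^ m * B powr - \<epsilon>" using elim powr_add[of B "real m" "-\<epsilon>"] by (simp add: U_def powr_realpow)
      have U1: "U \<ge> 1" using elim m \<epsilon> by (simp add: U_def ge_one_powr_ge_zero)
      define P where "P = {p. Factorial_Ring.prime p \<and> sbound B < real_of_int p \<and> real_of_int p \<le> U}"
      have "P \<subseteq> {p::int. 2 \<le> p \<and> real_of_int p \<le> U}" by (auto simp: P_def prime_ge_2_int)
      then have P: "finite P" "real (card P) \<le> U"
        using card_int_between_le[OF U1] card_mono[of "{p::int. 2 \<le> p \<and> real_of_int p \<le> U}" P]
        by (auto intro: finite_subset)
      show ?case
      proof (intro allI impI)
        fix b :: int
        define S where "S = (\<lambda>p. {a::int. \<bar>real_of_int a\<bar> \<le> B ^ m \<and> \<not> p dvd b \<and> p ^ 2 dvd fval h a (b ^ m)})"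
        have "{a. (a, b) \<in> E B} \<subseteq> (\<Union>p\<in>P. S p)"
          by (auto simp: box_def P_def S_def E_def U_def)
        moreover have "finite (S p)" for p by (rule finite_subset[OF _ finite_int_abs_le]) (auto simp: S_def)
        ultimately have "real (card {a. (a, b) \<in> E B}) \<le> real (card (\<Union>p\<in>P. S p))"
          unfolding of_nat_le_iff using P by (intro card_mono) auto
        also have "\<dots> \<le> (\<Sum>p\<in>P. real r * (2 * B ^ m / real_of_int (p ^ 2) + 1))"
        proof (rule real_card_UN_le[OF P(1)])
          fix p assume "p \<in> P"
          then have p: "Factorial_Ring.prime p" "sbound B < real_of_int p" by (auto simp: P_def)
          have ndvd: "\<not> p dvd z" if "z \<noteq> 0" "\<bar>real_of_int z\<bar> \<le> sbound B" for z
            using dvd_imp_le_int[OF that(1), of p] that(2) p(2) by linarith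
          have nR: "\<not> p dvd R" and nl: "\<not> p dvd lead_coeff h"
            using bez(2) h elim ndvd[of R] ndvd[of "lead_coeff h"] by auto
          show "real (card (S p)) \<le> real r * (2 * B ^ m / real_of_int (p ^ 2) + 1)"
          proof (rule card_le_windows)
            fix Y assume Y: "Y \<subseteq> S p" "finite Y" "\<forall>x\<in>Y. \<forall>y\<in>Y. \<bar>real_of_int (x - y)\<bar> < real_of_int (p ^ 2)"
            show "card Y \<le> r"
            proof (cases "Y = {}")
              case False
              then have "\<not> p dvd b" using Y by (auto simp: S_def)
              then have "\<not> p dvd b ^ m" using p(1) prime_dvd_power by blast
              moreover have "\<forall>x\<in>Y. \<forall>y\<in>Y. \<bar>x - y\<bar> < p ^ 2"
                using Y(3) unfolding of_int_abs[symmetric] of_int_less_iff .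
              ultimately show ?thesis unfolding r_def
                using Y nR nl by (intro card_square_roots_window[OF bez(1) p(1), where c = "b ^ m"]) (auto simp: S_def)
            qed auto
          qed (use p elim in \<open>auto simp: S_def prime_gt_0_int\<close>)
        qed
        also have "\<dots> = real r * (2 * B ^ m * (\<Sum>p\<in>P. 1 / real_of_int p ^ 2) + real (card P))"
          by (simp add: sum_distrib_left sum.distrib distrib_left mult_ac)
        also have "\<dots> \<le> real r * (2 * B ^ m * (2 / sbound B) + U)"
          using elim P by (intro mult_left_mono add_mono sum_inverse_squares_le) (auto simp: P_def)
        also have "\<dots> = B ^ m * q B" by (simp add: q_def U algebra_simps)
        finally show "real (card {a. (a, b) \<in> E B}) \<le> B ^ m * q B" .
      qed
    qed
  qed (auto simp: E_def)
  then show ?thesis by (simp only: E_def)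
qed

section \<open>Primitive lattice points and squares of large primes\<close>

text \<open>Fix a vector \<open>u\<close> of maximal sup norm in \<open>S\<close>. The determinants of \<open>u\<close> with the other vectors
  are multiples of \<open>q\<close>, and at most three vectors share the same determinant, since they differ by
  integer multiples of \<open>u\<close>.\<close>

lemma card_primitive_lattice_points_le:
  fixes S :: "(int \<times> int) set"
  assumes S: "S \<subseteq> box 1 B" "\<forall>(a, b)\<in>S. coprime a b" and q: "q > 0" and B: "B \<ge> 1"
    and det: "\<forall>(a, b)\<in>S. \<forall>(a', b')\<in>S. q dvd a * b' - a' * b"
  shows "real (card S) \<le> 3 * (4 * B ^ 2 / real_of_int q + 1)"
proof (cases "S = {}")
  case True
  then show ?thesis using q by simp
next
  case False
  have finS: "finite S" using S(1) finite_box finite_subset by blast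
  define nrm where "nrm = (\<lambda>(a::int, b::int). max \<bar>a\<bar> \<bar>b\<bar>)"
  have "Max (nrm ` S) \<in> nrm ` S" using finS False by (intro Max_in) auto
  then obtain a0 b0 where u: "(a0, b0) \<in> S" "Max (nrm ` S) = nrm (a0, b0)" by auto
  define M where "M = nrm (a0, b0)"
  have le: "\<bar>a\<bar> \<le> M \<and> \<bar>b\<bar> \<le> M" if "(a, b) \<in> S" for a b
  proof -
    have "nrm (a, b) \<le> M" using finS that u(2) unfolding M_def by (metis Max_ge finite_imageI imageI)
    then show ?thesis by (simp add: nrm_def)
  qed
  have M: "M \<ge> 1" "real_of_int M \<le> B" using u(1) S(1) by (auto simp: M_def nrm_def box_def)
  have cop: "coprime a0 b0" using u(1) S(2) by auto
  define T where "T = {t::int. \<bar>real_of_int t\<bar> \<le> 2 * B ^ 2 / real_of_int q}"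
  have finT: "finite T" unfolding T_def by (rule finite_int_abs_le)
  define F where "F = (\<lambda>t. {(a, b)\<in>S. a0 * b - a * b0 = q * t})"
  have "S \<subseteq> (\<Union>t\<in>T. F t)"
  proof (clarify)
    fix a b assume ab: "(a, b) \<in> S"
    then have "q dvd a0 * b - a * b0" using det u(1) by fastforce
    then obtain t where t: "a0 * b - a * b0 = q * t" by (auto simp: dvd_def)
    have "\<bar>a0 * b - a * b0\<bar> \<le> \<bar>a0\<bar> * \<bar>b\<bar> + \<bar>a\<bar> * \<bar>b0\<bar>"
      by (metis abs_mult abs_triangle_ineq4)
    also have "\<dots> \<le> M * M + M * M" using le[OF ab] le[OF u(1)] M(1) by (intro add_mono mult_mono) auto
    finally have "\<bar>q * t\<bar> \<le> 2 * M ^ 2" by (simp add: t power2_eq_square)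
    then have "real_of_int \<bar>q * t\<bar> \<le> real_of_int (2 * M ^ 2)" by (simp only: of_int_le_iff)
    also have "\<dots> \<le> 2 * B ^ 2" using M by (auto intro!: power_mono)
    finally have "\<bar>real_of_int t\<bar> \<le> 2 * B ^ 2 / real_of_int q" using q by (simp add: abs_mult field_simps)
    then show "(a, b) \<in> (\<Union>t\<in>T. F t)" using ab t by (auto simp: T_def F_def)
  qed
  then have "card S \<le> card (\<Union>t\<in>T. F t)" using finT finS by (intro card_mono) (auto simp: F_def intro: finite_subset[of _ S])
  also have "real \<dots> \<le> (\<Sum>t\<in>T. 3)"
  proof (rule real_card_UN_le[OF finT])
    fix t
    show "real (card (F t)) \<le> 3"
    proof (cases "F t = {}")
      case False
      then obtain a1 b1 where v: "(a1, b1) \<in> F t" by auto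
      \<comment> \<open>The integers within distance 1 of \<open>- c1 / c0\<close>, at most three;
        they contain every \<open>s\<close> for which \<open>c1 + s * c0\<close> is no larger in
        absolute value than \<open>c0 \<noteq> 0\<close>.\<close>
      define W where "W = (\<lambda>c0 c1. {s::int. - (real_of_int c1 / real_of_int c0) - 1 \<le> of_int s \<and> of_int s \<le> - (real_of_int c1 / real_of_int c0) + 1})"
      have W: "finite (W c0 c1)" "real (card (W c0 c1)) \<le> 3" for c0 c1
      proof -
        show "finite (W c0 c1)"
          by (rule finite_subset[OF _ finite_int_abs_le[of "\<bar>real_of_int c1 / real_of_int c0\<bar> + 1"]])
            (auto simp: W_def simp del: abs_divide; linarith)
        show "real (card (W c0 c1)) \<le> 3" unfolding W_def
          using card_int_interval_le[of "- (real_of_int c1 / real_of_int c0) - 1" "- (real_of_int c1 / real_of_int c0) + 1"] by simp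
      qed
      have inW: "s \<in> W c0 c1" if "\<bar>c1 + s * c0\<bar> \<le> \<bar>c0\<bar>" "c0 \<noteq> 0" for s c0 c1
      proof -
        have "real_of_int \<bar>c1 + s * c0\<bar> \<le> real_of_int \<bar>c0\<bar>" using that(1) by (simp only: of_int_le_iff)
        then have "\<bar>real_of_int c1 + of_int s * of_int c0\<bar> / \<bar>real_of_int c0\<bar> \<le> 1" using that(2) by simp
        then have "\<bar>(real_of_int c1 + of_int s * of_int c0) / real_of_int c0\<bar> \<le> 1" by (simp add: abs_divide)
        then have "\<bar>real_of_int c1 / real_of_int c0 + of_int s\<bar> \<le> 1" using that(2) by (simp add: add_divide_distrib)
        then show ?thesis by (auto simp: W_def)
      qed
      have sub: "\<exists>s. a = a1 + s * a0 \<and> b = b1 + s * b0" if "(a, b) \<in> F t" for a b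
      proof -
        have *: "a0 * (b - b1) = (a - a1) * b0" using that v by (auto simp: F_def algebra_simps)
        then have "a0 dvd (a - a1) * b0" by (metis dvd_triv_left)
        then have "a0 dvd a - a1" using cop by (simp add: coprime_dvd_mult_left_iff)
        then obtain s where s: "a - a1 = a0 * s" by (auto simp: dvd_def)
        show ?thesis
        proof (cases "a0 = 0")
          case True
          then have "\<bar>b0\<bar> = 1" using cop by simp
          \<comment> \<open>Here \<open>b0\<close> is 1 or -1, so \<open>b0 * b0 = 1\<close>
            supplies the multiple.\<close>
          then have "b = b1 + ((b - b1) * b0) * b0" by (cases "b0 \<ge> 0") auto
          then show ?thesis using s True by (intro exI[of _ "(b - b1) * b0"]) auto
        next
          case False
          then have "b - b1 = s * b0" using * s by simp
          then show ?thesis using s by (intro exI[of _ s]) (auto simp: algebra_simps)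
        qed
      qed
      \<comment> \<open>Use the coordinate in which \<open>(a0, b0)\<close> attains its norm
        \<open>M\<close>: that coordinate of every point of \<open>S\<close> is bounded by
        \<open>M\<close>, and this bounds \<open>s\<close>.\<close>
      obtain c0 c1 where c: "F t \<subseteq> (\<lambda>s. (a1 + s * a0, b1 + s * b0)) ` W c0 c1"
      proof (cases "\<bar>a0\<bar> = M")
        case True
        have "F t \<subseteq> (\<lambda>s. (a1 + s * a0, b1 + s * b0)) ` W a0 a1"
        proof clarify
          fix a b assume ab: "(a, b) \<in> F t"
          then obtain s where s: "a = a1 + s * a0" "b = b1 + s * b0" using sub by blast
          have "\<bar>a\<bar> \<le> \<bar>a0\<bar>" using ab le True by (auto simp: F_def)
          then have "s \<in> W a0 a1" using s True M by (intro inW) auto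
          then show "(a, b) \<in> (\<lambda>s. (a1 + s * a0, b1 + s * b0)) ` W a0 a1" using s by blast
        qed
        then show ?thesis by (rule that)
      next
        case False
        then have b0: "\<bar>b0\<bar> = M" by (auto simp: M_def nrm_def max_def split: if_splits)
        have "F t \<subseteq> (\<lambda>s. (a1 + s * a0, b1 + s * b0)) ` W b0 b1"
        proof clarify
          fix a b assume ab: "(a, b) \<in> F t"
          then obtain s where s: "a = a1 + s * a0" "b = b1 + s * b0" using sub by blast
          have "\<bar>b\<bar> \<le> \<bar>b0\<bar>" using ab le b0 by (auto simp: F_def)
          then have "s \<in> W b0 b1" using s b0 M by (intro inW) auto
          then show "(a, b) \<in> (\<lambda>s. (a1 + s * a0, b1 + s * b0)) ` W b0 b1" using s by blast
        qed
        then show ?thesis by (rule that)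
      qed
      have "card (F t) \<le> card ((\<lambda>s. (a1 + s * a0, b1 + s * b0)) ` W c0 c1)"
        using c W by (intro card_mono) auto
      also have "\<dots> \<le> card (W c0 c1)" using W by (intro card_image_le)
      finally show ?thesis using W(2)[of c0 c1] by linarith
    qed auto
  qed
  also have "(\<Sum>t\<in>T. 3) = 3 * real (card T)" by simp
  also have "\<dots> \<le> 3 * (2 * (2 * B ^ 2 / real_of_int q) + 1)"
    unfolding T_def using q by (intro mult_left_mono card_int_abs_le) auto
  finally show ?thesis by simp
qed

text \<open>The ratio \<open>a / b\<close> modulo \<open>p ^ 2\<close> is a root of
  \<open>h\<close>, so it takes at most \<open>degree h\<close> values, and pairs with equal ratio
  have determinants divisible by \<open>p ^ 2\<close>. All \<open>b\<close> are treated together, so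
  the \<open>+ 1\<close> occurs once per root and not once per \<open>b\<close>.\<close>

lemma card_primitive_square_values_le:
  assumes bez: "[:R:] = u * h + v * pderiv h" and p: "Factorial_Ring.prime p"
    and "\<not> p dvd R" "\<not> p dvd lead_coeff h" and B: "B \<ge> 1"
    and S: "S \<subseteq> box 1 B" "\<forall>(a, b)\<in>S. coprime a b \<and> \<not> p dvd b \<and> p ^ 2 dvd fval h a b"
  shows "real (card S) \<le> 3 * real (degree h) * (4 * B ^ 2 / real_of_int p ^ 2 + 1)"
proof -
  have p0: "p > 0" using p prime_gt_0_int by blast
  have finS: "finite S" using S(1) finite_box finite_subset by blast
  have "\<exists>\<beta>. (b * \<beta>) mod p ^ 2 = 1 mod p ^ 2" if "\<not> p dvd b" for b
  proof -
    have "coprime (p ^ 2) b" using p that by (simp add: prime_imp_coprime)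
    then show ?thesis by (metis bezout_int coprime_iff_gcd_eq_1 mod_mult_self3 mult.commute mod_mult_self1 add.commute)
  qed
  then obtain iv where iv: "\<And>b. \<not> p dvd b \<Longrightarrow> (b * iv b) mod p ^ 2 = 1 mod p ^ 2" by metis
  \<comment> \<open>The residue of \<open>a / b\<close> modulo \<open>p ^ 2\<close>, reduced to
    \<open>[0, p ^ 2)\<close> so that all values lie in one window.\<close>
  define \<phi> where "\<phi> = (\<lambda>(a, b). (a * iv b) mod p ^ 2)"
  define Y where "Y = \<phi> ` S"
  have finY: "finite Y" using finS by (simp add: Y_def)
  have cong: "p ^ 2 dvd b * \<phi> (a, b) - a" if "\<not> p dvd b" for a b
  proof -
    have "(b * \<phi> (a, b)) mod p ^ 2 = (a * (b * iv b)) mod p ^ 2" by (simp add: \<phi>_def mod_mult_right_eq mult_ac)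
    also have "\<dots> = (a * ((b * iv b) mod p ^ 2)) mod p ^ 2" by (simp add: mod_mult_right_eq)
    also have "\<dots> = a mod p ^ 2" unfolding iv[OF that] by (simp add: mod_mult_right_eq)
    finally show ?thesis by (simp add: mod_eq_dvd_iff)
  qed
  have "card Y \<le> degree h"
  proof (rule card_square_roots_window[OF bez p])
    show "\<not> p dvd 1" using p by auto
    show "\<forall>x\<in>Y. \<forall>y\<in>Y. \<bar>x - y\<bar> < p ^ 2"
    proof (intro ballI)
      fix x y assume "x \<in> Y" "y \<in> Y"
      then have "0 \<le> x" "x < p ^ 2" "0 \<le> y" "y < p ^ 2" using p0 by (auto simp: Y_def \<phi>_def)
      then show "\<bar>x - y\<bar> < p ^ 2" by linarith
    qed
    show "\<forall>x\<in>Y. p ^ 2 dvd fval h x 1"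
    proof
      fix x assume "x \<in> Y"
      then obtain a b where ab: "(a, b) \<in> S" "x = \<phi> (a, b)" by (auto simp: Y_def)
      then have nb: "\<not> p dvd b" and dv: "p ^ 2 dvd fval h a b" using S(2) by auto
      \<comment> \<open>As \<open>a\<close> is congruent to \<open>b * x\<close>, homogeneity
        transfers the divisibility from \<open>(a, b)\<close> to \<open>(x, 1)\<close>.\<close>
      have hom: "fval h (b * x) (b * 1) = b ^ degree h * fval h x 1"
        unfolding fval_def sum_distrib_left
      proof (rule sum.cong[OF refl], goal_cases)
        case (1 i)
        then have "b ^ degree h = b ^ i * b ^ (degree h - i)" by (simp flip: power_add)
        then show ?case by (simp add: power_mult_distrib)
      qed
      have "b * x - a dvd poly (fval_poly h b) (b * x) - poly (fval_poly h b) a"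
      proof -
        obtain k where "poly (fval_poly h b) (b * x) = poly (fval_poly h b) a
            + (b * x - a) * poly (pderiv (fval_poly h b)) a + (b * x - a) ^ 2 * k"
          using poly_taylor_square by blast
        then have "poly (fval_poly h b) (b * x) - poly (fval_poly h b) a
            = (b * x - a) * (poly (pderiv (fval_poly h b)) a + (b * x - a) * k)"
          by (simp add: power2_eq_square algebra_simps)
        then show ?thesis by simp
      qed
      then have "p ^ 2 dvd fval h (b * x) b - fval h a b"
        using cong[OF nb, of a] ab(2) by (metis dvd_trans poly_fval_poly)
      then have "p ^ 2 dvd fval h (b * x) b" using dv by (metis diff_add_cancel dvd_add)
      then have "p ^ 2 dvd b ^ degree h * fval h x 1" using hom by simp
      moreover have "coprime (p ^ 2) (b ^ degree h)" using p nb by (simp add: prime_imp_coprime)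
      ultimately show "p ^ 2 dvd fval h x 1" by (simp add: coprime_dvd_mult_right_iff)
    qed
  qed (use assms finY in auto)
  have "S \<subseteq> (\<Union>x\<in>Y. {s\<in>S. \<phi> s = x})" by (auto simp: Y_def)
  then have "real (card S) \<le> real (card (\<Union>x\<in>Y. {s\<in>S. \<phi> s = x}))"
    unfolding of_nat_le_iff using finY finS by (intro card_mono) auto
  also have "\<dots> \<le> (\<Sum>x\<in>Y. 3 * (4 * B ^ 2 / real_of_int (p ^ 2) + 1))"
  proof (rule real_card_UN_le[OF finY])
    fix x
    show "real (card {s\<in>S. \<phi> s = x}) \<le> 3 * (4 * B ^ 2 / real_of_int (p ^ 2) + 1)"
    proof (rule card_primitive_lattice_points_le)
      show "\<forall>(a, b)\<in>{s\<in>S. \<phi> s = x}. \<forall>(a', b')\<in>{s\<in>S. \<phi> s = x}. p ^ 2 dvd a * b' - a' * b"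
      proof clarify
        fix a b a' b' assume *: "(a, b) \<in> S" "(a', b') \<in> S" "\<phi> (a', b') = \<phi> (a, b)"
        define z where "z = \<phi> (a, b)"
        have "p ^ 2 dvd b * z - a" "p ^ 2 dvd b' * z - a'"
          using cong[of b a] cong[of b' a'] * S(2) by (auto simp: z_def)
        then have "p ^ 2 dvd (b' * z - a') * b - (b * z - a) * b'" 
          by (rule dvd_diff[OF dvd_mult2 dvd_mult2, rotated])
        then show "p ^ 2 dvd a * b' - a' * b" by (simp add: algebra_simps)
      qed
    qed (use S p0 B in auto)
  qed
  also have "\<dots> = real (card Y) * (3 * (4 * B ^ 2 / real_of_int (p ^ 2) + 1))" by simp
  also have "\<dots> \<le> real (degree h) * (3 * (4 * B ^ 2 / real_of_int (p ^ 2) + 1))"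
    using \<open>card Y \<le> _\<close> by (intro mult_right_mono) auto
  finally show ?thesis by (simp add: mult_ac)
qed

lemma abs_fval_le:
  assumes "\<bar>real_of_int a\<bar> \<le> A" "\<bar>real_of_int c\<bar> \<le> A" "A \<ge> 0"
  shows "\<bar>real_of_int (fval h a c)\<bar> \<le> (\<Sum>i\<le>degree h. \<bar>real_of_int (coeff h i)\<bar>) * A ^ degree h"
proof -
  have "\<bar>real_of_int (fval h a c)\<bar> \<le> (\<Sum>i\<le>degree h. \<bar>real_of_int (coeff h i * a ^ i * c ^ (degree h - i))\<bar>)"
    unfolding fval_def of_int_sum by (rule sum_abs)
  also have "\<dots> \<le> (\<Sum>i\<le>degree h. \<bar>real_of_int (coeff h i)\<bar> * A ^ degree h)"
  proof (intro sum_mono)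
    fix i assume "i \<in> {..degree h}"
    then have "A ^ degree h = A ^ i * A ^ (degree h - i)" by (simp flip: power_add)
    moreover have "\<bar>real_of_int a\<bar> ^ i * \<bar>real_of_int c\<bar> ^ (degree h - i) \<le> A ^ i * A ^ (degree h - i)"
      using assms by (intro mult_mono power_mono) auto
    ultimately show "\<bar>real_of_int (coeff h i * a ^ i * c ^ (degree h - i))\<bar> \<le> \<bar>real_of_int (coeff h i)\<bar> * A ^ degree h"
      by (simp add: abs_mult power_abs mult.assoc mult_left_mono)
  qed
  finally show ?thesis by (simp add: sum_distrib_right)
qed

text \<open>The \<open>+ 1\<close> per prime is affordable while \<open>p\<close> is at most of
  order \<open>B powr (3/2)\<close>. Since \<open>p ^ s\<close> divides a nonzero value of order at
  most \<open>B ^ degree h\<close>, the condition \<open>2 * degree h \<le> 3 * s\<close> guarantees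
  this.\<close>

lemma negligible_primitive_large_squares:
  assumes bez: "[:R:] = u * h + v * pderiv h" "R \<noteq> 0" and h: "h \<noteq> 0" and \<epsilon>: "0 < \<epsilon>" "\<epsilon> < 1"
    and s: "s \<ge> 2" "2 * degree h \<le> 3 * s"
  shows "negligible 1 (\<lambda>B. {(a, b)\<in>box 1 B. coprime a b \<and> fval h a b \<noteq> 0 \<and> (\<exists>p. Factorial_Ring.prime p \<and>
    B powr (1 - \<epsilon>) \<le> real_of_int p \<and> \<not> p dvd b \<and> p ^ s dvd fval h a b)})"
proof -
  define r where "r = degree h"
  define K where "K = max 1 (\<Sum>i\<le>degree h. \<bar>real_of_int (coeff h i)\<bar>)"
  define q where "q = (\<lambda>B. 48 * real r * B powr - (1 - \<epsilon>) + 3 * real r * K * B powr - (1/2))"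
  define E where "E = (\<lambda>B. {(a, b)\<in>box 1 B. coprime a b \<and> fval h a b \<noteq> 0 \<and> (\<exists>p. Factorial_Ring.prime p \<and>
    B powr (1 - \<epsilon>) \<le> real_of_int p \<and> \<not> p dvd b \<and> p ^ s dvd fval h a b)})"
  have "negligible 1 E"
  proof (rule negligibleI)
    show "q \<in> O(\<lambda>B. 1 / sqrt (ln B))" unfolding q_def
      using \<epsilon> by (intro sum_in_bigo(1) bigo_cmult powr_neg_bigo) auto
    have "\<forall>\<^sub>F B in at_top. B powr (1 - \<epsilon>) \<ge> 2 + max \<bar>real_of_int R\<bar> \<bar>real_of_int (lead_coeff h)\<bar>"
    proof -
      have "filterlim (\<lambda>B. B powr (1 - \<epsilon>)) at_top at_top" using \<epsilon> by real_asymp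
      then show ?thesis by (simp add: filterlim_at_top)
    qed
    then show "\<forall>\<^sub>F B in at_top. real (card (E B)) \<le> B ^ (1 + 1) * q B"
      using eventually_ge_at_top[of 1]
    proof eventually_elim
      case (elim B)
      \<comment> \<open>The \<open>- 1\<close> produces the strict inequality that
        \<open>sum_inverse_squares_le\<close> expects.\<close>
      define y where "y = B powr (1 - \<epsilon>) - 1"
      define U where "U = K * B powr (3/2)"
      have B32: "B powr (3/2) \<ge> 1" using elim by (simp add: ge_one_powr_ge_zero)
      have K1: "K \<ge> 1" by (simp add: K_def)
      have U1: "U \<ge> 1" unfolding U_def using K1 B32 mult_mono[of 1 K 1 "B powr (3/2)"] by simp
      have y1: "y \<ge> 1" "y \<ge> B powr (1 - \<epsilon>) / 2" using elim by (auto simp: y_def)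
      define P where "P = {p. Factorial_Ring.prime p \<and> B powr (1 - \<epsilon>) \<le> real_of_int p \<and> real_of_int p \<le> U}"
      have "P \<subseteq> {p::int. 2 \<le> p \<and> real_of_int p \<le> U}" by (auto simp: P_def prime_ge_2_int)
      then have P: "finite P" "real (card P) \<le> U"
        using card_int_between_le[OF U1] card_mono[of "{p::int. 2 \<le> p \<and> real_of_int p \<le> U}" P]
        by (auto intro: finite_subset)
      define S where "S = (\<lambda>p. {(a, b)\<in>box 1 B. coprime a b \<and> \<not> p dvd b \<and> p ^ 2 dvd fval h a b})"
      have "E B \<subseteq> (\<Union>p\<in>P. S p)"
      proof clarify
        fix a b assume "(a, b) \<in> E B"
        then obtain p where ab: "(a, b) \<in> box 1 B" "coprime a b" "fval h a b \<noteq> 0"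
          and p: "Factorial_Ring.prime p" "B powr (1 - \<epsilon>) \<le> real_of_int p" "\<not> p dvd b" "p ^ s dvd fval h a b"
          by (auto simp: E_def)
        have p0: "p > 0" using p(1) prime_gt_0_int by blast
        have "p ^ s \<le> \<bar>fval h a b\<bar>" using dvd_imp_le_int[OF ab(3) p(4)] p0 by simp
        then have "real_of_int (p ^ s) \<le> real_of_int \<bar>fval h a b\<bar>" by (simp only: of_int_le_iff)
        also have "\<dots> \<le> K * B ^ degree h"
          using abs_fval_le[of a B b h] ab(1) elim unfolding K_def
          by (auto simp: box_def elim!: order.trans intro!: mult_right_mono)
        also have "\<dots> \<le> K ^ s * B powr (3/2 * real s)"
        proof (intro mult_mono)
          show "K \<le> K ^ s" using K1 s(1) power_increasing[of 1 s K] by simp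
          have "B ^ degree h = B powr real (degree h)" using elim by (simp add: powr_realpow)
          also have "\<dots> \<le> B powr (3/2 * real s)" using elim s(2) by (intro powr_mono) linarith+
          finally show "B ^ degree h \<le> B powr (3/2 * real s)" .
        qed (use K1 elim in auto)
        also have "\<dots> = U ^ s"
        proof -
          have "B powr (3/2 * real s) = (B powr (3/2)) powr real s" by (rule powr_powr[symmetric])
          also have "\<dots> = (B powr (3/2)) ^ s" using elim by (intro powr_realpow) auto
          finally show ?thesis by (simp only: U_def power_mult_distrib)
        qed
        finally have "real_of_int p ^ s \<le> U ^ s" by simp
        then have "real_of_int p \<le> U" using s U1 p0 by (subst (asm) power_mono_iff) auto
        moreover have "p ^ 2 dvd fval h a b" using dvd_trans[OF le_imp_power_dvd[OF s(1)] p(4)] .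
        ultimately show "(a, b) \<in> (\<Union>p\<in>P. S p)" using ab p by (auto simp: P_def S_def)
      qed
      then have "real (card (E B)) \<le> real (card (\<Union>p\<in>P. S p))"
        unfolding of_nat_le_iff using P by (intro card_mono) (auto simp: S_def intro: finite_subset[OF _ finite_box[of 1 B]])
      also have "\<dots> \<le> (\<Sum>p\<in>P. 3 * real r * (4 * B ^ 2 / real_of_int p ^ 2 + 1))"
      proof (rule real_card_UN_le[OF P(1)])
        fix p assume "p \<in> P"
        then have p: "Factorial_Ring.prime p" "B powr (1 - \<epsilon>) \<le> real_of_int p" by (auto simp: P_def)
        have ndvd: "\<not> p dvd z" if "z \<noteq> 0" "2 + \<bar>real_of_int z\<bar> \<le> B powr (1 - \<epsilon>)" for z
          using dvd_imp_le_int[OF that(1), of p] that(2) p(2) by linarith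
        have "\<not> p dvd R" "\<not> p dvd lead_coeff h"
          using bez(2) h elim ndvd[of R] ndvd[of "lead_coeff h"] by auto
        then show "real (card (S p)) \<le> 3 * real r * (4 * B ^ 2 / real_of_int p ^ 2 + 1)"
          unfolding r_def using elim
          by (intro card_primitive_square_values_le[OF bez(1) p(1)]) (auto simp: S_def)
      qed
      also have "\<dots> = 3 * real r * (4 * B ^ 2 * (\<Sum>p\<in>P. 1 / real_of_int p ^ 2) + real (card P))"
        by (simp add: sum_distrib_left sum.distrib distrib_left mult_ac)
      also have "\<dots> \<le> 3 * real r * (4 * B ^ 2 * (2 / y) + U)"
        using elim P y1 by (intro mult_left_mono add_mono sum_inverse_squares_le) (auto simp: P_def y_def)
      also have "\<dots> \<le> 3 * real r * (4 * B ^ 2 * (2 / (B powr (1 - \<epsilon>) / 2)) + U)"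
        using elim y1 by (intro mult_left_mono add_mono divide_left_mono) auto
      also have "\<dots> = B ^ (1 + 1) * q B"
      proof -
        have e1: "2 / (B powr (1 - \<epsilon>) / 2) = 4 * B powr - (1 - \<epsilon>)"
          unfolding powr_minus_divide by simp
        have e2: "U = B ^ 2 * (K * B powr - (1/2))"
          using elim powr_add[of B 2 "-(1/2)"] by (simp add: U_def powr_realpow)
        have "3 * real r * (4 * B ^ 2 * (4 * t) + B ^ 2 * (K * w)) = B ^ (1 + 1) * (48 * real r * t + 3 * real r * K * w)" for t w
          by (simp add: power2_eq_square algebra_simps)
        then show ?thesis unfolding e1 e2 q_def .
      qed
      finally show ?case .
    qed
  qed
  then show ?thesis by (simp only: E_def)
qed

section \<open>Factorization of binary forms\<close>

text \<open>The binary form \<open>y^r q(x/y)\<close> with \<open>r = degree q\<close>, obtained from \<open>q(x y)\<close> by reversing its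
  coefficients in \<open>y\<close>. In this shape multiplicativity is inherited from \<open>pcompose\<close> and
  \<open>reflect_poly\<close>.\<close>

definition form_of :: "'a::idom poly \<Rightarrow> 'a poly poly" where
  "form_of q = reflect_poly (pcompose (map_poly (\<lambda>c. [:c:]) q) [:0, [:0, 1:]:])"

lemma linear_const_power: "[:0, 1:] ^ n = monom (1::'a::comm_semiring_1) n"
  by (simp add: monom_altdef)

lemma coeff_lift_scale:
  fixes q :: "'a::idom poly"
  shows "coeff (pcompose (map_poly (\<lambda>c. [:c:]) q) [:0, [:0, 1:]:]) j = monom (coeff q j) j"
  by (simp add: coeff_pcompose_linear coeff_map_poly linear_const_power flip: smult_monom)
    (simp add: smult_monom mult.commute)

lemma degree_lift_scale:
  fixes q :: "'a::idom poly"
  shows "degree (pcompose (map_poly (\<lambda>c. [:c:]) q) [:0, [:0, 1:]:]) = degree q"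
proof (cases "q = 0")
  case False
  show ?thesis
  proof (rule antisym)
    show "degree (pcompose (map_poly (\<lambda>c. [:c:]) q) [:0, [:0, 1:]:]) \<le> degree q"
      by (intro degree_le) (auto simp: coeff_lift_scale coeff_eq_0)
    show "degree q \<le> degree (pcompose (map_poly (\<lambda>c. [:c:]) q) [:0, [:0, 1:]:])"
      using False by (intro le_degree) (auto simp: coeff_lift_scale)
  qed
qed auto

lemma coeff_form_of: "coeff (form_of q) j =
  (if j \<le> degree q then monom (coeff q (degree q - j)) (degree q - j) else 0)"
  by (simp add: form_of_def coeff_reflect_poly degree_lift_scale coeff_lift_scale)

lemma coeff_coeff_form_of:
  "coeff (coeff (form_of q) j) i = (if i + j = degree q then coeff q i else 0)"
  by (auto simp: coeff_form_of)

lemma form_of_mult: "form_of (p * q) = form_of p * form_of q"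
proof -
  have "map_poly (\<lambda>c. [:c:]) (p * q) = map_poly (\<lambda>c. [:c:]) p * map_poly (\<lambda>c. [:c:]) q"
    by (rule map_poly_mult_hom) auto
  then show ?thesis by (simp add: form_of_def pcompose_mult reflect_poly_mult)
qed

lemma form_of_const: "form_of [:c:] = [:[:c:]:]"
  by (rule poly_eqI) (auto simp: coeff_form_of coeff_pCons monom_0 split: nat.splits)

lemma form_of_power: "form_of (p ^ n) = form_of p ^ n"
  by (induction n) (simp_all add: form_of_mult form_of_const[of 1, folded one_pCons])

lemma form_of_prod: "form_of (\<Prod>i\<in>A. f i) = (\<Prod>i\<in>A. form_of (f i))"
  by (induction A rule: infinite_finite_induct) (simp_all add: form_of_mult form_of_const[of 1, folded one_pCons])

lemma form_of_0 [simp]: "form_of 0 = 0"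
  by (simp add: form_of_def)

lemma form_of_altdef:
  "form_of q = (\<Sum>i\<le>degree q. monom (monom (coeff q i) i) (degree q - i))"
proof (intro poly_eqI, goal_cases)
  case (1 j i)
  have "coeff (coeff (\<Sum>i\<le>degree q. monom (monom (coeff q i) i) (degree q - i)) j) i
    = (\<Sum>k\<le>degree q. if k = i then (if degree q - k = j then coeff q k else 0) else 0)"
    unfolding coeff_sum by (intro sum.cong) auto
  also have "\<dots> = (if i + j = degree q then coeff q i else 0)" by auto
  finally show ?case by (simp add: coeff_coeff_form_of)
qed

lemma poly_form_of:
  "poly (poly (form_of q) [:c:]) a = (\<Sum>i\<le>degree q. coeff q i * a ^ i * c ^ (degree q - i))"
  by (simp add: form_of_altdef poly_sum poly_monom mult_ac poly_power)

text \<open>Setting \<open>y = 1\<close> is a ring homomorphism that undoes the homogenization; it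
  carries facts about forms back to \<open>q\<close>.\<close>

lemma poly_form_of_1 [simp]: "poly (form_of q) 1 = q"
  by (simp add: form_of_altdef poly_sum poly_monom poly_as_sum_of_monoms)

lemma over_rat_form_of: "over_rat (form_of h) = form_of (map_poly of_int h)"
  by (intro poly_eqI) (simp add: coeff_map_poly coeff_coeff_form_of degree_map_poly)

text \<open>The power of \<open>y\<close> split off here is what \<open>e0\<close> records: the drop
  of \<open>degree d\<close> below \<open>k\<close>.\<close>

lemma homogenize_conv_form_of:
  assumes "k \<ge> degree d"
  shows "homogenize k d = form_y ^ (k - degree d) * form_of d"
proof -
  have "[:[:coeff d i:]:] * form_x ^ i * form_y ^ (k - i)
      = form_y ^ (k - degree d) * monom (monom (coeff d i) i) (degree d - i)"
    if "i \<le> degree d" for i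
  proof -
    have x: "form_x ^ i = [:monom (1::rat) i:]"
      by (simp add: form_x_def poly_const_pow linear_const_power)
    have y: "form_y ^ n = monom (1::rat poly) n" for n
      by (simp add: form_y_def linear_const_power)
    have "k - i = (k - degree d) + (degree d - i)" using assms that by simp
    then show ?thesis unfolding x y
      by (simp add: mult_monom smult_monom flip: monom_0)
  qed
  then show ?thesis unfolding homogenize_def form_of_altdef sum_distrib_left by (intro sum.cong) auto
qed

lemma is_unit_form_of_iff: "form_of q dvd 1 \<longleftrightarrow> q dvd 1"
proof
  assume "form_of q dvd 1"
  then obtain r where "1 = form_of q * r" by (auto simp: dvd_def)
  then have "poly 1 1 = poly (form_of q * r) 1" by simp
  then show "q dvd 1" by (auto simp: dvd_def)
next
  assume "q dvd 1"
  then obtain r where "1 = q * r" by (auto simp: dvd_def)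
  then have "form_of 1 = form_of q * form_of r" by (simp flip: form_of_mult)
  then show "form_of q dvd 1" by (auto simp: dvd_def form_of_const[of 1, folded one_pCons])
qed

text \<open>Setting \<open>y = 1\<close> lowers the degree only if \<open>y\<close> divides
  \<open>F\<close>, which coprimality excludes. Irreducibility passes to \<open>poly F 1\<close>
  because \<open>form_of\<close> is multiplicative and reflects units.\<close>

lemma homogeneous_eq_form_of:
  fixes F :: "int poly poly"
  assumes hom: "homogeneous F" and irr: "Factorial_Ring.irreducible (over_rat F)"
    and cop: "coprime (over_rat F) form_y"
  shows "F = form_of (poly F 1)" "total_degree F = degree (poly F 1)"
    "Factorial_Ring.irreducible (map_poly rat_of_int (poly F 1))"
proof -
  define T where "T = total_degree F"
  define h where "h = poly F 1"
  have coF: "i + j = T" if "coeff (coeff F j) i \<noteq> 0" for i j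
    using hom that by (auto simp: homogeneous_def T_def)
  have coF0: "coeff (coeff F j) i = 0" if "i + j \<noteq> T" for i j
    using coF that by blast
  have ch: "coeff h i = coeff (coeff F (T - i)) i" if "i \<le> T" for i
  proof -
    have "coeff h i = (\<Sum>j\<le>degree F. coeff (coeff F j) i)"
      by (simp add: h_def poly_altdef coeff_sum)
    also have "\<dots> = (\<Sum>j\<le>degree F. if j = T - i then coeff (coeff F j) i else 0)"
      using coF0 that by (intro sum.cong) auto
    also have "\<dots> = coeff (coeff F (T - i)) i" by (auto simp: coeff_eq_0 not_le)
    finally show ?thesis .
  qed
  have ch0: "coeff h i = 0" if "i > T" for i
  proof -
    have "coeff h i = (\<Sum>j\<le>degree F. coeff (coeff F j) i)"
      by (simp add: h_def poly_altdef coeff_sum)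
    also have "\<dots> = 0" using coF0 that by (intro sum.neutral) auto
    finally show ?thesis .
  qed
  \<comment> \<open>This is the coefficient of the monomial of \<open>F\<close> free of
    \<open>y\<close>; if it vanished, \<open>y\<close> would divide \<open>F\<close>.\<close>
  have "coeff h T \<noteq> 0"
  proof
    assume "coeff h T = 0"
    then have "coeff (coeff F 0) T = 0" using ch[of T] by simp
    then have "coeff F 0 = 0" using coF[of 0] by (intro poly_eqI) fastforce
    then have "coeff (over_rat F) 0 = 0" by (simp add: coeff_map_poly)
    then have "form_y dvd over_rat F" unfolding form_y_def using poly_eq_0_iff_dvd[of "over_rat F" 0] by (simp add: poly_0_coeff_0)
    then have "form_y dvd (1 :: rat poly poly)" using cop by (meson coprime_common_divisor dvd_refl)
    then show False by (auto simp: form_y_def dvd_def mult_pCons_left one_pCons)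
  qed
  then have dT: "degree h = T" using ch0 by (intro antisym le_degree degree_le) auto
  then show "total_degree F = degree (poly F 1)" by (simp add: h_def T_def)
  have "coeff (coeff F j) i = coeff (coeff (form_of h) j) i" for i j
  proof (cases "i + j = T")
    case True
    then have "T - i = j" by simp
    with ch[of i] True dT show ?thesis by (simp add: coeff_coeff_form_of)
  qed (use coF0 dT in \<open>auto simp: coeff_coeff_form_of\<close>)
  then show F: "F = form_of (poly F 1)" unfolding h_def by (intro poly_eqI)
  let ?q = "map_poly rat_of_int (poly F 1)"
  have oF: "over_rat F = form_of ?q" by (subst F) (rule over_rat_form_of)
  show "Factorial_Ring.irreducible ?q"
  proof (rule Factorial_Ring.irreducibleI)
    show "?q \<noteq> 0" using irr oF by auto
    show "\<not> ?q dvd 1" using irr unfolding oF by (auto simp: is_unit_form_of_iff Factorial_Ring.irreducible_def)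
    fix a b assume "?q = a * b"
    then have "over_rat F = form_of a * form_of b" unfolding oF by (simp add: form_of_mult)
    then show "a dvd 1 \<or> b dvd 1" using Factorial_Ring.irreducibleD[OF irr] is_unit_form_of_iff by blast
  qed
qed

section \<open>From coprimality over the rationals to Bezout identities over the integers\<close>

lemma clear_denominators:
  fixes p :: "rat poly"
  shows "\<exists>c::int. \<exists>q. c \<noteq> 0 \<and> smult (of_int c) p = map_poly of_int q"
proof (induction p)
  case 0
  show ?case by (rule exI[of _ 1], rule exI[of _ 0]) simp
next
  case (pCons x p)
  then obtain c q where c: "c \<noteq> 0" "smult (of_int c) p = map_poly of_int q" by blast
  obtain a b where "quotient_of x = (a, b)" by force
  then have ab: "b \<noteq> 0" "x = of_int a / of_int b"
    using quotient_of_denom_pos[of x a b] by (auto simp: quotient_of_div)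
  have "smult (of_int (b * c)) (pCons x p) = map_poly of_int (pCons (c * a) (smult b q))"
  proof -
    have "smult (of_int (b * c)) (pCons x p) = pCons (of_int (c * a)) (smult (of_int b) (smult (of_int c) p))"
      using ab by (simp add: mult_ac)
    also have "\<dots> = map_poly of_int (pCons (c * a) (smult b q))"
      unfolding c(2) by (intro poly_eqI) (auto simp: coeff_map_poly coeff_pCons split: nat.splits)
    finally show ?thesis .
  qed
  then show ?case using ab c by (intro exI[of _ "b * c"] exI[of _ "pCons (c * a) (smult b q)"]) auto
qed

text \<open>\<open>R\<close> acts like a resultant: by \<open>prime_dvd_fval_both\<close>, a prime
  dividing both values but not the second argument must divide it.\<close>

lemma coprime_rat_imp_int_bezout:
  assumes "coprime (map_poly rat_of_int h) (map_poly rat_of_int g)"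
  shows "\<exists>R u v. R \<noteq> 0 \<and> [:R:] = u * h + v * g"
proof -
  obtain x y where "x * map_poly rat_of_int h + y * map_poly rat_of_int g = gcd (map_poly rat_of_int h) (map_poly rat_of_int g)"
    using bezout_coefficients_fst_snd by blast
  then have xy: "x * map_poly rat_of_int h + y * map_poly rat_of_int g = 1" using assms by (simp add: coprime_iff_gcd_eq_1)
  obtain c u where c: "c \<noteq> 0" "smult (rat_of_int c) x = map_poly of_int u" using clear_denominators by blast
  obtain d v where d: "d \<noteq> 0" "smult (rat_of_int d) y = map_poly of_int v" using clear_denominators by blast
  define U where "U = smult d u"
  define V where "V = smult c v"
  have sm: "map_poly rat_of_int (smult e q) = smult (of_int e) (map_poly of_int q)" for e q
    by (intro poly_eqI) (simp add: coeff_map_poly)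
  have "map_poly rat_of_int (U * h + V * g) = map_poly of_int U * map_poly of_int h + map_poly of_int V * map_poly of_int g"
    by (simp add: map_poly_add_hom map_poly_mult_hom)
  also have "\<dots> = smult (of_int (c * d)) (x * map_poly rat_of_int h + y * map_poly rat_of_int g)"
    unfolding U_def V_def sm c(2)[symmetric] d(2)[symmetric] by (simp add: smult_add_right mult_ac)
  also have "\<dots> = map_poly rat_of_int [:c * d:]" unfolding xy by (simp add: map_poly_pCons)
  finally have "U * h + V * g = [:c * d:]"
    by (metis (no_types, lifting) coeff_map_poly of_int_0 of_int_eq_iff poly_eqI)
  then show ?thesis using c d by (intro exI[of _ "c * d"] exI[of _ U] exI[of _ V]) auto
qed

lemma irreducible_rat_imp_pderiv_bezout:
  assumes "Factorial_Ring.irreducible (map_poly rat_of_int h)"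
  shows "\<exists>R u v. R \<noteq> 0 \<and> [:R:] = u * h + v * pderiv h" "degree h \<ge> 1"
proof -
  let ?q = "map_poly rat_of_int h"
  have q0: "?q \<noteq> 0" "\<not> ?q dvd 1" using assms by (auto simp: Factorial_Ring.irreducible_def)
  then have deg: "degree ?q \<ge> 1" using is_unit_iff_degree[of ?q] by simp
  then show "degree h \<ge> 1" by (simp add: degree_map_poly)
  have pd: "map_poly rat_of_int (pderiv h) = pderiv ?q"
    by (intro poly_eqI) (simp add: coeff_map_poly coeff_pderiv)
  have "\<not> ?q dvd pderiv ?q"
  proof
    assume "?q dvd pderiv ?q"
    moreover have "pderiv ?q \<noteq> 0" using deg by (simp add: pderiv_eq_0_iff)
    ultimately have "degree ?q \<le> degree (pderiv ?q)" by (rule dvd_imp_degree_le)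
    then show False using deg by (simp add: degree_pderiv)
  qed
  then have "coprime ?q (pderiv ?q)"
    using assms by (intro prime_elem_imp_coprime) (simp add: irreducible_imp_prime_elem_gcd)
  then show "\<exists>R u v. R \<noteq> 0 \<and> [:R:] = u * h + v * pderiv h"
    by (intro coprime_rat_imp_int_bezout) (simp add: pd)
qed

lemma irreducible_rat_imp_bezout:
  assumes "Factorial_Ring.irreducible (map_poly rat_of_int h)"
    and "coprime (over_rat (form_of h)) (over_rat (form_of g))"
  shows "\<exists>R u v. R \<noteq> 0 \<and> [:R:] = u * h + v * g"
proof -
  let ?p = "map_poly rat_of_int h" and ?q = "map_poly rat_of_int g"
  have "\<not> ?p dvd ?q"
  proof
    assume "?p dvd ?q"
    then have "form_of ?p dvd form_of ?q" by (auto simp: form_of_mult)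
    then have "form_of ?p dvd 1" using assms(2) unfolding over_rat_form_of by (meson coprime_common_divisor dvd_refl)
    then show False using assms(1) by (simp add: is_unit_form_of_iff Factorial_Ring.irreducible_def)
  qed
  then have "coprime ?p ?q"
    using assms by (intro prime_elem_imp_coprime) (simp add: irreducible_imp_prime_elem_gcd)
  then show ?thesis by (rule coprime_rat_imp_int_bezout)
qed

text \<open>An irreducible form divisible by \<open>x\<close> is \<open>x\<close> up to a constant,
  so the special case in the weight concerns linear factors only.\<close>

lemma form_x_dvd_imp_degree:
  assumes "Factorial_Ring.irreducible (map_poly rat_of_int (poly F 1))" "form_x dvd F"
  shows "degree (poly F 1) = 1"
proof -
  obtain G where "F = form_x * G" using assms(2) by (auto simp: dvd_def)
  then have F: "poly F 1 = [:0, 1:] * poly G 1" by (simp add: form_x_def)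
  let ?q = "map_poly rat_of_int (poly F 1)"
  have q: "?q = [:0, 1:] * map_poly rat_of_int (poly G 1)"
    unfolding F by (subst map_poly_mult_hom) (simp_all add: map_poly_pCons)
  have "\<not> [:0, 1::rat:] dvd 1" by (simp add: is_unit_iff_degree)
  then have "map_poly rat_of_int (poly G 1) dvd 1" using Factorial_Ring.irreducibleD[OF assms(1) q] by blast
  moreover have G0: "poly G 1 \<noteq> 0"
  proof
    assume "poly G 1 = 0"
    then have "?q = 0" unfolding F by simp
    with assms(1) show False by (simp add: Factorial_Ring.irreducible_def)
  qed
  then have "map_poly rat_of_int (poly G 1) \<noteq> 0" by (simp add: map_poly_eq_0_iff)
  ultimately have "degree (map_poly rat_of_int (poly G 1)) = 0"
    by (simp add: is_unit_iff_degree)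
  then have "degree (poly G 1) = 0" by (simp add: degree_map_poly)
  then show ?thesis unfolding F using G0 by (subst degree_mult_eq) auto
qed

text \<open>A factorization is reflected back: the constant term of \<open>reflect_poly q\<close> is
  the leading coefficient of \<open>q\<close>, so both factors have nonzero constant terms and keep
  their degrees.\<close>

lemma irreducible_reflect_poly:
  fixes q :: "'a::field poly"
  assumes "Factorial_Ring.irreducible q" "coeff q 0 \<noteq> 0"
  shows "Factorial_Ring.irreducible (reflect_poly q)"
proof (rule Factorial_Ring.irreducibleI)
  have q0: "q \<noteq> 0" "\<not> q dvd 1" using assms(1) by (auto simp: Factorial_Ring.irreducible_def)
  then show "reflect_poly q \<noteq> 0" by simp
  then show "\<not> reflect_poly q dvd 1" using q0 assms(2) by (simp add: is_unit_iff_degree)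
  fix a b assume ab: "reflect_poly q = a * b"
  have "coeff (reflect_poly q) 0 \<noteq> 0" using q0 by simp
  then have ab0: "coeff a 0 \<noteq> 0" "coeff b 0 \<noteq> 0" unfolding ab by (auto simp: coeff_mult_0)
  have "reflect_poly (reflect_poly q) = reflect_poly a * reflect_poly b" unfolding ab by (rule reflect_poly_mult)
  then have "q = reflect_poly a * reflect_poly b" using assms(2) by simp
  then have "reflect_poly a dvd 1 \<or> reflect_poly b dvd 1" by (rule Factorial_Ring.irreducibleD[OF assms(1)])
  moreover have "a \<noteq> 0" "b \<noteq> 0" using ab0 by auto
  ultimately show "a dvd 1 \<or> b dvd 1"
    using ab0 is_unit_iff_degree[of a] is_unit_iff_degree[of b]
      is_unit_iff_degree[of "reflect_poly a"] is_unit_iff_degree[of "reflect_poly b"] by simp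
qed

text \<open>A factor of \<open>form_of q\<close> that becomes a unit at \<open>x = 1\<close> has degree 0 in \<open>y\<close>, because the other
  factor already accounts for the full \<open>y\<close>-degree; so it divides the coefficient of the top power
  of \<open>y\<close>, which is a constant.\<close>

lemma form_of_factor_unit:
  fixes q :: "'a::field poly"
  assumes q: "coeff q 0 \<noteq> 0" and UV: "form_of q = U * V"
    and unit: "map_poly (\<lambda>c. poly c 1) U dvd 1"
  shows "U dvd 1"
proof -
  define \<phi> :: "'a poly poly \<Rightarrow> 'a poly" where "\<phi> = map_poly (\<lambda>c. poly c 1)"
  have \<phi>_mult: "\<phi> (A * B) = \<phi> A * \<phi> B" for A B unfolding \<phi>_def by (rule map_poly_mult_hom) auto
  have \<phi>_le: "degree (\<phi> A) \<le> degree A" for A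
    unfolding \<phi>_def by (intro degree_le) (simp add: coeff_map_poly coeff_eq_0)
  have q0: "q \<noteq> 0" using q by auto
  have \<phi>q: "\<phi> (form_of q) = reflect_poly q"
    by (rule poly_eqI) (auto simp: \<phi>_def coeff_map_poly coeff_form_of coeff_reflect_poly poly_monom)
  have degq: "degree (form_of q) = degree q"
  proof (rule antisym)
    show "degree (form_of q) \<le> degree q" by (intro degree_le) (simp add: coeff_form_of)
    show "degree q \<le> degree (form_of q)" using q by (intro le_degree) (simp add: coeff_form_of)
  qed
  have nz: "form_of q \<noteq> 0" "\<phi> U \<noteq> 0" "\<phi> V \<noteq> 0"
    using q0 \<phi>q UV \<phi>_mult by (metis reflect_poly_eq_0_iff map_poly_0 \<phi>_def mult_eq_0_iff)+
  have "degree (\<phi> U) = 0" using unit nz(2) by (simp add: \<phi>_def is_unit_iff_degree)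
  moreover have "degree (\<phi> U) + degree (\<phi> V) = degree q"
    using \<phi>_mult[of U V] \<phi>q q nz UV by (metis degree_mult_eq degree_reflect_poly_eq)
  moreover have "degree U + degree V = degree q"
    using UV nz(1) degq by (metis degree_mult_eq mult_eq_0_iff)
  ultimately have "degree U = 0" using \<phi>_le[of V] by simp
  then obtain w where w: "U = [:w:]" by (rule degree_eq_zeroE)
  have "w dvd coeff (form_of q) (degree q)" unfolding UV w by simp
  then have "w dvd [:coeff q 0:]" by (simp add: coeff_form_of monom_0)
  also have "[:coeff q 0:] dvd 1" using q by (simp add: is_unit_iff_degree)
  finally show ?thesis unfolding w by (simp add: is_unit_const_poly_iff)
qed

text \<open>If \<open>q\<close> does not vanish at 0, setting \<open>x = 1\<close> maps
  \<open>form_of q\<close> to the irreducible \<open>reflect_poly q\<close>, so one factor becomes a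
  unit there and \<open>form_of_factor_unit\<close> applies. Otherwise \<open>q\<close> is a
  constant multiple of \<open>x\<close>, and the form is constant in \<open>y\<close>.\<close>

lemma irreducible_form_of:
  fixes q :: "'a::field poly"
  assumes irr: "Factorial_Ring.irreducible q"
  shows "Factorial_Ring.irreducible (form_of q)"
proof (cases "coeff q 0 = 0")
  case False
  have q0: "q \<noteq> 0" "\<not> q dvd 1" using irr by (auto simp: Factorial_Ring.irreducible_def)
  show ?thesis
  proof (rule Factorial_Ring.irreducibleI)
    show "form_of q \<noteq> 0" using q0 poly_form_of_1[of q] by (metis poly_0)
    show "\<not> form_of q dvd 1" using q0 by (simp add: is_unit_form_of_iff)
    fix U V assume UV: "form_of q = U * V"
    have "map_poly (\<lambda>c. poly c 1) (form_of q) = reflect_poly q"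
      by (rule poly_eqI) (auto simp: coeff_map_poly coeff_form_of coeff_reflect_poly poly_monom)
    then have "reflect_poly q = map_poly (\<lambda>c. poly c 1) U * map_poly (\<lambda>c. poly c 1) V"
      unfolding UV by (subst (asm) map_poly_mult_hom) auto
    then have "map_poly (\<lambda>c. poly c 1) U dvd 1 \<or> map_poly (\<lambda>c. poly c 1) V dvd 1"
      by (rule Factorial_Ring.irreducibleD[OF irreducible_reflect_poly[OF irr False]])
    then show "U dvd 1 \<or> V dvd 1"
      using form_of_factor_unit[OF False UV] form_of_factor_unit[OF False UV[unfolded mult.commute[of U]]] by blast
  qed
next
  case True
  have q0: "q \<noteq> 0" "\<not> q dvd 1" using irr by (auto simp: Factorial_Ring.irreducible_def)
  have "[:0, 1:] dvd q" using True poly_eq_0_iff_dvd[of q 0] by (simp add: poly_0_coeff_0)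
  then obtain s where s: "q = [:0, 1:] * s" by (auto simp: dvd_def)
  have "\<not> [:0, 1::'a:] dvd 1" by (simp add: is_unit_iff_degree)
  then have "s dvd 1" using Factorial_Ring.irreducibleD[OF irr s] by blast
  then obtain c where c: "s = [:c:]" using q0 s by (metis degree_eq_zeroE is_unit_iff_degree mult_eq_0_iff)
  have "form_of q = [:q:]"
    unfolding s c using q0 s c by (intro poly_eqI) (auto simp: coeff_form_of coeff_pCons monom_Suc monom_0 split: nat.splits)
  then show ?thesis using irr by (simp add: irreducible_const_poly_iff)
qed

text \<open>At \<open>y = 0\<close> the form is a nonzero multiple of a power of \<open>x\<close>.
  In \<open>y = form_of q * s\<close> the factor \<open>y\<close> would therefore belong to
  \<open>s\<close>, and \<open>form_of q\<close> would be a unit.\<close>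

lemma coprime_form_of_form_y:
  fixes q :: "rat poly"
  assumes "Factorial_Ring.irreducible (form_of q)" "q \<noteq> 0"
  shows "coprime (form_of q) form_y"
proof (rule prime_elem_imp_coprime)
  show "prime_elem (form_of q)" using assms(1) by (rule irreducible_imp_prime_elem_gcd)
  show "\<not> form_of q dvd form_y"
  proof
    assume "form_of q dvd form_y"
    then obtain s where s: "form_y = form_of q * s" by (auto simp: dvd_def)
    have "poly form_y 0 = poly (form_of q) 0 * poly s 0"
      using arg_cong[OF s, of "\<lambda>z. poly z 0"] by simp
    moreover have "poly (form_of q) 0 \<noteq> 0" using assms(2) by (simp add: poly_0_coeff_0 coeff_form_of)
    ultimately have "poly s 0 = 0" by (simp add: form_y_def)
    then obtain s' where s': "s = [:0, 1:] * s'" using poly_eq_0_iff_dvd[of s 0] by (auto simp: dvd_def)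
    have "form_y * (form_of q * s') = form_of q * s" unfolding s' form_y_def by (simp only: mult_ac)
    also have "\<dots> = form_y * 1" unfolding s[symmetric] by simp
    finally have "form_of q * s' = 1"
      unfolding mult_cancel_left by (simp add: form_y_def)
    then have "1 = form_of q * s'" by (rule sym)
    then have "form_of q dvd 1" by (rule dvdI)
    then show False using assms(1) by (simp add: Factorial_Ring.irreducible_def)
  qed
qed

lemma homogeneous_form_of: "homogeneous (form_of q)"
proof (cases "q = 0")
  case False
  have "i + j = degree q" if "coeff (coeff (form_of q) j) i \<noteq> 0" for i j
    using that by (auto simp: coeff_coeff_form_of split: if_splits)
  moreover have "{i + j | i j. coeff (coeff (form_of q) j) i \<noteq> 0} = {degree q}"
  proof (intro equalityI subsetI)
    fix x assume "x \<in> {degree q}"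
    then have "x = degree q + 0 \<and> coeff (coeff (form_of q) 0) (degree q) \<noteq> 0"
      using False by (simp add: coeff_coeff_form_of)
    then show "x \<in> {i + j | i j. coeff (coeff (form_of q) j) i \<noteq> 0}" by blast
  qed (auto simp: coeff_coeff_form_of split: if_splits)
  then have "total_degree (form_of q) = degree q" by (simp add: total_degree_def)
  ultimately show ?thesis by (simp add: homogeneous_def)
qed (simp add: homogeneous_def)

text \<open>Existence is what gives the choice in \<open>kappa1\<close> its meaning. The prime
  factors of \<open>d\<close> are homogenized after clearing denominators, and \<open>c0\<close>
  collects the constants this introduces.\<close>

lemma exists_form_factorization:
  assumes "d \<noteq> 0" "degree d \<le> k"
  shows "\<exists>c0 e0 \<psi> F e. form_factorization (homogenize k d) c0 e0 \<psi> F e"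
proof -
  define \<psi> where "\<psi> = card (prime_factors d)"
  obtain q where q: "bij_betw q {1..\<psi>} (prime_factors d)"
    unfolding \<psi>_def using ex_bij_betw_nat_finite_1[of "prime_factors d"] by auto
  have pr: "Factorial_Ring.prime (q i)" if "i \<in> {1..\<psi>}" for i
    using bij_betwE[OF q] that by auto
  define e where "e = (\<lambda>i. multiplicity (q i) d)"
  have e1: "e i \<ge> 1" if "i \<in> {1..\<psi>}" for i
    using bij_betwE[OF q] that by (auto simp: e_def prime_factors_multiplicity Suc_le_eq)
  have "\<exists>c::int. \<exists>h. c \<noteq> 0 \<and> smult (of_int c) (q i) = map_poly of_int h" for i
    by (rule clear_denominators)
  then obtain c h where ch: "\<And>i. c i \<noteq> 0" "\<And>i. smult (rat_of_int (c i)) (q i) = map_poly of_int (h i)"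
    by metis
  define F where "F = (\<lambda>i. form_of (h i))"
  have oF': "over_rat (F i) = form_of (map_poly of_int (h i))" for i
    by (simp add: F_def over_rat_form_of)
  have oF: "over_rat (F i) = [:[:of_int (c i):]:] * form_of (q i)" for i
  proof -
    have "map_poly of_int (h i) = [:rat_of_int (c i):] * q i" by (simp flip: ch(2))
    then show ?thesis unfolding oF' by (simp only: form_of_mult form_of_const)
  qed
  have irrq: "Factorial_Ring.irreducible (smult (rat_of_int (c i)) (q i))" if "i \<in> {1..\<psi>}" for i
  proof -
    have "Factorial_Ring.irreducible (q i)" using pr[OF that] by (simp add: prime_elem_imp_irreducible)
    moreover have "is_unit [:rat_of_int (c i):]" using ch(1) by (simp add: is_unit_iff_degree)
    ultimately have "Factorial_Ring.irreducible ([:rat_of_int (c i):] * q i)"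
      using irreducible_mult_unit_left by blast
    then show ?thesis by simp
  qed
  then have irrF: "Factorial_Ring.irreducible (over_rat (F i))" if "i \<in> {1..\<psi>}" for i
    unfolding oF' ch(2)[symmetric] using that by (intro irreducible_form_of)
  define l where "l = lead_coeff d"
  have "d = [:l:] * normalize d"
    using unit_factor_mult_normalize[of d] by (simp add: l_def unit_factor_poly_def monom_0 unit_factor_field_def)
  also have "normalize d = (\<Prod>p\<in>prime_factors d. p ^ multiplicity p d)" using prod_prime_factors[OF assms(1)] by simp
  also have "\<dots> = (\<Prod>i\<in>{1..\<psi>}. q i ^ e i)" unfolding e_def by (rule prod.reindex_bij_betw[OF q, symmetric])
  finally have d: "d = [:l:] * (\<Prod>i\<in>{1..\<psi>}. q i ^ e i)" .
  define c0 where "c0 = l / (\<Prod>i\<in>{1..\<psi>}. rat_of_int (c i) ^ e i)"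
  have "form_of d = [:[:l:]:] * (\<Prod>i\<in>{1..\<psi>}. form_of (q i) ^ e i)"
    by (subst d) (simp only: form_of_mult form_of_const form_of_prod form_of_power)
  also have "\<dots> = [:[:c0:]:] * (\<Prod>i\<in>{1..\<psi>}. over_rat (F i) ^ e i)"
  proof -
    have "(\<Prod>i\<in>{1..\<psi>}. over_rat (F i) ^ e i) = (\<Prod>i\<in>{1..\<psi>}. [:[:rat_of_int (c i):]:] ^ e i) * (\<Prod>i\<in>{1..\<psi>}. form_of (q i) ^ e i)"
      unfolding oF power_mult_distrib prod.distrib ..
    also have "(\<Prod>i\<in>{1..\<psi>}. [:[:rat_of_int (c i):]:] ^ e i) = [:[:\<Prod>i\<in>{1..\<psi>}. rat_of_int (c i) ^ e i:]:]"
      by (induction \<psi>) (simp_all add: poly_const_pow one_pCons mult_ac)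
    finally have "[:[:c0:]:] * (\<Prod>i\<in>{1..\<psi>}. over_rat (F i) ^ e i) = ([:[:c0:]:] * [:[:\<Prod>i\<in>{1..\<psi>}. rat_of_int (c i) ^ e i:]:]) * (\<Prod>i\<in>{1..\<psi>}. form_of (q i) ^ e i)"
      by (simp only: mult.assoc)
    also have "[:[:c0:]:] * [:[:\<Prod>i\<in>{1..\<psi>}. rat_of_int (c i) ^ e i:]:] = [:[:l:]:]"
      using ch(1) by (simp add: c0_def)
    finally show ?thesis ..
  qed
  finally have D: "homogenize k d = [:[:c0:]:] * form_y ^ (k - degree d) * (\<Prod>i\<in>{1..\<psi>}. over_rat (F i) ^ e i)"
    using homogenize_conv_form_of[OF assms(2)] by (simp only: mult_ac)
  have copF: "coprime (over_rat (F i)) (over_rat (F j))" if ij: "i \<in> {1..\<psi>}" "j \<in> {1..\<psi>}" "i \<noteq> j" for i j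
  proof (rule prime_elem_imp_coprime)
    show "prime_elem (over_rat (F i))" using irrF[OF ij(1)] by (rule irreducible_imp_prime_elem_gcd)
    show "\<not> over_rat (F i) dvd over_rat (F j)"
    proof
      assume "over_rat (F i) dvd over_rat (F j)"
      then obtain s where "over_rat (F j) = over_rat (F i) * s" by (auto simp: dvd_def)
      then have "poly (over_rat (F j)) 1 = poly (over_rat (F i)) 1 * poly s 1" by simp
      then have "smult (rat_of_int (c j)) (q j) = smult (rat_of_int (c i)) (q i) * poly s 1"
        unfolding oF' ch(2) by simp
      then have "q i dvd smult (rat_of_int (c j)) (q j)" by (simp add: dvd_smult)
      then have "q i dvd q j" using ch(1)[of j] by (simp add: dvd_smult_iff)
      then have "q i = q j" using pr ij primes_dvd_imp_eq by blast
      then show False using ij bij_betw_imp_inj_on[OF q] by (auto dest: inj_onD)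
    qed
  qed
  have "coprime (over_rat (F i)) form_y" if "i \<in> {1..\<psi>}" for i
    unfolding oF' using irrF[OF that] irrq[OF that] unfolding oF' ch(2)
    by (intro coprime_form_of_form_y) (auto simp: Factorial_Ring.irreducible_def)
  then have "form_factorization (homogenize k d) c0 (k - degree d) \<psi> F e"
    unfolding form_factorization_def using D e1 irrF copF homogeneous_form_of by (auto simp: F_def)
  then show ?thesis by blast
qed

section \<open>Minimal discriminant and conductor\<close>

definition inv_b2 :: "'a::comm_ring_1 weierstrass \<Rightarrow> 'a" where
  "inv_b2 W = a1 W ^ 2 + 4 * a2 W"

definition inv_b4 :: "'a::comm_ring_1 weierstrass \<Rightarrow> 'a" where
  "inv_b4 W = 2 * a4 W + a1 W * a3 W"

definition inv_b6 :: "'a::comm_ring_1 weierstrass \<Rightarrow> 'a" where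
  "inv_b6 W = a3 W ^ 2 + 4 * a6 W"

definition inv_c4 :: "'a::comm_ring_1 weierstrass \<Rightarrow> 'a" where
  "inv_c4 W = inv_b2 W ^ 2 - 24 * inv_b4 W"

definition inv_c6 :: "'a::comm_ring_1 weierstrass \<Rightarrow> 'a" where
  "inv_c6 W = - (inv_b2 W ^ 3) + 36 * inv_b2 W * inv_b4 W - 216 * inv_b6 W"

text \<open>To stay in an arbitrary commutative ring, \<open>b8\<close> is eliminated through
  \<open>4 * b8\<close> without dividing by 4; the factor 1728 supplies the 4.\<close>

lemma disc_inv_c4_c6: "1728 * disc W = inv_c4 W ^ 3 - inv_c6 W ^ 2"
proof -
  define b8 where "b8 = a1 W ^ 2 * a6 W + 4 * a2 W * a6 W - a1 W * a3 W * a4 W + a2 W * a3 W ^ 2 - a4 W ^ 2"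
  have b8: "4 * b8 = inv_b2 W * inv_b6 W - inv_b4 W ^ 2"
    by (simp add: b8_def inv_b2_def inv_b4_def inv_b6_def power2_eq_square algebra_simps)
  have dsc: "disc W = - (inv_b2 W ^ 2 * b8) - 8 * inv_b4 W ^ 3 - 27 * inv_b6 W ^ 2 + 9 * inv_b2 W * inv_b4 W * inv_b6 W"
    by (simp add: disc_def Let_def b8_def inv_b2_def inv_b4_def inv_b6_def)
  have "1728 * disc W = - (432 * inv_b2 W ^ 2 * (4 * b8)) - 1728 * 8 * inv_b4 W ^ 3 - 1728 * 27 * inv_b6 W ^ 2 + 1728 * 9 * inv_b2 W * inv_b4 W * inv_b6 W"
    unfolding dsc by (simp add: algebra_simps)
  also have "\<dots> = inv_c4 W ^ 3 - inv_c6 W ^ 2" unfolding b8 inv_c4_def inv_c6_def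
    by (simp add: power2_eq_square power3_eq_cube algebra_simps)
  finally show ?thesis .
qed

lemma inv_change_vars:
  fixes W :: "'a::field weierstrass"
  assumes "u \<noteq> 0"
  shows "inv_b2 (change_vars u r s t W) * u ^ 2 = inv_b2 W + 12 * r"
    and "inv_b4 (change_vars u r s t W) * u ^ 4 = inv_b4 W + r * inv_b2 W + 6 * r ^ 2"
    and "inv_b6 (change_vars u r s t W) * u ^ 6 = inv_b6 W + 2 * r * inv_b4 W + r ^ 2 * inv_b2 W + 4 * r ^ 3"
proof -
  let ?W = "change_vars u r s t W"
  have a: "a1 ?W * u = a1 W + 2 * s" "a2 ?W * u ^ 2 = a2 W - s * a1 W + 3 * r - s ^ 2"
    "a3 ?W * u ^ 3 = a3 W + r * a1 W + 2 * t"
    "a4 ?W * u ^ 4 = a4 W - s * a3 W + 2 * r * a2 W - (t + r * s) * a1 W + 3 * r ^ 2 - 2 * s * t"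
    "a6 ?W * u ^ 6 = a6 W + r * a4 W + r ^ 2 * a2 W + r ^ 3 - t * a3 W - t ^ 2 - r * t * a1 W"
    using assms by (simp_all add: change_vars_def)
  have "inv_b2 ?W * u ^ 2 = (a1 ?W * u) ^ 2 + 4 * (a2 ?W * u ^ 2)"
    by (simp add: inv_b2_def algebra_simps power_mult_distrib)
  then show "inv_b2 ?W * u ^ 2 = inv_b2 W + 12 * r"
    unfolding a by (simp add: inv_b2_def power2_eq_square algebra_simps)
  have "inv_b4 ?W * u ^ 4 = 2 * (a4 ?W * u ^ 4) + (a1 ?W * u) * (a3 ?W * u ^ 3)"
    by (simp add: inv_b4_def eval_nat_numeral algebra_simps)
  then show "inv_b4 ?W * u ^ 4 = inv_b4 W + r * inv_b2 W + 6 * r ^ 2"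
    unfolding a by (simp add: inv_b2_def inv_b4_def power2_eq_square algebra_simps)
  have "inv_b6 ?W * u ^ 6 = (a3 ?W * u ^ 3) ^ 2 + 4 * (a6 ?W * u ^ 6)"
    by (simp add: inv_b6_def eval_nat_numeral algebra_simps)
  then show "inv_b6 ?W * u ^ 6 = inv_b6 W + 2 * r * inv_b4 W + r ^ 2 * inv_b2 W + 4 * r ^ 3"
    unfolding a by (simp add: inv_b2_def inv_b4_def inv_b6_def power2_eq_square power3_eq_cube algebra_simps)
qed

lemma inv_c4_change_vars:
  fixes W :: "'a::field weierstrass"
  assumes "u \<noteq> 0"
  shows "inv_c4 (change_vars u r s t W) * u ^ 4 = inv_c4 W"
proof -
  let ?W = "change_vars u r s t W"
  have "inv_c4 ?W * u ^ 4 = (inv_b2 ?W * u ^ 2) ^ 2 - 24 * (inv_b4 ?W * u ^ 4)"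
    by (simp add: inv_c4_def eval_nat_numeral algebra_simps)
  also have "\<dots> = inv_c4 W" unfolding inv_change_vars[OF assms]
    by (simp add: inv_c4_def power2_eq_square algebra_simps)
  finally show ?thesis .
qed

lemma inv_c6_change_vars:
  fixes W :: "'a::field weierstrass"
  assumes "u \<noteq> 0"
  shows "inv_c6 (change_vars u r s t W) * u ^ 6 = inv_c6 W"
proof -
  let ?W = "change_vars u r s t W"
  have "inv_c6 ?W * u ^ 6 = - ((inv_b2 ?W * u ^ 2) ^ 3) + 36 * (inv_b2 ?W * u ^ 2) * (inv_b4 ?W * u ^ 4) - 216 * (inv_b6 ?W * u ^ 6)"
    by (simp add: inv_c6_def eval_nat_numeral algebra_simps)
  also have "\<dots> = inv_c6 W" unfolding inv_change_vars[OF assms]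
    by (simp add: inv_c6_def power2_eq_square power3_eq_cube algebra_simps)
  finally show ?thesis .
qed

text \<open>Follows from the scaling of \<open>c4\<close> and \<open>c6\<close> on cancelling 1728,
  which is legitimate over the rationals.\<close>

lemma disc_change_vars:
  fixes W :: "rat weierstrass"
  assumes "u \<noteq> 0"
  shows "disc (change_vars u r s t W) * u ^ 12 = disc W"
proof -
  let ?W = "change_vars u r s t W"
  have "1728 * (disc ?W * u ^ 12) = (1728 * disc ?W) * u ^ 12" by simp
  also have "\<dots> = (inv_c4 ?W * u ^ 4) ^ 3 - (inv_c6 ?W * u ^ 6) ^ 2"
    unfolding disc_inv_c4_c6 by (simp add: left_diff_distrib power_mult_distrib flip: power_mult)
  also have "\<dots> = 1728 * disc W" unfolding inv_c4_change_vars[OF assms] inv_c6_change_vars[OF assms] disc_inv_c4_c6 ..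
  finally show ?thesis by simp
qed

lemma weierstrass_of_int:
  "disc (map_weierstrass of_int W) = (of_int (disc W) :: rat)"
  "inv_c4 (map_weierstrass of_int W) = (of_int (inv_c4 W) :: rat)"
  "inv_c6 (map_weierstrass of_int W) = (of_int (inv_c6 W) :: rat)"
  by (simp_all add: disc_def Let_def inv_c4_def inv_c6_def inv_b2_def inv_b4_def inv_b6_def weierstrass.map_sel)

lemma minimal_model_in:
  assumes "W0 \<in> integral_models E"
  shows "minimal_model E \<in> integral_models E" "\<bar>minimal_disc E\<bar> \<le> \<bar>disc W0\<bar>"
proof -
  have *: "minimal_model E \<in> integral_models E \<and> (\<forall>W. W \<in> integral_models E \<longrightarrow> nat \<bar>disc (minimal_model E)\<bar> \<le> nat \<bar>disc W\<bar>)"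
    unfolding minimal_model_def by (rule arg_min_nat_lemma) (rule assms)
  then show "minimal_model E \<in> integral_models E" by blast
  have "nat \<bar>disc (minimal_model E)\<bar> \<le> nat \<bar>disc W0\<bar>" using * assms by blast
  then show "\<bar>minimal_disc E\<bar> \<le> \<bar>disc W0\<bar>" by (simp add: minimal_disc_def)
qed

text \<open>One and the same \<open>u\<close> scales all three invariants; this links the
  discriminant to \<open>c4\<close> and \<open>c6\<close> when two models are compared.\<close>

lemma integral_model_invariants:
  assumes "W \<in> integral_models E"
  shows "\<exists>u. u \<noteq> 0 \<and> of_int (disc W) * u ^ 12 = disc E \<and> of_int (inv_c4 W) * u ^ 4 = inv_c4 E \<and>
    of_int (inv_c6 W) * u ^ 6 = inv_c6 E"
proof -
  obtain u r s t where u: "u \<noteq> 0" "map_weierstrass of_int W = change_vars u r s t E"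
    using assms unfolding integral_models_def by blast
  show ?thesis
    unfolding weierstrass_of_int[symmetric] u(2)
    using u(1) disc_change_vars[OF u(1)] inv_c4_change_vars[OF u(1)] inv_c6_change_vars[OF u(1)] by blast
qed

lemma minimal_disc_nonzero:
  assumes "W0 \<in> integral_models E" "disc E \<noteq> 0"
  shows "minimal_disc E \<noteq> 0"
  using integral_model_invariants[OF minimal_model_in(1)[OF assms(1)]] assms(2)
  by (auto simp: minimal_disc_def)

text \<open>If \<open>p\<close> divides the discriminant of an integral model but not the minimal one, then \<open>p\<close> divides
  the scaling factor \<open>u\<close> between the two models, and hence the invariants \<open>c4\<close> and \<open>c6\<close>.\<close>

lemma prime_dvd_minimal_disc:
  fixes A B p :: int
  assumes W0: "Weierstrass 0 0 0 A B \<in> integral_models E" and E: "disc E \<noteq> 0"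
    and p: "Factorial_Ring.prime p" "p > 3" "p dvd disc (Weierstrass 0 0 0 A B)" "\<not> p dvd minimal_disc E"
  shows "p dvd A \<and> p dvd B"
proof -
  let ?W = "minimal_model E" and ?M = "Weierstrass 0 0 0 A B"
  have "\<exists>u. u \<noteq> 0 \<and> of_int (disc ?W) * u ^ 12 = disc E \<and> of_int (inv_c4 ?W) * u ^ 4 = inv_c4 E \<and>
    of_int (inv_c6 ?W) * u ^ 6 = inv_c6 E"
    by (rule integral_model_invariants[OF minimal_model_in(1)[OF W0]])
  then obtain u where u: "u \<noteq> 0" "of_int (disc ?W) * u ^ 12 = disc E" "of_int (inv_c4 ?W) * u ^ 4 = inv_c4 E"
    "of_int (inv_c6 ?W) * u ^ 6 = inv_c6 E" by (elim exE conjE)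
  have "\<exists>v. v \<noteq> 0 \<and> of_int (disc ?M) * v ^ 12 = disc E \<and> of_int (inv_c4 ?M) * v ^ 4 = inv_c4 E \<and>
    of_int (inv_c6 ?M) * v ^ 6 = inv_c6 E"
    by (rule integral_model_invariants[OF W0])
  then obtain v where v: "v \<noteq> 0" "of_int (disc ?M) * v ^ 12 = disc E" "of_int (inv_c4 ?M) * v ^ 4 = inv_c4 E"
    "of_int (inv_c6 ?M) * v ^ 6 = inv_c6 E" by (elim exE conjE)
  obtain k l where kl: "quotient_of (u / v) = (k, l)" by (cases "quotient_of (u / v)")
  have l: "l > 0" "coprime k l" "u / v = of_int k / of_int l"
    using quotient_of_denom_pos[OF kl] quotient_of_coprime[OF kl] quotient_of_div[OF kl] by blast+
  have uv: "u * of_int l = v * of_int k" using l(1,3) v(1) by (simp add: field_simps)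
  \<comment> \<open>Both models are compared with \<open>E\<close>; clearing the fraction
    \<open>u / v = k / l\<close> leaves identities between integers.\<close>
  have scale: "l ^ e * x0 = k ^ e * x" if "of_int x * u ^ e = y" "of_int x0 * v ^ e = y" for x x0 :: int and y e
  proof -
    have "of_int (l ^ e * x0) * v ^ e = of_int l ^ e * (of_int x0 * v ^ e)" by simp
    also have "\<dots> = of_int l ^ e * (of_int x * u ^ e)" unfolding that ..
    also have "\<dots> = of_int x * (u * of_int l) ^ e" by (simp add: power_mult_distrib mult_ac)
    also have "\<dots> = of_int (k ^ e * x) * v ^ e" unfolding uv power_mult_distrib by simp
    finally have "of_int (l ^ e * x0) = (of_int (k ^ e * x) :: rat)" using v(1) by simp
    then show ?thesis by (simp only: of_int_eq_iff)
  qed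
  have "p dvd k ^ 12 * disc ?W" unfolding scale[OF u(2) v(2), symmetric] using p(3) by simp
  then have pk: "p dvd k" using p by (auto simp: prime_dvd_mult_iff minimal_disc_def dest: prime_dvd_power)
  then have pl: "\<not> p dvd l" using coprime_common_divisor[OF l(2) pk] not_prime_unit p(1) by blast
  have dv: "p dvd x0" if "l ^ e * x0 = k ^ e * x" "e > 0" for x x0 e
  proof -
    have "p dvd l ^ e * x0" unfolding that(1) by (intro dvd_mult2 dvd_trans[OF pk dvd_power] disjI1 that(2))
    then show ?thesis using pl p(1) by (auto simp: prime_dvd_mult_iff dest: prime_dvd_power)
  qed
  have "p dvd inv_c4 ?M" by (rule dv[OF scale[OF u(3) v(3)]]) simp
  then have "p dvd 48 * A" by (simp add: inv_c4_def inv_b2_def inv_b4_def)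
  moreover have "p dvd inv_c6 ?M" by (rule dv[OF scale[OF u(4) v(4)]]) simp
  then have "p dvd 864 * B" by (simp add: inv_c6_def inv_b2_def inv_b4_def inv_b6_def)
  moreover have "\<not> p dvd 2" "\<not> p dvd 3" using p(2) by (auto dest: zdvd_imp_le)
  then have "\<not> p dvd 2 ^ i * 3 ^ j" for i j
    using p(1) by (auto simp: prime_dvd_mult_iff dest: prime_dvd_power)
  from this[of 4 1] this[of 5 3] have "\<not> p dvd 48" "\<not> p dvd 864" by simp_all
  ultimately show ?thesis using p(1) by (simp add: prime_dvd_mult_iff)
qed

text \<open>Together with the value 1 in the node case, this makes every conductor exponent at a
  prime dividing the minimal discriminant at least 1.\<close>

lemma wild_exponent_nonneg: "wild_exponent E p \<ge> 0"
proof -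
  have "log (real l) (real (card T) / real (card {P\<in>T. Q P})) \<ge> 0" if "l > 1" for l and T :: "complex point set" and Q
  proof (cases "finite T \<and> {P\<in>T. Q P} \<noteq> {}")
    case True
    then have "0 < card {P\<in>T. Q P}" "card {P\<in>T. Q P} \<le> card T" by (auto intro!: card_mono simp: card_gt_0_iff)
    then have "real (card T) / real (card {P\<in>T. Q P}) \<ge> 1" by simp
    then show ?thesis using that by simp
  next
    case False
    \<comment> \<open>By the conventions for infinite cardinalities and division by 0 the quotient
      is 0, and the logarithm of 0 is 0.\<close>
    then have "card T = 0 \<or> card {P\<in>T. Q P} = 0" by (auto simp: card_eq_0_iff)
    then show ?thesis by (auto simp: log_def)
  qed
  then show ?thesis unfolding wild_exponent_def Let_def by (intro infsum_nonneg mult_nonneg_nonneg) auto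
qed

lemma conductor_ge:
  assumes "minimal_disc E \<noteq> 0" "finite P" "\<And>p. p \<in> P \<Longrightarrow> Factorial_Ring.prime p \<and> int p dvd minimal_disc E"
  shows "conductor E \<ge> (\<Prod>p\<in>P. real p)"
proof -
  let ?Q = "{p. Factorial_Ring.prime p \<and> int p dvd minimal_disc E}"
  have fin: "finite ?Q"
  proof (rule finite_subset)
    show "?Q \<subseteq> {..nat \<bar>minimal_disc E\<bar>}"
    proof
      fix p assume "p \<in> ?Q"
      then have "int p \<le> \<bar>minimal_disc E\<bar>" using dvd_imp_le_int[OF assms(1), of "int p"] by simp
      then show "p \<in> {..nat \<bar>minimal_disc E\<bar>}" by simp
    qed
  qed auto
  have ge: "real p powr conductor_exponent E p \<ge> real p" if "p \<in> ?Q" for p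
  proof -
    have p: "real p \<ge> 1" using that prime_ge_1_nat by auto
    have "conductor_exponent E p \<ge> 1"
      using that wild_exponent_nonneg[of E p] by (auto simp: conductor_exponent_def)
    then have "real p powr 1 \<le> real p powr conductor_exponent E p" using p by (rule powr_mono)
    then show ?thesis using p by simp
  qed
  have "(\<Prod>p\<in>P. real p) \<le> (\<Prod>p\<in>?Q. real p)"
    using assms fin by (intro prod_mono2) (auto dest: prime_ge_1_nat)
  also have "\<dots> \<le> conductor E" unfolding conductor_def using ge by (intro prod_mono) auto
  finally show ?thesis .
qed

section \<open>The family of curves\<close>

text \<open>At most \<open>y\<close> primes lie up to \<open>y\<close>, each of multiplicity below
  \<open>k\<close>; larger primes have multiplicity at most \<open>w\<close>. So, apart from the
  first term, \<open>V\<close> is bounded by the \<open>w\<close>-th power of the radical of its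
  large part.\<close>

lemma ln_abs_le_radical:
  fixes V :: int and y :: real
  assumes V: "V \<noteq> 0" and y: "y \<ge> 1"
    and large: "\<And>p. Factorial_Ring.prime p \<Longrightarrow> y < real_of_int p \<Longrightarrow> \<not> p ^ Suc w dvd V"
    and small: "\<And>p. Factorial_Ring.prime p \<Longrightarrow> real_of_int p \<le> y \<Longrightarrow> \<not> p ^ k dvd V"
  shows "ln \<bar>real_of_int V\<bar> \<le> real k * y * ln y + real w * (\<Sum>p | p \<in> prime_factors V \<and> y < real_of_int p. ln (real_of_int p))"
proof -
  define L where "L = {p \<in> prime_factors V. y < real_of_int p}"
  define S where "S = {p \<in> prime_factors V. real_of_int p \<le> y}"
  have fin: "finite L" "finite S" by (simp_all add: L_def S_def)
  have un: "prime_factors V = S \<union> L" "S \<inter> L = {}" by (auto simp: L_def S_def)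
  have pr: "Factorial_Ring.prime p" "real_of_int p > 1" if "p \<in> prime_factors V" for p
    using that prime_gt_1_int by auto
  have "\<bar>V\<bar> = (\<Prod>p\<in>prime_factors V. p ^ multiplicity p V)" using prod_prime_factors[OF V] by simp
  then have "\<bar>real_of_int V\<bar> = (\<Prod>p\<in>prime_factors V. real_of_int p ^ multiplicity p V)"
    by (metis (mono_tags, lifting) of_int_abs of_int_power of_int_prod prod.cong)
  then have "ln \<bar>real_of_int V\<bar> = (\<Sum>p\<in>prime_factors V. ln (real_of_int p ^ multiplicity p V))"
    using pr by (simp add: ln_prod)
  also have "\<dots> = (\<Sum>p\<in>prime_factors V. real (multiplicity p V) * ln (real_of_int p))"
    using pr by (intro sum.cong) (auto simp: ln_realpow)
  also have "\<dots> = (\<Sum>p\<in>S. real (multiplicity p V) * ln (real_of_int p)) + (\<Sum>p\<in>L. real (multiplicity p V) * ln (real_of_int p))"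
    unfolding un(1) using fin(2,1) un(2) by (rule sum.union_disjoint)
  also have "(\<Sum>p\<in>S. real (multiplicity p V) * ln (real_of_int p)) \<le> (\<Sum>p\<in>S. real k * ln y)"
  proof (rule sum_mono)
    fix p assume p: "p \<in> S"
    then have "\<not> p ^ k dvd V" using small pr by (auto simp: S_def)
    then have "multiplicity p V < k" by (meson multiplicity_dvd' not_le)
    moreover have "ln (real_of_int p) \<le> ln y" using p pr(2)[of p] by (auto simp: S_def)
    moreover have "ln (real_of_int p) \<ge> 0" using p pr(2)[of p] by (auto simp: S_def)
    ultimately show "real (multiplicity p V) * ln (real_of_int p) \<le> real k * ln y" by (intro mult_mono) auto
  qed
  also have "(\<Sum>p\<in>S. real k * ln y) = real (card S) * (real k * ln y)" by simp
  also have "\<dots> \<le> y * (real k * ln y)"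
  proof (rule mult_right_mono)
    have "S \<subseteq> {p. 2 \<le> p \<and> real_of_int p \<le> y}" using pr(1) prime_ge_2_int by (auto simp: S_def)
    then show "real (card S) \<le> y"
      using card_int_between_le[OF y] card_mono[of "{p::int. 2 \<le> p \<and> real_of_int p \<le> y}" S] by linarith
  qed (use y in auto)
  also have "(\<Sum>p\<in>L. real (multiplicity p V) * ln (real_of_int p)) \<le> (\<Sum>p\<in>L. real w * ln (real_of_int p))"
  proof (intro sum_mono mult_right_mono)
    fix p assume p: "p \<in> L"
    then have "\<not> p ^ Suc w dvd V" using large pr by (auto simp: L_def)
    then have "multiplicity p V < Suc w" by (meson multiplicity_dvd' not_le)
    then show "real (multiplicity p V) \<le> real w" by simp
    show "0 \<le> ln (real_of_int p)" using p pr(2)[of p] by (auto simp: L_def)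
  qed
  finally show ?thesis by (simp add: L_def sum_distrib_left mult_ac)
qed

text \<open>Modulo \<open>p\<close> only the term with the leading coefficient survives, since all
  others contain \<open>c\<close>.\<close>

lemma prime_dvd_fval_denominator:
  assumes "Factorial_Ring.prime p" "p dvd c" "p dvd fval h a c" "\<not> p dvd lead_coeff h"
  shows "p dvd a"
proof -
  let ?r = "degree h"
  have "fval h a c = (\<Sum>i<?r. coeff h i * a ^ i * c ^ (?r - i)) + lead_coeff h * a ^ ?r"
    unfolding fval_def by (simp flip: lessThan_Suc_atMost)
  moreover have "p dvd (\<Sum>i<?r. coeff h i * a ^ i * c ^ (?r - i))"
    using assms(2) by (intro dvd_sum dvd_mult) (auto intro: dvd_trans[OF _ dvd_power])
  ultimately have "p dvd lead_coeff h * a ^ ?r" using assms(3) by (simp add: dvd_add_right_iff)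
  then show ?thesis using assms(1,4) by (auto simp: prime_dvd_mult_iff dest: prime_dvd_power)
qed

lemma conductor_ge_int:
  assumes "minimal_disc E \<noteq> 0" "finite P" "\<And>p. p \<in> P \<Longrightarrow> Factorial_Ring.prime p \<and> p dvd minimal_disc E"
  shows "conductor E \<ge> (\<Prod>p\<in>P. real_of_int p)"
proof -
  have pos: "p > 0" if "p \<in> P" for p using assms(3)[OF that] prime_gt_0_int by blast
  have "(\<Prod>p\<in>nat ` P. real p) \<le> conductor E"
  proof (rule conductor_ge[OF assms(1)])
    fix q assume "q \<in> nat ` P"
    then obtain p where "p \<in> P" "q = nat p" by auto
    then have "int q = p" "p \<in> P" using pos[of p] by auto
    then show "Factorial_Ring.prime q \<and> int q dvd minimal_disc E" using assms(3)[of p] by auto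
  qed (use assms in auto)
  also have "(\<Prod>p\<in>nat ` P. real p) = (\<Prod>p\<in>P. real (nat p))"
    using pos by (subst prod.reindex) (auto intro!: inj_onI simp: less_imp_le eq_nat_nat_iff)
  also have "\<dots> = (\<Prod>p\<in>P. real_of_int p)" using pos by (intro prod.cong) (auto simp: less_imp_le)
  finally show ?thesis .
qed

lemma disc_short: "disc (Weierstrass 0 0 0 A B) = - 16 * (4 * A ^ 3 + 27 * B ^ 2)"
  by (simp add: disc_def Let_def eval_nat_numeral algebra_simps)

section \<open>An integral Weierstrass model of each fibre\<close>

locale integral_family =
  fixes f g :: "rat poly" and n m :: nat and s :: int and f0 g0 :: "int poly" and R :: int and u v :: "int poly"
  assumes m_pos: "m > 0" and n_pos: "n > 0" and s_nz: "s \<noteq> 0"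
    and f0: "smult (of_int s) f = map_poly of_int f0"
    and g0: "smult (of_int s) g = map_poly of_int g0"
    and deg_f0: "m * degree f0 \<le> 4 * n" and deg_g0: "m * degree g0 \<le> 6 * n"
    and deg_eq: "m * degree f0 = 4 * n \<or> m * degree g0 = 6 * n"
    and R_nz: "R \<noteq> 0" and bezout: "[:R:] = u * f0 + v * g0"
begin

text \<open>Scaling a fibre by \<open>s * b ^ n\<close> multiplies its two coefficients by the
  fourth and sixth powers of that number. One factor \<open>s\<close> is already contained in
  \<open>f0\<close> and \<open>g0\<close>, which leaves \<open>s ^ 3\<close> here and
  \<open>s ^ 5\<close> below.\<close>

definition coeff_a4 :: "int \<Rightarrow> int \<Rightarrow> int" where
  "coeff_a4 a b = s ^ 3 * b ^ (4 * n - m * degree f0) * fval f0 a (b ^ m)"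

definition coeff_a6 :: "int \<Rightarrow> int \<Rightarrow> int" where
  "coeff_a6 a b = s ^ 5 * b ^ (6 * n - m * degree g0) * fval g0 a (b ^ m)"

abbreviation model :: "int \<Rightarrow> int \<Rightarrow> int weierstrass" where
  "model a b \<equiv> Weierstrass 0 0 0 (coeff_a4 a b) (coeff_a6 a b)"

lemma of_int_coeff_a4:
  assumes "b \<noteq> 0"
  shows "of_int (coeff_a4 a b) = of_int s ^ 4 * of_int b ^ (4 * n) * poly f (of_int a / of_int b ^ m)"
proof -
  have "poly (map_poly of_int f0) (of_int a / of_int b ^ m) = of_int s * poly f (of_int a / of_int b ^ m)"
    by (simp flip: f0)
  then have "of_int (fval f0 a (b ^ m)) = of_int b ^ (m * degree f0) * (of_int s * poly f (of_int a / of_int b ^ m))"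
    using assms by (subst of_int_fval) (auto simp: power_mult)
  moreover have "of_int b ^ (4 * n) = of_int b ^ (4 * n - m * degree f0) * (of_int b ^ (m * degree f0) :: rat)"
    using deg_f0 by (simp flip: power_add)
  ultimately show ?thesis by (simp add: coeff_a4_def eval_nat_numeral)
qed

lemma of_int_coeff_a6:
  assumes "b \<noteq> 0"
  shows "of_int (coeff_a6 a b) = of_int s ^ 6 * of_int b ^ (6 * n) * poly g (of_int a / of_int b ^ m)"
proof -
  have "poly (map_poly of_int g0) (of_int a / of_int b ^ m) = of_int s * poly g (of_int a / of_int b ^ m)"
    by (simp flip: g0)
  then have "of_int (fval g0 a (b ^ m)) = of_int b ^ (m * degree g0) * (of_int s * poly g (of_int a / of_int b ^ m))"
    using assms by (subst of_int_fval) (auto simp: power_mult)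
  moreover have "of_int b ^ (6 * n) = of_int b ^ (6 * n - m * degree g0) * (of_int b ^ (m * degree g0) :: rat)"
    using deg_g0 by (simp flip: power_add)
  ultimately show ?thesis by (simp add: coeff_a6_def eval_nat_numeral)
qed

lemma model_in_integral_models:
  assumes "b \<noteq> 0"
  shows "model a b \<in> integral_models (fibre f g (of_int a / of_int b ^ m))"
proof -
  define w :: rat where "w = of_int s * of_int b ^ n"
  have w: "w \<noteq> 0" using assms s_nz by (simp add: w_def)
  have "map_weierstrass of_int (model a b) = change_vars (1 / w) 0 0 0 (fibre f g (of_int a / of_int b ^ m))"
  proof -
    have "w ^ 4 = of_int s ^ 4 * of_int b ^ (4 * n)" "w ^ 6 = of_int s ^ 6 * of_int b ^ (6 * n)"
      by (simp_all add: w_def power_mult_distrib mult.commute[of _ n] power_mult)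
    then show ?thesis
      by (simp add: change_vars_def fibre_def of_int_coeff_a4[OF assms] of_int_coeff_a6[OF assms] power_divide)
  qed
  then show ?thesis unfolding integral_models_def using w
    by (intro CollectI exI[of _ "1 / w"] exI[of _ 0]) auto
qed

lemma disc_model:
  assumes "b \<noteq> 0"
  shows "rat_of_int (disc (model a b)) = - 16 * of_int s ^ 12 * (of_int b ^ (12 * n) * poly (disc_poly f g) (of_int a / of_int b ^ m))"
proof -
  have "rat_of_int (disc (model a b)) = - 16 * (4 * of_int (coeff_a4 a b) ^ 3 + 27 * of_int (coeff_a6 a b) ^ 2)"
    unfolding disc_short by simp
  also have "\<dots> = - 16 * of_int s ^ 12 * (of_int b ^ (12 * n) * poly (disc_poly f g) (of_int a / of_int b ^ m))"
  proof -
    have "((of_int s :: rat) ^ 4) ^ 3 = of_int s ^ 12" "((of_int s :: rat) ^ 6) ^ 2 = of_int s ^ 12"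
      "((of_int b :: rat) ^ (4 * n)) ^ 3 = of_int b ^ (12 * n)" "((of_int b :: rat) ^ (6 * n)) ^ 2 = of_int b ^ (12 * n)"
      by (simp_all flip: power_mult)
    then show ?thesis
      unfolding of_int_coeff_a4[OF assms] of_int_coeff_a6[OF assms] disc_poly_def power_mult_distrib
      by (simp add: algebra_simps)
  qed
  finally show ?thesis .
qed

lemma abs_disc_model_le:
  "\<exists>C\<ge>1. \<forall>B\<ge>1. \<forall>a b. (a, b) \<in> box m B \<longrightarrow> \<bar>real_of_int (disc (model a b))\<bar> \<le> C * B ^ (12 * n)"
proof -
  define Kf where "Kf = \<bar>real_of_int s\<bar> ^ 3 * (\<Sum>i\<le>degree f0. \<bar>real_of_int (coeff f0 i)\<bar>)"
  define Kg where "Kg = \<bar>real_of_int s\<bar> ^ 5 * (\<Sum>i\<le>degree g0. \<bar>real_of_int (coeff g0 i)\<bar>)"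
  have K: "Kf \<ge> 0" "Kg \<ge> 0" by (auto simp: Kf_def Kg_def intro!: mult_nonneg_nonneg sum_nonneg)
  have val: "\<bar>real_of_int (s ^ j * b ^ (N - m * degree h) * fval h a (b ^ m))\<bar>
      \<le> \<bar>real_of_int s\<bar> ^ j * (\<Sum>i\<le>degree h. \<bar>real_of_int (coeff h i)\<bar>) * B ^ N"
    if "(a, b) \<in> box m B" "B \<ge> 1" "m * degree h \<le> N" for a b B j N h
  proof -
    have ab: "\<bar>real_of_int a\<bar> \<le> B ^ m" "\<bar>real_of_int b\<bar> \<le> B" using that(1) by (auto simp: box_def)
    then have "\<bar>real_of_int (b ^ m)\<bar> \<le> B ^ m" by (simp add: power_abs power_mono)
    then have "\<bar>real_of_int (fval h a (b ^ m))\<bar> \<le> (\<Sum>i\<le>degree h. \<bar>real_of_int (coeff h i)\<bar>) * (B ^ m) ^ degree h"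
      using ab that(2) by (intro abs_fval_le) auto
    moreover have "\<bar>real_of_int b\<bar> ^ (N - m * degree h) \<le> B ^ (N - m * degree h)"
      using ab by (intro power_mono) auto
    ultimately have "\<bar>real_of_int b\<bar> ^ (N - m * degree h) * \<bar>real_of_int (fval h a (b ^ m))\<bar>
        \<le> B ^ (N - m * degree h) * ((\<Sum>i\<le>degree h. \<bar>real_of_int (coeff h i)\<bar>) * (B ^ m) ^ degree h)"
      using that(2) by (intro mult_mono) auto
    also have "\<dots> = (\<Sum>i\<le>degree h. \<bar>real_of_int (coeff h i)\<bar>) * (B ^ (N - m * degree h) * B ^ (m * degree h))"
      unfolding power_mult by (simp only: mult_ac)
    also have "B ^ (N - m * degree h) * B ^ (m * degree h) = B ^ N"
      using that(3) by (simp flip: power_add)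
    finally have "\<bar>real_of_int s\<bar> ^ j * (\<bar>real_of_int b\<bar> ^ (N - m * degree h) * \<bar>real_of_int (fval h a (b ^ m))\<bar>)
      \<le> \<bar>real_of_int s\<bar> ^ j * ((\<Sum>i\<le>degree h. \<bar>real_of_int (coeff h i)\<bar>) * B ^ N)"
      by (rule mult_left_mono) auto
    then show ?thesis by (simp add: abs_mult power_abs mult_ac)
  qed
  show ?thesis
  proof (intro exI[of _ "64 * Kf ^ 3 + 432 * Kg ^ 2 + 1"] conjI allI impI)
    show "64 * Kf ^ 3 + 432 * Kg ^ 2 + 1 \<ge> 1" using K by simp
    fix B :: real and a b assume B: "B \<ge> 1" and ab: "(a, b) \<in> box m B"
    have "\<bar>real_of_int (coeff_a4 a b)\<bar> \<le> Kf * B ^ (4 * n)"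
      unfolding coeff_a4_def Kf_def using val[OF ab B deg_f0, of 3] .
    then have A: "\<bar>real_of_int (coeff_a4 a b)\<bar> ^ 3 \<le> (Kf * B ^ (4 * n)) ^ 3" by (rule power_mono) auto
    have "\<bar>real_of_int (coeff_a6 a b)\<bar> \<le> Kg * B ^ (6 * n)"
      unfolding coeff_a6_def Kg_def using val[OF ab B deg_g0, of 5] .
    then have B6: "\<bar>real_of_int (coeff_a6 a b)\<bar> ^ 2 \<le> (Kg * B ^ (6 * n)) ^ 2" by (rule power_mono) auto
    have "\<bar>real_of_int (disc (model a b))\<bar> = \<bar>64 * real_of_int (coeff_a4 a b) ^ 3 + 432 * real_of_int (coeff_a6 a b) ^ 2\<bar>"
    proof -
      have "real_of_int (disc (model a b)) = - (64 * real_of_int (coeff_a4 a b) ^ 3 + 432 * real_of_int (coeff_a6 a b) ^ 2)"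
        unfolding disc_short by simp
      then show ?thesis by (simp only: abs_minus_cancel)
    qed
    also have "\<dots> \<le> 64 * \<bar>real_of_int (coeff_a4 a b)\<bar> ^ 3 + 432 * \<bar>real_of_int (coeff_a6 a b)\<bar> ^ 2"
      by (rule order.trans[OF abs_triangle_ineq]) (simp add: abs_mult power_abs)
    also have "\<dots> \<le> 64 * (Kf * B ^ (4 * n)) ^ 3 + 432 * (Kg * B ^ (6 * n)) ^ 2" using A B6 by linarith
    also have "\<dots> = (64 * Kf ^ 3 + 432 * Kg ^ 2) * B ^ (12 * n)"
    proof -
      have "(B ^ (4 * n)) ^ 3 = B ^ (12 * n)" "(B ^ (6 * n)) ^ 2 = B ^ (12 * n)" by (simp_all flip: power_mult)
      then show ?thesis unfolding power_mult_distrib by (simp only: distrib_right mult.assoc)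
    qed
    also have "\<dots> \<le> (64 * Kf ^ 3 + 432 * Kg ^ 2 + 1) * B ^ (12 * n)" using B by (intro mult_right_mono) auto
    finally show "\<bar>real_of_int (disc (model a b))\<bar> \<le> (64 * Kf ^ 3 + 432 * Kg ^ 2 + 1) * B ^ (12 * n)" .
  qed
qed

text \<open>Otherwise \<open>p\<close> divides both coefficients of the model. If \<open>p\<close>
  does not divide \<open>b\<close>, it divides the values of \<open>f0\<close> and
  \<open>g0\<close>, hence \<open>R\<close>. If it does, \<open>deg_eq\<close> says that one
  coefficient carries no extra power of \<open>b\<close>, and its leading term forces
  \<open>p dvd a\<close>.\<close>

lemma prime_dvd_minimal_disc_fibre:
  "\<exists>C. \<forall>p a b. Factorial_Ring.prime p \<longrightarrow> C < p \<longrightarrow> b \<noteq> 0 \<longrightarrow> \<not> (p dvd a \<and> p dvd b) \<longrightarrow>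
    disc (fibre f g (of_int a / of_int b ^ m)) \<noteq> 0 \<longrightarrow> p dvd disc (model a b) \<longrightarrow>
    p dvd minimal_disc (fibre f g (of_int a / of_int b ^ m))"
proof (intro exI allI impI)
  fix p a b :: int
  \<comment> \<open>This assumption fixes the constant \<open>C\<close>: such a prime exceeds 3 and
    divides none of the listed integers that are nonzero.\<close>
  assume p: "Factorial_Ring.prime p" "3 + \<bar>s\<bar> + \<bar>R\<bar> + \<bar>lead_coeff f0\<bar> + \<bar>lead_coeff g0\<bar> < p"
    and b: "b \<noteq> 0" and ab: "\<not> (p dvd a \<and> p dvd b)"
    and disc: "disc (fibre f g (of_int a / of_int b ^ m)) \<noteq> 0" "p dvd disc (model a b)"
  have p3: "3 < p" using p(2) by linarith
  have nd: "\<not> p dvd x" if "x \<noteq> 0" "\<bar>x\<bar> < p" for x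
    using dvd_imp_le_int[OF that(1), of p] that(2) by linarith
  have pw: "p dvd z" if "p dvd x ^ j * z" "\<not> p dvd x" for x z j
    using that prime_dvd_mult_iff[OF p(1), of "x ^ j" z] prime_dvd_power[OF p(1), of x j] by blast
  show "p dvd minimal_disc (fibre f g (of_int a / of_int b ^ m))"
  proof (rule ccontr)
    assume "\<not> ?thesis"
    then have "p dvd coeff_a4 a b" "p dvd coeff_a6 a b"
      using prime_dvd_minimal_disc[OF model_in_integral_models[OF b] disc(1) p(1) _ disc(2)] p3 by blast+
    moreover have "\<not> p dvd s" using nd[of s] s_nz p(2) by linarith
    ultimately have *: "p dvd b ^ (4 * n - m * degree f0) * fval f0 a (b ^ m)"
      "p dvd b ^ (6 * n - m * degree g0) * fval g0 a (b ^ m)"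
      unfolding coeff_a4_def coeff_a6_def mult.assoc using pw by blast+
    show False
    proof (cases "p dvd b")
      case False
      then have "p dvd fval f0 a (b ^ m)" "p dvd fval g0 a (b ^ m)" "\<not> p dvd b ^ m"
        using *[THEN pw] prime_dvd_power[OF p(1), of b m] by blast+
      then have "p dvd R" by (rule prime_dvd_fval_both[OF bezout p(1)])
      then show False using nd[OF R_nz] p(2) by linarith
    next
      case True
      then have bm: "p dvd b ^ m" using dvd_trans[OF True dvd_power[of m b]] m_pos by blast
      have "p dvd a"
        using deg_eq
      proof
        assume eq: "m * degree f0 = 4 * n"
        then have "f0 \<noteq> 0" using n_pos by auto
        then have "\<not> p dvd lead_coeff f0" using p(2) by (intro nd) auto
        moreover have "p dvd fval f0 a (b ^ m)" using *(1) unfolding eq by simp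
        ultimately show "p dvd a" using prime_dvd_fval_denominator[OF p(1) bm] by blast
      next
        assume eq: "m * degree g0 = 6 * n"
        then have "g0 \<noteq> 0" using n_pos by auto
        then have "\<not> p dvd lead_coeff g0" using p(2) by (intro nd) auto
        moreover have "p dvd fval g0 a (b ^ m)" using *(2) unfolding eq by simp
        ultimately show "p dvd a" using prime_dvd_fval_denominator[OF p(1) bm] by blast
      qed
      then show False using ab True by blast
    qed
  qed
qed

end

lemma eventually_large_not_dvd:
  assumes "x \<noteq> (0::int)"
  shows "\<forall>\<^sub>F y in at_top. \<forall>p. y < real_of_int p \<longrightarrow> \<not> p dvd x"
  using eventually_ge_at_top[of "\<bar>real_of_int x\<bar>"]
proof eventually_elim
  case (elim y)
  show ?case
  proof (intro allI impI notI)
    fix p assume "y < real_of_int p" "p dvd x"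
    then show False using dvd_imp_le_int[OF assms, of p] elim by linarith
  qed
qed

section \<open>Factors of the discriminant form and their values\<close>

locale factored_family = integral_family +
  fixes c0 :: rat and e0 \<psi> k :: nat and F :: "nat \<Rightarrow> int poly poly" and e :: "nat \<Rightarrow> nat"
  assumes k: "m * k = 12 * n" and disc_nz: "disc_poly f g \<noteq> 0" and deg_disc: "degree (disc_poly f g) \<le> k"
    and fact: "form_factorization (homogenize k (disc_poly f g)) c0 e0 \<psi> F e"
begin

definition h :: "nat \<Rightarrow> int poly" where
  "h i = poly (F i) 1"

text \<open>The index 0 stands for the factor \<open>y\<close> of the discriminant form, which takes the value \<open>b ^ m\<close>;
  as in the definition of \<open>kappa1\<close> it is replaced by its \<open>m\<close>-th root \<open>b\<close>.\<close>

definition idx :: "nat set" where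
  "idx = (if e0 \<ge> 1 then {0} else {}) \<union> {1..\<psi>}"

definition val :: "nat \<Rightarrow> int \<Rightarrow> int \<Rightarrow> int" where
  "val i a b = (if i = 0 then b else fval (h i) a (b ^ m))"

definition dl :: "nat \<Rightarrow> nat" where
  "dl i = (if i = 0 then 1 else m * degree (h i))"

text \<open>Where truncated subtraction differs from real subtraction, the maximum with 1 hides it,
  so this agrees with \<open>form_weight\<close>.\<close>

definition wt :: "nat \<Rightarrow> nat" where
  "wt i = (if i = 0 \<or> form_x dvd F i then 1 else max 1 (m * degree (h i) - 2))"

lemma finite_idx [simp]: "finite idx"
  by (simp add: idx_def)

lemma factor:
  assumes "i \<in> {1..\<psi>}"
  shows "F i = form_of (h i)" "total_degree (F i) = degree (h i)"
    "Factorial_Ring.irreducible (map_poly rat_of_int (h i))" "e i \<ge> 1" "degree (h i) \<ge> 1"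
    "\<exists>R u v. R \<noteq> 0 \<and> [:R:] = u * h i + v * pderiv (h i)"
proof -
  have *: "homogeneous (F i)" "Factorial_Ring.irreducible (over_rat (F i))" "coprime (over_rat (F i)) form_y"
    and "e i \<ge> 1"
    using fact assms by (auto simp: form_factorization_def)
  from homogeneous_eq_form_of[OF *] show "F i = form_of (h i)" "total_degree (F i) = degree (h i)"
    and irr: "Factorial_Ring.irreducible (map_poly rat_of_int (h i))" unfolding h_def by blast+
  show "e i \<ge> 1" by fact
  from irreducible_rat_imp_pderiv_bezout[OF irr] show "degree (h i) \<ge> 1"
    "\<exists>R u v. R \<noteq> 0 \<and> [:R:] = u * h i + v * pderiv (h i)" by blast+
qed

lemma factor_pair:
  assumes "i \<in> {1..\<psi>}" "j \<in> {1..\<psi>}" "i \<noteq> j"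
  shows "\<exists>R u v. R \<noteq> 0 \<and> [:R:] = u * h i + v * h j"
proof (rule irreducible_rat_imp_bezout[OF factor(3)[OF assms(1)]])
  have "coprime (over_rat (F i)) (over_rat (F j))" using fact assms by (auto simp: form_factorization_def)
  then show "coprime (over_rat (form_of (h i))) (over_rat (form_of (h j)))"
    by (simp flip: factor(1)[OF assms(1)] factor(1)[OF assms(2)])
qed

lemma wt_ge_1: "wt i \<ge> 1"
  by (simp add: wt_def)

lemma wt_ge: "i \<in> {1..\<psi>} \<Longrightarrow> degree (h i) \<ge> 2 \<Longrightarrow> wt i \<ge> m * degree (h i) - 2"
  using form_x_dvd_imp_degree[of "F i"] factor(3)[of i] by (auto simp: wt_def h_def)

lemma form_weight_eq: "i \<in> {1..\<psi>} \<Longrightarrow> form_weight m (F i) = real (wt i)"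
proof -
  assume i: "i \<in> {1..\<psi>}"
  have "real (max 1 (N - 2)) = max 1 (real N - 2)" for N :: nat
    by (cases "N \<ge> 2") (auto simp: of_nat_diff max_def)
  then show ?thesis using i by (simp only: form_weight_def wt_def factor(2)[OF i]) simp
qed

lemma kappa_denominator:
  "(if e0 \<ge> 1 then 1 else 0) + (\<Sum>i=1..\<psi>. real (m * total_degree (F i)) / form_weight m (F i))
    = (\<Sum>i\<in>idx. real (dl i) / real (wt i))"
proof -
  have "(\<Sum>i=1..\<psi>. real (m * total_degree (F i)) / form_weight m (F i)) = (\<Sum>i\<in>{1..\<psi>}. real (dl i) / real (wt i))"
    by (intro sum.cong refl) (simp_all only: form_weight_eq factor(2), auto simp: dl_def)
  then show ?thesis by (simp add: idx_def dl_def wt_def)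
qed

lemma eval_homogenize:
  assumes "c \<noteq> 0"
  shows "poly (poly (homogenize k (disc_poly f g)) [:c:]) x = c ^ k * poly (disc_poly f g) (x / c)"
proof -
  let ?d = "disc_poly f g"
  have "poly (poly (homogenize k ?d) [:c:]) x = (\<Sum>i\<le>degree ?d. coeff ?d i * x ^ i * c ^ (k - i))"
    by (simp add: homogenize_def poly_sum form_x_def form_y_def poly_power mult_ac)
  also have "\<dots> = (\<Sum>i\<le>degree ?d. c ^ k * (coeff ?d i * (x / c) ^ i))"
  proof (intro sum.cong refl)
    fix i assume "i \<in> {..degree ?d}"
    then have "c ^ k = c ^ i * c ^ (k - i)" using deg_disc by (simp flip: power_add)
    then show "coeff ?d i * x ^ i * c ^ (k - i) = c ^ k * (coeff ?d i * (x / c) ^ i)"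
      using assms by (simp add: power_divide)
  qed
  finally show ?thesis by (simp add: poly_altdef sum_distrib_left)
qed

lemma eval_factorization:
  "poly (poly (homogenize k (disc_poly f g)) [:of_int c:]) (of_int a)
    = c0 * of_int c ^ e0 * (\<Prod>i\<in>{1..\<psi>}. of_int (fval (h i) a c) ^ e i)"
proof -
  have ev: "poly (poly (over_rat (F i)) [:of_int c:]) (of_int a) = of_int (fval (h i) a c)" if "i \<in> {1..\<psi>}" for i
    by (simp add: factor(1)[OF that] over_rat_form_of poly_form_of fval_def coeff_map_poly degree_map_poly)
  have "homogenize k (disc_poly f g) = [:[:c0:]:] * form_y ^ e0 * (\<Prod>i\<in>{1..\<psi>}. over_rat (F i) ^ e i)"
    using fact by (simp add: form_factorization_def)
  then have "poly (poly (homogenize k (disc_poly f g)) [:of_int c:]) (of_int a)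
      = c0 * of_int c ^ e0 * (\<Prod>i\<in>{1..\<psi>}. poly (poly (over_rat (F i)) [:of_int c:]) (of_int a) ^ e i)"
    by (simp add: form_y_def poly_power poly_prod)
  also have "\<dots> = c0 * of_int c ^ e0 * (\<Prod>i\<in>{1..\<psi>}. of_int (fval (h i) a c) ^ e i)"
    using ev by (intro arg_cong2[where f = "(*)"] prod.cong) auto
  finally show ?thesis .
qed

lemma disc_model_factorization:
  assumes "b \<noteq> 0"
  shows "rat_of_int (disc (model a b)) = - 16 * of_int s ^ 12 * c0 * of_int b ^ (m * e0) * (\<Prod>i\<in>{1..\<psi>}. of_int (val i a b) ^ e i)"
proof -
  have "rat_of_int b ^ (12 * n) * poly (disc_poly f g) (of_int a / of_int b ^ m)
      = (of_int b ^ m) ^ k * poly (disc_poly f g) (of_int a / of_int b ^ m)"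
    by (simp flip: power_mult k)
  also have "\<dots> = poly (poly (homogenize k (disc_poly f g)) [:of_int (b ^ m):]) (of_int a)"
    using assms by (subst eval_homogenize) auto
  also have "\<dots> = c0 * of_int b ^ (m * e0) * (\<Prod>i\<in>{1..\<psi>}. of_int (fval (h i) a (b ^ m)) ^ e i)"
    unfolding eval_factorization by (simp add: power_mult)
  also have "(\<Prod>i\<in>{1..\<psi>}. rat_of_int (fval (h i) a (b ^ m)) ^ e i) = (\<Prod>i\<in>{1..\<psi>}. of_int (val i a b) ^ e i)"
    by (intro prod.cong) (auto simp: val_def)
  finally show ?thesis unfolding disc_model[OF assms] by (simp only: mult.assoc)
qed

text \<open>A form of positive degree \<open>k\<close> is not a nonzero constant: its values at
  \<open>(0, 1)\<close> and \<open>(0, 2)\<close> differ by the factor \<open>2 ^ k\<close>. This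
  keeps the denominator of \<open>kappa1\<close> positive.\<close>

lemma idx_nonempty: "idx \<noteq> {}"
proof
  assume "idx = {}"
  then have e: "e0 = 0" "\<psi> = 0" by (auto simp: idx_def split: if_splits)
  have k0: "k > 0" using k n_pos by (cases k) auto
  have "homogenize k (disc_poly f g) = [:[:c0:]:]"
    using fact e by (simp add: form_factorization_def)
  then have c: "c ^ k * poly (disc_poly f g) (x / c) = c0" if "c \<noteq> 0" for c x
    using eval_homogenize[OF that, of x] by simp
  then have d: "poly (disc_poly f g) x = c0" for x using c[of 1 x] by simp
  have "2 ^ k * c0 = c0" using c[of 2 0] d by simp
  moreover have "(2::rat) ^ k > 1" using k0 by (intro one_less_power) auto
  ultimately have "c0 = 0" by simp
  then have "disc_poly f g = 0" using d by (simp add: poly_all_0_iff_0[symmetric])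
  then show False using disc_nz by blast
qed

lemma weight_sum_pos: "(\<Sum>i\<in>idx. real (dl i) / real (wt i)) > 0"
proof (rule sum_pos)
  fix i assume "i \<in> idx"
  then show "real (dl i) / real (wt i) > 0"
    using wt_ge_1[of i] factor(5)[of i] m_pos by (auto simp: idx_def dl_def split: if_splits)
qed (use idx_nonempty in auto)

text \<open>The obstructions are finitely many: leading coefficients, Bezout constants of pairs, the
  denominator of \<open>c0\<close> and the constant of \<open>prime_dvd_minimal_disc_fibre\<close>.
  Primes beyond all of them behave generically.\<close>

lemma eventually_large_primes:
  "\<forall>\<^sub>F y in at_top. \<forall>p a b. Factorial_Ring.prime p \<longrightarrow> y < real_of_int p \<longrightarrow> b \<noteq> 0 \<longrightarrow> \<not> (p dvd a \<and> p dvd b) \<longrightarrow>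
     (\<forall>i\<in>{1..\<psi>}. p dvd val i a b \<longrightarrow> \<not> p dvd b) \<and>
     (\<forall>i\<in>idx. \<forall>j\<in>idx. i \<noteq> j \<longrightarrow> p dvd val i a b \<longrightarrow> \<not> p dvd val j a b) \<and>
     (disc (fibre f g (of_int a / of_int b ^ m)) \<noteq> 0 \<longrightarrow>
       (\<forall>i\<in>idx. p dvd val i a b \<longrightarrow> p dvd minimal_disc (fibre f g (of_int a / of_int b ^ m))))"
proof -
  from prime_dvd_minimal_disc_fibre obtain C where C: "\<forall>p a b. Factorial_Ring.prime p \<longrightarrow> C < p \<longrightarrow> b \<noteq> 0 \<longrightarrow> \<not> (p dvd a \<and> p dvd b) \<longrightarrow>
    disc (fibre f g (of_int a / of_int b ^ m)) \<noteq> 0 \<longrightarrow> p dvd disc (model a b) \<longrightarrow>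
    p dvd minimal_disc (fibre f g (of_int a / of_int b ^ m))" ..
  have lcs: "\<forall>\<^sub>F y in at_top. \<forall>i\<in>{1..\<psi>}. \<forall>p. y < real_of_int p \<longrightarrow> \<not> p dvd lead_coeff (h i)"
  proof (intro eventually_ball_finite ballI)
    fix i assume "i \<in> {1..\<psi>}"
    then have "lead_coeff (h i) \<noteq> 0" using factor(5)[of i] by auto
    then show "\<forall>\<^sub>F y in at_top. \<forall>p. y < real_of_int p \<longrightarrow> \<not> p dvd lead_coeff (h i)"
      by (rule eventually_large_not_dvd)
  qed auto
  define RR where "RR = (\<lambda>i j. SOME R. R \<noteq> 0 \<and> (\<exists>u v. [:R:] = u * h i + v * h j))"
  have RR: "RR i j \<noteq> 0 \<and> (\<exists>u v. [:RR i j:] = u * h i + v * h j)" if "i \<in> {1..\<psi>}" "j \<in> {1..\<psi>}" "i \<noteq> j" for i j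
  proof -
    have "\<exists>R. R \<noteq> 0 \<and> (\<exists>u v. [:R:] = u * h i + v * h j)" using factor_pair[OF that] by simp
    then show ?thesis unfolding RR_def by (rule someI_ex)
  qed
  have res: "\<forall>\<^sub>F y in at_top. \<forall>i\<in>{1..\<psi>}. \<forall>j\<in>{1..\<psi>}. i \<noteq> j \<longrightarrow> (\<forall>p. y < real_of_int p \<longrightarrow> \<not> p dvd RR i j)"
  proof (intro eventually_ball_finite ballI)
    fix i j assume ij: "i \<in> {1..\<psi>}" "j \<in> {1..\<psi>}"
    show "\<forall>\<^sub>F y in at_top. i \<noteq> j \<longrightarrow> (\<forall>p. y < real_of_int p \<longrightarrow> \<not> p dvd RR i j)"
    proof (cases "i = j")
      case False
      then have "RR i j \<noteq> 0" using RR ij by blast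
      from eventually_large_not_dvd[OF this] show ?thesis by eventually_elim blast
    qed auto
  qed auto
  \<comment> \<open>\<open>c0\<close> is only rational; divisibility of the integral discriminant is
    read off after multiplying by its denominator \<open>\<gamma>\<close>, which large primes do not
    divide.\<close>
  obtain \<alpha> \<gamma> where "quotient_of c0 = (\<alpha>, \<gamma>)" by (cases "quotient_of c0")
  then have \<gamma>: "\<gamma> \<noteq> 0" "c0 = of_int \<alpha> / of_int \<gamma>"
    using quotient_of_denom_pos[of c0 \<alpha> \<gamma>] quotient_of_div[of c0 \<alpha> \<gamma>] by auto
  show ?thesis
    using lcs res eventually_large_not_dvd[OF \<gamma>(1)] eventually_ge_at_top[of "real_of_int C"]
  proof eventually_elim
    case (elim y)
    show ?case
    proof (intro allI impI, intro conjI)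
      fix p a b :: int
      assume p: "Factorial_Ring.prime p" "y < real_of_int p" and b: "b \<noteq> 0" and ab: "\<not> (p dvd a \<and> p dvd b)"
      have nb: "\<not> p dvd b" if i: "i \<in> {1..\<psi>}" and v: "p dvd val i a b" for i
      proof
        assume "p dvd b"
        then have "p dvd b ^ m" using m_pos dvd_trans[OF _ dvd_power[of m b]] by blast
        moreover have "p dvd fval (h i) a (b ^ m)" using v i by (simp add: val_def)
        moreover have "\<not> p dvd lead_coeff (h i)" using elim(1) i p(2) by blast
        ultimately have "p dvd a" by (rule prime_dvd_fval_denominator[OF p(1)])
        with \<open>p dvd b\<close> ab show False by blast
      qed
      then show "\<forall>i\<in>{1..\<psi>}. p dvd val i a b \<longrightarrow> \<not> p dvd b" by blast
      show "\<forall>i\<in>idx. \<forall>j\<in>idx. i \<noteq> j \<longrightarrow> p dvd val i a b \<longrightarrow> \<not> p dvd val j a b"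
      proof (intro ballI impI notI)
        fix i j assume ij: "i \<in> idx" "j \<in> idx" "i \<noteq> j" "p dvd val i a b" "p dvd val j a b"
        have i: "i \<noteq> 0 \<Longrightarrow> i \<in> {1..\<psi>}" and j: "j \<noteq> 0 \<Longrightarrow> j \<in> {1..\<psi>}"
          using ij(1,2) by (auto simp: idx_def split: if_splits)
        consider "i = 0" "j \<in> {1..\<psi>}" | "j = 0" "i \<in> {1..\<psi>}" | "i \<in> {1..\<psi>}" "j \<in> {1..\<psi>}"
          using i j ij(3) by (metis (full_types))
        then show False
        proof cases
          case 1
          then show False using nb[of j] ij by (simp add: val_def)
        next
          case 2
          then show False using nb[of i] ij by (simp add: val_def)
        next
          case 3
          obtain u v where uv: "[:RR i j:] = u * h i + v * h j" using RR[OF 3 ij(3)] by blast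
          have "\<not> p dvd b" using nb[OF 3(1) ij(4)] .
          then have "\<not> p dvd b ^ m" using prime_dvd_power[OF p(1)] by blast
          moreover have "p dvd fval (h i) a (b ^ m)" "p dvd fval (h j) a (b ^ m)" using ij 3 by (auto simp: val_def)
          ultimately have "p dvd RR i j" using prime_dvd_fval_both[OF uv p(1)] by blast
          then show False using elim(2) 3 ij(3) p(2) by blast
        qed
      qed
      show "disc (fibre f g (of_int a / of_int b ^ m)) \<noteq> 0 \<longrightarrow>
        (\<forall>i\<in>idx. p dvd val i a b \<longrightarrow> p dvd minimal_disc (fibre f g (of_int a / of_int b ^ m)))"
      proof (intro impI ballI)
        fix i assume disc: "disc (fibre f g (of_int a / of_int b ^ m)) \<noteq> 0" and i: "i \<in> idx" "p dvd val i a b"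
        have "rat_of_int (\<gamma> * disc (model a b)) = of_int (- 16 * s ^ 12 * \<alpha> * (b ^ (m * e0) * (\<Prod>i\<in>{1..\<psi>}. val i a b ^ e i)))"
          using \<gamma> by (simp add: disc_model_factorization[OF b])
        then have eq: "\<gamma> * disc (model a b) = - 16 * s ^ 12 * \<alpha> * (b ^ (m * e0) * (\<Prod>i\<in>{1..\<psi>}. val i a b ^ e i))"
          by (simp only: of_int_eq_iff)
        have "p dvd b ^ (m * e0) * (\<Prod>i\<in>{1..\<psi>}. val i a b ^ e i)"
        proof (cases "i = 0")
          case True
          then have "p dvd b" "e0 \<ge> 1" using i by (auto simp: val_def idx_def split: if_splits)
          then have "p dvd b ^ (m * e0)" using m_pos dvd_trans[OF _ dvd_power[of "m * e0" b]] by simp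
          then show ?thesis by (rule dvd_mult2)
        next
          case False
          then have i': "i \<in> {1..\<psi>}" using i by (auto simp: idx_def split: if_splits)
          then have "p dvd val i a b ^ e i"
            using factor(4)[OF i'] dvd_trans[OF i(2) dvd_power[of "e i" "val i a b"]] by simp
          also have "\<dots> dvd (\<Prod>i\<in>{1..\<psi>}. val i a b ^ e i)" using i' by (intro dvd_prodI) auto
          finally show ?thesis by (rule dvd_mult)
        qed
        then have "p dvd \<gamma> * disc (model a b)" unfolding eq by (rule dvd_mult)
        moreover have "\<not> p dvd \<gamma>" using elim(3) p(2) by blast
        ultimately have "p dvd disc (model a b)" using prime_dvd_mult_iff[OF p(1)] by blast
        moreover have "C < p" using elim(4) p(2) by linarith
        ultimately show "p dvd minimal_disc (fibre f g (of_int a / of_int b ^ m))"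
          using C[rule_format, OF p(1) _ b ab disc] by blast
      qed
    qed
  qed
qed

end

section \<open>Exceptional pairs of the family and the Szpiro ratio at the others\<close>

context factored_family begin

text \<open>In the last set, present for \<open>m = 1\<close>, the exponent
  \<open>max 2 (degree (h i) - 1)\<close> is one more than the weight \<open>wt i\<close>.\<close>

definition bad_factor :: "real \<Rightarrow> real \<Rightarrow> nat \<Rightarrow> (int \<times> int) set" where
  "bad_factor \<epsilon> B i =
     {(a, b)\<in>box m B. \<bar>real_of_int (fval (h i) a (b ^ m))\<bar> \<le> B powr (real (m * degree (h i)) - \<epsilon>)} \<union>
     {(a, b)\<in>box m B. \<exists>p\<ge>2. real_of_int p \<le> sbound B \<and> p ^ sexponent B dvd fval (h i) a (b ^ m)} \<union>
     {(a, b)\<in>box m B. \<exists>p. Factorial_Ring.prime p \<and> sbound B < real_of_int p \<and>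
        real_of_int p \<le> B powr (real m - \<epsilon>) \<and> \<not> p dvd b \<and> p ^ 2 dvd fval (h i) a (b ^ m)} \<union>
     (if m = 1 then {(a, b)\<in>box 1 B. coprime a b \<and> fval (h i) a b \<noteq> 0 \<and> (\<exists>p. Factorial_Ring.prime p \<and>
        B powr (1 - \<epsilon>) \<le> real_of_int p \<and> \<not> p dvd b \<and> p ^ max 2 (degree (h i) - 1) dvd fval (h i) a b)} else {})"

definition bad :: "real \<Rightarrow> real \<Rightarrow> (int \<times> int) set" where
  "bad \<epsilon> B =
     {(a, b)\<in>box m B. \<exists>p. sbound B < real_of_int p \<and> p dvd a \<and> p dvd b} \<union>
     {(a, b)\<in>box m B. \<bar>real_of_int b\<bar> \<le> B powr (1 - \<epsilon>)} \<union>
     {(a, b)\<in>box m B. \<exists>p. sbound B < real_of_int p \<and> p ^ 2 dvd b} \<union>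
     {(a, b)\<in>box m B. \<exists>p\<ge>2. real_of_int p \<le> sbound B \<and> p ^ sexponent B dvd b} \<union>
     (\<Union>i\<in>{1..\<psi>}. bad_factor \<epsilon> B i)"

lemma negligible_bad:
  assumes "0 < \<epsilon>" "\<epsilon> < 1"
  shows "negligible m (bad \<epsilon>)"
proof -
  have m1: "m \<ge> 1" using m_pos by simp
  have "negligible m (\<lambda>B. bad_factor \<epsilon> B i)" if i: "i \<in> {1..\<psi>}" for i
  proof -
    obtain R u v where bez: "R \<noteq> 0" "[:R:] = u * h i + v * pderiv (h i)" using factor(6)[OF i] by blast
    have h0: "h i \<noteq> 0" using factor(5)[OF i] by auto
    have "negligible m (\<lambda>B. if m = 1 then {(a, b)\<in>box 1 B. coprime a b \<and> fval (h i) a b \<noteq> 0 \<and> (\<exists>p. Factorial_Ring.prime p \<and>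
        B powr (1 - \<epsilon>) \<le> real_of_int p \<and> \<not> p dvd b \<and> p ^ max 2 (degree (h i) - 1) dvd fval (h i) a b)} else {})"
    proof (cases "m = 1")
      case True
      have "2 * degree (h i) \<le> 3 * max 2 (degree (h i) - 1)" by linarith
      then show ?thesis
        using negligible_primitive_large_squares[OF bez(2,1) h0 assms, of "max 2 (degree (h i) - 1)"] True by simp
    qed (simp add: negligible_empty)
    then show ?thesis unfolding bad_factor_def
      using negligible_small_value[OF factor(5)[OF i] assms(1) m1] negligible_value_small_primes[OF h0 m1]
        negligible_value_medium_squares[OF bez(2,1) h0 m1 assms(1)] assms(2)
      by (intro negligible_Un) auto
  qed
  then show ?thesis unfolding bad_def
    using negligible_common_factor[OF m1] negligible_small_denominator[OF assms(1)]
      negligible_denominator_square negligible_denominator_small_primes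
    by (intro negligible_Un negligible_UN) auto
qed

text \<open>A failure makes \<open>p\<close> larger than \<open>B powr (m - \<epsilon>)\<close>. For
  \<open>m = 1\<close> the pair then lies in the last exceptional set; for \<open>m \<ge> 2\<close>
  already the power with exponent \<open>degree (h i) + 1\<close> exceeds the value.\<close>

lemma large_prime_power_not_dvd:
  assumes \<epsilon>: "0 < \<epsilon>" "\<epsilon> * (real (degree (h i)) + 1) \<le> 1" and i: "i \<in> {1..\<psi>}"
    and B: "B \<ge> 1" "B > (\<Sum>j\<le>degree (h i). \<bar>real_of_int (coeff (h i) j)\<bar>)"
    and ab: "(a, b) \<in> box m B" "m = 1 \<Longrightarrow> coprime a b" "(a, b) \<notin> bad_factor \<epsilon> B i"
    and p: "Factorial_Ring.prime p" "sbound B < real_of_int p" "\<not> p dvd b"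
  shows "\<not> p ^ Suc (wt i) dvd fval (h i) a (b ^ m)"
proof
  assume dv: "p ^ Suc (wt i) dvd fval (h i) a (b ^ m)"
  let ?r = "degree (h i)"
  have p0: "p > 1" using p(1) prime_gt_1_int by blast
  note nbad = ab(3)[unfolded bad_factor_def Un_iff mem_Collect_eq case_prod_conv]
  have "p ^ 2 dvd p ^ Suc (wt i)" using wt_ge_1[of i] by (intro le_imp_power_dvd) simp
  then have p2: "p ^ 2 dvd fval (h i) a (b ^ m)" using dv by (rule dvd_trans)
  have "\<not> real_of_int p \<le> B powr (real m - \<epsilon>)"
    using nbad ab(1) p p2 by blast
  then have pl: "B powr (real m - \<epsilon>) < real_of_int p" by simp
  have "\<not> \<bar>real_of_int (fval (h i) a (b ^ m))\<bar> \<le> B powr (real (m * ?r) - \<epsilon>)"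
    using nbad ab(1) by blast
  then have nz: "fval (h i) a (b ^ m) \<noteq> 0" by (cases "fval (h i) a (b ^ m) = 0") simp_all
  show False
  proof (cases "m = 1")
    case True
    have "max 2 (?r - 1) \<le> Suc (wt i)" using wt_ge[OF i] wt_ge_1[of i] True by (cases "?r \<ge> 2") auto
    then have "p ^ max 2 (?r - 1) dvd fval (h i) a b"
      using dvd_trans[OF le_imp_power_dvd dv] True by simp
    moreover have "B powr (1 - \<epsilon>) \<le> real_of_int p" "fval (h i) a b \<noteq> 0" "(a, b) \<in> box 1 B"
      using pl nz ab(1) True by simp_all
    ultimately have "(a, b) \<in> {(a, b)\<in>box 1 B. coprime a b \<and> fval (h i) a b \<noteq> 0 \<and> (\<exists>p. Factorial_Ring.prime p \<and>
        B powr (1 - \<epsilon>) \<le> real_of_int p \<and> \<not> p dvd b \<and> p ^ max 2 (?r - 1) dvd fval (h i) a b)}"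
      using ab(2)[OF True] p by blast
    then show False using ab(3) True unfolding bad_factor_def by simp
  next
    case False
    then have m2: "m \<ge> 2" using m_pos by simp
    have wr: "Suc (wt i) \<ge> ?r + 1"
    proof (cases "?r \<ge> 2")
      case True
      have "2 * ?r \<le> m * ?r" using m2 by simp
      then show ?thesis using wt_ge[OF i True] True by linarith
    qed (use wt_ge_1[of i] in simp)
    have "p ^ (?r + 1) dvd fval (h i) a (b ^ m)" using dvd_trans[OF le_imp_power_dvd[OF wr] dv] .
    then have "p ^ (?r + 1) \<le> \<bar>fval (h i) a (b ^ m)\<bar>" using dvd_imp_le_int[OF nz, of "p ^ (?r + 1)"] p0 by simp
    then have "real_of_int (p ^ (?r + 1)) \<le> real_of_int \<bar>fval (h i) a (b ^ m)\<bar>" by (simp only: of_int_le_iff)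
    also have "\<dots> = \<bar>real_of_int (fval (h i) a (b ^ m))\<bar>" by simp
    also have "\<dots> \<le> (\<Sum>j\<le>?r. \<bar>real_of_int (coeff (h i) j)\<bar>) * (B ^ m) ^ ?r"
    proof (rule abs_fval_le)
      have "\<bar>real_of_int b\<bar> ^ m \<le> B ^ m" using ab(1) by (intro power_mono) (auto simp: box_def)
      then show "\<bar>real_of_int (b ^ m)\<bar> \<le> B ^ m" by (simp add: power_abs)
    qed (use ab(1) B in \<open>auto simp: box_def\<close>)
    \<comment> \<open>The coefficient sum is absorbed by one further factor \<open>B\<close>, for
      which \<open>m \<ge> 2\<close> leaves room in the exponent below.\<close>
    also have "\<dots> < B * (B ^ m) ^ ?r" using B by (intro mult_strict_right_mono) auto
    also have "\<dots> = B powr (real (m * ?r) + 1)" 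
    proof -
      have "B powr (real (m * ?r) + 1) = B powr real (m * ?r) * B" using B by (simp add: powr_add)
      also have "B powr real (m * ?r) = (B ^ m) ^ ?r" using B by (subst powr_realpow) (auto simp: power_mult)
      finally show ?thesis by simp
    qed
    also have "\<dots> \<le> B powr ((real m - \<epsilon>) * real (?r + 1))"
    proof (rule powr_mono)
      have "(real m - \<epsilon>) * real (?r + 1) = real (m * ?r) + real m - \<epsilon> * (real ?r + 1)"
        by (simp add: algebra_simps)
      then show "real (m * ?r) + 1 \<le> (real m - \<epsilon>) * real (?r + 1)" using \<epsilon>(2) m2 by linarith
    qed (use B in simp)
    also have "\<dots> = (B powr (real m - \<epsilon>)) ^ (?r + 1)"
      unfolding powr_powr[symmetric] using B by (intro powr_realpow) simp
    also have "\<dots> \<le> real_of_int p ^ (?r + 1)" using pl by (intro power_mono) auto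
    finally show False by simp
  qed
qed

text \<open>Of the loss \<open>2 * \<epsilon>\<close>, one half allows for values smaller than
  \<open>B ^ dl i\<close>, the other for the primes up to \<open>sbound B\<close>.\<close>

lemma eventually_ln_conductor_ge:
  assumes \<epsilon>: "0 < \<epsilon>" "\<epsilon> < 1" "\<forall>i\<in>{1..\<psi>}. \<epsilon> * (real (degree (h i)) + 1) \<le> 1"
  shows "\<forall>\<^sub>F B in at_top. \<forall>a b. (a, b) \<in> box m B \<longrightarrow> (a, b) \<notin> bad \<epsilon> B \<longrightarrow> (m = 1 \<longrightarrow> coprime a b) \<longrightarrow>
    disc (fibre f g (of_int a / of_int b ^ m)) \<noteq> 0 \<longrightarrow>
    (\<Sum>i\<in>idx. (real (dl i) - 2 * \<epsilon>) / real (wt i)) * ln B \<le> ln (conductor (fibre f g (of_int a / of_int b ^ m)))"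
proof -
  have large: "\<forall>\<^sub>F B in at_top. \<forall>p a b. Factorial_Ring.prime p \<longrightarrow> sbound B < real_of_int p \<longrightarrow> b \<noteq> 0 \<longrightarrow> \<not> (p dvd a \<and> p dvd b) \<longrightarrow>
     (\<forall>i\<in>{1..\<psi>}. p dvd val i a b \<longrightarrow> \<not> p dvd b) \<and>
     (\<forall>i\<in>idx. \<forall>j\<in>idx. i \<noteq> j \<longrightarrow> p dvd val i a b \<longrightarrow> \<not> p dvd val j a b) \<and>
     (disc (fibre f g (of_int a / of_int b ^ m)) \<noteq> 0 \<longrightarrow>
       (\<forall>i\<in>idx. p dvd val i a b \<longrightarrow> p dvd minimal_disc (fibre f g (of_int a / of_int b ^ m))))"
    by (rule eventually_compose_filterlim[OF eventually_large_primes sbound_at_top])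
  \<comment> \<open>This is \<open>k * y * ln y\<close> with \<open>k \<le> sqrt y + 1\<close> and
    \<open>y = sqrt (ln B)\<close>.\<close>
  have small: "\<forall>\<^sub>F B in at_top. (sqrt (sqrt (ln B)) + 1) * sqrt (ln B) * ln (sqrt (ln B)) \<le> \<epsilon> * ln B"
    using \<epsilon>(1) by real_asymp
  have coefs: "\<forall>\<^sub>F B in at_top. \<forall>i\<in>{1..\<psi>}. B > (\<Sum>j\<le>degree (h i). \<bar>real_of_int (coeff (h i) j)\<bar>)"
    by (intro eventually_ball_finite ballI eventually_gt_at_top) auto
  show ?thesis
    using large small coefs eventually_sbound_ge[of 1] eventually_gt_at_top[of 1]
  proof eventually_elim
    case (elim B)
    define y where "y = sbound B"
    define E where "E = (\<lambda>a b. fibre f g (of_int a / of_int b ^ m))"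
    show ?case
    proof (intro allI impI)
      fix a b
      assume ab: "(a, b) \<in> box m B" "(a, b) \<notin> bad \<epsilon> B" "m = 1 \<longrightarrow> coprime a b"
        and disc: "disc (fibre f g (of_int a / of_int b ^ m)) \<noteq> 0"
      have b0: "b \<noteq> 0" using ab(1) by (simp add: box_def)
      have nc: "\<not> (p dvd a \<and> p dvd b)" if "y < real_of_int p" for p
        using ab that by (auto simp: bad_def y_def)
      have nbf: "(a, b) \<notin> bad_factor \<epsilon> B i" if "i \<in> {1..\<psi>}" for i using ab(2) that by (auto simp: bad_def)
      have idx_cases: "i = 0 \<or> i \<in> {1..\<psi>}" if "i \<in> idx" for i using that by (auto simp: idx_def split: if_splits)
      have lower: "B powr (real (dl i) - \<epsilon>) < \<bar>real_of_int (val i a b)\<bar>" if "i \<in> idx" for i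
      proof (cases "i = 0")
        case True
        then show ?thesis using ab by (auto simp: bad_def val_def dl_def)
      next
        case False
        then have "i \<in> {1..\<psi>}" using idx_cases[OF that] by blast
        from nbf[OF this] show ?thesis using ab(1) False by (auto simp: bad_factor_def val_def dl_def)
      qed
      have nz: "val i a b \<noteq> 0" if "i \<in> idx" for i
      proof
        assume "val i a b = 0"
        with lower[OF that] show False using powr_ge_zero[of B "real (dl i) - \<epsilon>"] by simp
      qed
      have nlarge: "\<not> p ^ Suc (wt i) dvd val i a b" if i: "i \<in> idx" and p: "Factorial_Ring.prime p" "y < real_of_int p" for i p
      proof (cases "i = 0")
        case True
        then have "\<not> p ^ 2 dvd b" using ab p(2) by (auto simp: bad_def y_def)
        then show ?thesis using True by (simp add: val_def wt_def numeral_2_eq_2)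
      next
        case False
        then have i': "i \<in> {1..\<psi>}" using idx_cases[OF i] by blast
        show ?thesis
        proof (cases "p dvd val i a b")
          case True
          then have "\<not> p dvd b" using elim(1) p b0 nc[OF p(2)] i' unfolding y_def by blast
          then have "\<not> p ^ Suc (wt i) dvd fval (h i) a (b ^ m)"
            using elim i' ab nbf[OF i'] p unfolding y_def
            by (intro large_prime_power_not_dvd[OF \<epsilon>(1) \<epsilon>(3)[rule_format, OF i'] i']) auto
          then show ?thesis using False by (simp add: val_def)
        next
          case False
          then show ?thesis using dvd_trans[of p "p ^ Suc (wt i)" "val i a b"] by auto
        qed
      qed
      have nsmall: "\<not> p ^ sexponent B dvd val i a b" if i: "i \<in> idx" and p: "Factorial_Ring.prime p" "real_of_int p \<le> y" for i p
      proof (cases "i = 0")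
        case True
        then show ?thesis using ab p prime_ge_2_int[OF p(1)] by (auto simp: bad_def val_def y_def)
      next
        case False
        then have "i \<in> {1..\<psi>}" using idx_cases[OF i] by blast
        from nbf[OF this] show ?thesis using ab(1) False p prime_ge_2_int[OF p(1)] by (auto simp: bad_factor_def val_def y_def)
      qed
      define P where "P = (\<lambda>i. {p. p \<in> prime_factors (val i a b) \<and> y < real_of_int p})"
      have finP: "finite (P i)" for i by (simp add: P_def)
      have P: "Factorial_Ring.prime p" "p dvd val i a b" "y < real_of_int p" if "p \<in> P i" for p i
        using that by (auto simp: P_def)
      have err: "real (sexponent B) * y * ln y \<le> \<epsilon> * ln B"
      proof -
        have "real (nat \<lceil>x\<rceil>) \<le> x + 1" if "x \<ge> 0" for x :: real
        proof -
          have "real (nat \<lceil>x\<rceil>) = of_int \<lceil>x\<rceil>" using that by simp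
          then show ?thesis by linarith
        qed
        then have "real (sexponent B) \<le> sqrt y + 1" using elim(4) by (simp add: sexponent_def y_def)
        then have "real (sexponent B) * y * ln y \<le> (sqrt y + 1) * y * ln y"
          using elim(4) by (intro mult_right_mono) (auto simp: y_def)
        also have "\<dots> \<le> \<epsilon> * ln B" using elim(2) by (simp add: y_def sbound_def)
        finally show ?thesis .
      qed
      have radical: "(real (dl i) - 2 * \<epsilon>) / real (wt i) * ln B \<le> (\<Sum>p\<in>P i. ln (real_of_int p))" if i: "i \<in> idx" for i
      proof -
        have "(real (dl i) - \<epsilon>) * ln B = ln (B powr (real (dl i) - \<epsilon>))" using elim(5) by (simp add: ln_powr)
        also have "\<dots> \<le> ln \<bar>real_of_int (val i a b)\<bar>" using lower[OF i] elim(5) nz[OF i] by (subst ln_le_cancel_iff) auto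
        also have "\<dots> \<le> real (sexponent B) * y * ln y + real (wt i) * (\<Sum>p\<in>P i. ln (real_of_int p))"
          unfolding P_def using elim(4) nlarge[OF i] nsmall[OF i] nz[OF i]
          by (intro ln_abs_le_radical) (auto simp: y_def)
        also have "\<dots> \<le> \<epsilon> * ln B + real (wt i) * (\<Sum>p\<in>P i. ln (real_of_int p))" using err by simp
        finally have "(real (dl i) - 2 * \<epsilon>) * ln B \<le> real (wt i) * (\<Sum>p\<in>P i. ln (real_of_int p))"
          by (simp add: algebra_simps)
        then show ?thesis using wt_ge_1[of i] by (simp add: pos_divide_le_eq mult.commute)
      qed
      \<comment> \<open>Disjointness lets the radicals of the different factors multiply inside the
        conductor.\<close>
      have disj: "P i \<inter> P j = {}" if "i \<in> idx" "j \<in> idx" "i \<noteq> j" for i j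
      proof -
        have "\<not> p dvd val j a b" if p: "p \<in> P i" for p
          using elim(1) P[OF p] b0 nc[OF P(3)[OF p]] \<open>i \<in> idx\<close> \<open>j \<in> idx\<close> \<open>i \<noteq> j\<close> unfolding y_def by blast
        then show ?thesis using P(2) by blast
      qed
      have model: "model a b \<in> integral_models (E a b)" unfolding E_def by (rule model_in_integral_models[OF b0])
      have md: "minimal_disc (E a b) \<noteq> 0" using minimal_disc_nonzero[OF model] disc by (simp add: E_def)
      have cond: "(\<Prod>p\<in>(\<Union>i\<in>idx. P i). real_of_int p) \<le> conductor (E a b)"
      proof (rule conductor_ge_int[OF md])
        fix p assume "p \<in> (\<Union>i\<in>idx. P i)"
        then obtain i where i: "i \<in> idx" "p \<in> P i" by blast
        then show "Factorial_Ring.prime p \<and> p dvd minimal_disc (E a b)"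
          using elim(1) P[OF i(2)] b0 nc[OF P(3)[OF i(2)]] disc unfolding y_def E_def by blast
      qed (use finP in auto)
      have pos: "real_of_int p > 0" if "p \<in> (\<Union>i\<in>idx. P i)" for p using that P(1) prime_gt_0_int by fastforce
      have "(\<Sum>i\<in>idx. (real (dl i) - 2 * \<epsilon>) / real (wt i)) * ln B \<le> (\<Sum>i\<in>idx. \<Sum>p\<in>P i. ln (real_of_int p))"
        unfolding sum_distrib_right by (intro sum_mono radical)
      also have "\<dots> = (\<Sum>p\<in>(\<Union>i\<in>idx. P i). ln (real_of_int p))"
        using finP disj by (intro sum.UNION_disjoint[symmetric]) auto
      also have "\<dots> = ln (\<Prod>p\<in>(\<Union>i\<in>idx. P i). real_of_int p)"
        using pos by (intro ln_prod[symmetric]) (auto simp: finP)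
      also have "\<dots> \<le> ln (conductor (E a b))"
        using cond prod_pos[of "\<Union>i\<in>idx. P i" real_of_int] pos by (subst ln_le_cancel_iff) (auto intro: less_le_trans)
      finally show "(\<Sum>i\<in>idx. (real (dl i) - 2 * \<epsilon>) / real (wt i)) * ln B \<le> ln (conductor (fibre f g (of_int a / of_int b ^ m)))"
        unfolding E_def .
    qed
  qed
qed

text \<open>The gap \<open>\<theta> = \<beta> * S - 12 * n\<close> is spent in halves: one on the
  loss \<open>\<beta> * (\<epsilon> * W)\<close> in the conductor, the other on the constant
  \<open>C\<close> in the discriminant bound.\<close>

lemma eventually_szpiro_ratio_less:
  assumes \<beta>: "12 * real n < \<beta> * (\<Sum>i\<in>idx. real (dl i) / real (wt i))"
  shows "\<exists>\<epsilon>. 0 < \<epsilon> \<and> \<epsilon> < 1 \<and> (\<forall>\<^sub>F B in at_top. \<forall>a b. (a, b) \<in> box m B \<longrightarrow> (a, b) \<notin> bad \<epsilon> B \<longrightarrow> (m = 1 \<longrightarrow> coprime a b) \<longrightarrow>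
    disc (fibre f g (of_int a / of_int b ^ m)) \<noteq> 0 \<longrightarrow> szpiro_ratio (fibre f g (of_int a / of_int b ^ m)) < \<beta>)"
proof -
  define S where "S = (\<Sum>i\<in>idx. real (dl i) / real (wt i))"
  define W where "W = (\<Sum>i\<in>idx. 2 / real (wt i))"
  define D where "D = 2 + (\<Sum>i\<in>{1..\<psi>}. real (degree (h i)))"
  have S: "S > 0" unfolding S_def by (rule weight_sum_pos)
  have \<beta>0: "\<beta> > 0"
  proof (rule ccontr)
    assume "\<not> \<beta> > 0"
    then have "\<beta> * S \<le> 0" using S by (simp add: mult_nonpos_nonneg)
    moreover have "0 \<le> 12 * real n" by simp
    ultimately show False using \<beta> unfolding S_def by linarith
  qed
  define \<theta> where "\<theta> = \<beta> * S - 12 * real n"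
  have \<theta>: "\<theta> > 0" using \<beta> by (simp add: \<theta>_def S_def)
  have W: "W \<ge> 0" unfolding W_def by (intro sum_nonneg) auto
  have D: "D \<ge> 2" unfolding D_def by (simp add: sum_nonneg)
  \<comment> \<open>\<open>1 / D\<close> secures \<open>\<epsilon> < 1\<close> and
    \<open>\<epsilon> * (degree (h i) + 1) \<le> 1\<close>; the other bound secures
    \<open>\<beta> * (\<epsilon> * W) \<le> \<theta> / 2\<close>, with \<open>W + 1\<close> for a
    positive denominator.\<close>
  define \<epsilon> where "\<epsilon> = min (1 / D) (\<theta> / (2 * \<beta> * (W + 1)))"
  have \<epsilon>0: "\<epsilon> > 0" using D \<theta> \<beta>0 W by (simp add: \<epsilon>_def)
  have \<epsilon>D: "\<epsilon> * D \<le> 1"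
  proof -
    have "\<epsilon> * D \<le> (1 / D) * D" using D by (intro mult_right_mono) (auto simp: \<epsilon>_def)
    then show ?thesis using D by simp
  qed
  have \<epsilon>1: "\<epsilon> < 1" 
  proof -
    have "\<epsilon> * 2 \<le> \<epsilon> * D" using D \<epsilon>0 by (intro mult_left_mono) auto
    with \<epsilon>D show ?thesis by linarith
  qed
  have \<epsilon>i: "\<forall>i\<in>{1..\<psi>}. \<epsilon> * (real (degree (h i)) + 1) \<le> 1"
  proof
    fix i assume i: "i \<in> {1..\<psi>}"
    have "real (degree (h i)) \<le> (\<Sum>i\<in>{1..\<psi>}. real (degree (h i)))"
      using i by (intro member_le_sum) auto
    then have "\<epsilon> * (real (degree (h i)) + 1) \<le> \<epsilon> * D" using \<epsilon>0 by (intro mult_left_mono) (auto simp: D_def)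
    with \<epsilon>D show "\<epsilon> * (real (degree (h i)) + 1) \<le> 1" by linarith
  qed
  have \<epsilon>W: "\<beta> * (\<epsilon> * W) \<le> \<theta> / 2"
  proof -
    have "\<epsilon> * W \<le> \<theta> / (2 * \<beta> * (W + 1)) * (W + 1)"
      using W \<epsilon>0 \<theta> \<beta>0 by (intro mult_mono) (auto simp: \<epsilon>_def)
    also have "\<dots> = \<theta> / (2 * \<beta>)" using W by simp
    finally show ?thesis using \<beta>0 by (simp add: field_simps)
  qed
  have sums: "(\<Sum>i\<in>idx. (real (dl i) - 2 * \<epsilon>) / real (wt i)) = S - \<epsilon> * W"
    by (simp add: S_def W_def diff_divide_distrib sum_subtractf sum_distrib_left mult_ac)
  have gap: "12 * real n + \<theta> / 2 \<le> \<beta> * (S - \<epsilon> * W)"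
  proof -
    have "x + (z - x) / 2 \<le> z - t" if "t \<le> (z - x) / 2" for x z t :: real using that by argo
    then show ?thesis using \<epsilon>W unfolding right_diff_distrib \<theta>_def by blast
  qed
  obtain C where C: "C \<ge> 1" "\<forall>B\<ge>1. \<forall>a b. (a, b) \<in> box m B \<longrightarrow> \<bar>real_of_int (disc (model a b))\<bar> \<le> C * B ^ (12 * n)"
    using abs_disc_model_le by auto
  have "\<forall>\<^sub>F B in at_top. ln C < \<theta> / 2 * ln B" using \<theta> by real_asymp
  with eventually_ln_conductor_ge[OF \<epsilon>0 \<epsilon>1 \<epsilon>i] eventually_gt_at_top[of 1]
  have "\<forall>\<^sub>F B in at_top. \<forall>a b. (a, b) \<in> box m B \<longrightarrow> (a, b) \<notin> bad \<epsilon> B \<longrightarrow> (m = 1 \<longrightarrow> coprime a b) \<longrightarrow>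
    disc (fibre f g (of_int a / of_int b ^ m)) \<noteq> 0 \<longrightarrow> szpiro_ratio (fibre f g (of_int a / of_int b ^ m)) < \<beta>"
  proof eventually_elim
    case (elim B)
    show ?case
    proof (intro allI impI)
      fix a b
      define E where "E = fibre f g (of_int a / of_int b ^ m)"
      assume ab: "(a, b) \<in> box m B" "(a, b) \<notin> bad \<epsilon> B" "m = 1 \<longrightarrow> coprime a b"
        and disc: "disc (fibre f g (of_int a / of_int b ^ m)) \<noteq> 0"
      have b0: "b \<noteq> 0" using ab(1) by (simp add: box_def)
      have cond: "(S - \<epsilon> * W) * ln B \<le> ln (conductor E)"
        using elim(1) ab disc unfolding sums E_def by blast
      have lnB: "ln B > 0" using elim(2) by simp
      have model: "model a b \<in> integral_models E" unfolding E_def by (rule model_in_integral_models[OF b0])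
      have md: "minimal_disc E \<noteq> 0" using minimal_disc_nonzero[OF model] disc by (simp add: E_def)
      have "\<bar>minimal_disc E\<bar> \<le> \<bar>disc (model a b)\<bar>" by (rule minimal_model_in(2)[OF model])
      then have "\<bar>real_of_int (minimal_disc E)\<bar> \<le> \<bar>real_of_int (disc (model a b))\<bar>"
        unfolding of_int_abs[symmetric] of_int_le_iff .
      also have "\<dots> \<le> C * B ^ (12 * n)" using C(2) elim(2) ab(1) by simp
      finally have "ln \<bar>real_of_int (minimal_disc E)\<bar> \<le> ln (C * B ^ (12 * n))"
        using md C(1) elim(2) by (subst ln_le_cancel_iff) auto
      also have "\<dots> = ln C + 12 * real n * ln B" using C(1) elim(2) by (simp add: ln_mult ln_realpow)
      also have "\<dots> < (12 * real n + \<theta> / 2) * ln B" using elim(3) by (simp add: distrib_right)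
      also have "\<dots> \<le> \<beta> * (S - \<epsilon> * W) * ln B" using gap lnB by (intro mult_right_mono) auto
      also have "\<dots> \<le> \<beta> * ln (conductor E)" using cond \<beta>0 by (simp add: mult.assoc)
      finally have lt: "ln \<bar>real_of_int (minimal_disc E)\<bar> < \<beta> * ln (conductor E)" .
      \<comment> \<open>The logarithm of the conductor must be positive before the quotient in
        \<open>szpiro_ratio\<close> can be compared with \<open>\<beta>\<close>.\<close>
      have "S - \<epsilon> * W > 0"
      proof -
        have "0 < \<beta> * (S - \<epsilon> * W)" using gap \<theta> by (smt (verit) divide_pos_pos of_nat_0_le_iff)
        then show ?thesis using \<beta>0 by (simp add: zero_less_mult_iff)
      qed
      then have "ln (conductor E) > 0" using cond lnB by (smt (verit) mult_pos_pos)
      then show "szpiro_ratio (fibre f g (of_int a / of_int b ^ m)) < \<beta>"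
        using lt unfolding szpiro_ratio_def E_def[symmetric] by (simp add: pos_divide_less_eq)
    qed
  qed
  then show ?thesis using \<epsilon>0 \<epsilon>1 by blast
qed

end

section \<open>Proof of the theorem\<close>

text \<open>From \<open>4 * f ^ 3 = - (27 * g ^ 2)\<close>, \<open>f\<close> divides a power of the
  coprime \<open>g\<close> and is a unit; then \<open>g\<close> divides a unit, and both are
  constants.\<close>

lemma disc_poly_nonzero:
  assumes "coprime f g" "degree f > 0 \<or> degree g > 0"
  shows "disc_poly f g \<noteq> 0"
proof
  assume "disc_poly f g = 0"
  then have eq: "4 * f ^ 3 = - (27 * g ^ 2)" by (simp add: disc_poly_def add_eq_0_iff)
  have u: "is_unit (4 :: rat poly)" "is_unit (27 :: rat poly)"
    using is_unit_iff_degree[of "4 :: rat poly"] is_unit_iff_degree[of "27 :: rat poly"] by simp_all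
  have "f dvd 4 * f ^ 3" by simp
  then have "f dvd 27 * g ^ 2" unfolding eq by simp
  then have "f dvd g ^ 2" using u(2) by (metis dvd_mult_unit_iff' )
  moreover have "coprime f (g ^ 2)" using assms(1) by simp
  ultimately have f: "is_unit f" by (meson coprime_common_divisor dvd_refl)
  have "g dvd 27 * g ^ 2" by simp
  then have "g dvd 4 * f ^ 3" unfolding eq by simp
  then have "g dvd f ^ 3" using u(1) by (metis dvd_mult_unit_iff')
  moreover have "is_unit (f ^ 3)" using f by (simp add: is_unit_power_iff)
  ultimately have "is_unit g" using dvd_unit_imp_unit by blast
  moreover from this f have "f \<noteq> 0" "g \<noteq> 0" by auto
  ultimately show False using f assms(2) is_unit_iff_degree[of f] is_unit_iff_degree[of g] by simp
qed

text \<open>Extracts the factorization behind the value chosen in \<open>kappa1\<close>; the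
  argument then runs with this one.\<close>

lemma kappa1_factorization:
  assumes "disc_poly f g \<noteq> 0" "degree (disc_poly f g) \<le> 12 * n div m"
  shows "\<exists>c0 e0 \<psi> F e. form_factorization (homogenize (12 * n div m) (disc_poly f g)) c0 e0 \<psi> F e \<and>
    kappa1 n m f g = 12 * real n / ((if e0 \<ge> 1 then 1 else 0) +
        (\<Sum>i=1..\<psi>. real (m * total_degree (F i)) / form_weight m (F i)))"
proof -
  have "\<exists>\<kappa> c0 e0 \<psi> F e. form_factorization (homogenize (12 * n div m) (disc_poly f g)) c0 e0 \<psi> F e \<and>
    \<kappa> = 12 * real n / ((if e0 \<ge> 1 then 1 else 0) +
        (\<Sum>i=1..\<psi>. real (m * total_degree (F i)) / form_weight m (F i)))"
    using exists_form_factorization[OF assms] by blast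
  then show ?thesis unfolding kappa1_def by (rule someI_ex)
qed

lemma common_denominator:
  fixes f g :: "rat poly"
  shows "\<exists>s f0 g0. s \<noteq> 0 \<and> smult (of_int s) f = map_poly of_int f0 \<and>
    smult (of_int s) g = map_poly of_int g0"
proof -
  have sm: "map_poly rat_of_int (smult x q) = smult (of_int x) (map_poly of_int q)" for x q
    by (intro poly_eqI) (simp add: coeff_map_poly)
  from clear_denominators[of f] clear_denominators[of g] obtain c d f1 g1 where
    cd: "c \<noteq> 0" "smult (of_int c) f = map_poly of_int f1" "d \<noteq> 0" "smult (of_int d) g = map_poly of_int g1"
    by (elim exE conjE)
  have "smult (of_int (c * d)) f = map_poly of_int (smult d f1)"
    unfolding sm cd(2)[symmetric] by (simp add: mult.commute)
  moreover have "smult (of_int (c * d)) g = map_poly of_int (smult c g1)"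
    unfolding sm cd(4)[symmetric] by simp
  ultimately show ?thesis using cd(1,3) by (intro exI[of _ "c * d"] exI conjI) auto
qed

text \<open>For \<open>m = 1\<close> the fraction is put in lowest terms, which keeps it in the box
  and supplies the coprimality that the lattice argument relies on.\<close>

lemma box_representative:
  fixes a b :: int
  assumes "b \<noteq> 0" "\<bar>real_of_int a\<bar> \<le> B ^ m" "\<bar>real_of_int b\<bar> \<le> B"
  shows "\<exists>a' b'. (a', b') \<in> box m B \<and> (m = 1 \<longrightarrow> coprime a' b') \<and>
    rat_of_int a / of_int b ^ m = of_int a' / of_int b' ^ m"
proof (cases "m = 1")
  case True
  define d where "d = gcd a b"
  have "\<exists>a' b'. a = a' * d \<and> b = b' * d \<and> coprime a' b'"
    unfolding d_def using assms(1) by (intro gcd_coprime_exists) simp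
  then obtain a' b' where ab: "a = a' * d" "b = b' * d" "coprime a' b'" by (elim exE conjE)
  have "d > 0" using assms(1) by (simp add: d_def)
  then have d: "d \<ge> 1" by linarith
  have le: "\<bar>real_of_int x\<bar> \<le> \<bar>real_of_int (x * d)\<bar>" for x
    using mult_left_mono[of 1 "\<bar>real_of_int d\<bar>" "\<bar>real_of_int x\<bar>"] d by (simp add: abs_mult)
  have "(a', b') \<in> box m B"
  proof -
    have "b' \<noteq> 0" using assms(1) ab(2) by auto
    moreover have "\<bar>real_of_int a'\<bar> \<le> B ^ m" using le[of a'] assms(2) ab(1) by linarith
    moreover have "\<bar>real_of_int b'\<bar> \<le> B" using le[of b'] assms(3) ab(2) by linarith
    ultimately show ?thesis by (simp add: box_def)
  qed
  moreover have "rat_of_int a / of_int b ^ m = of_int a' / of_int b' ^ m"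
    using d True by (simp add: ab(1,2))
  ultimately show ?thesis using ab(3) by blast
next
  case False
  then have "(a, b) \<in> box m B \<and> (m = 1 \<longrightarrow> coprime a b) \<and> rat_of_int a / of_int b ^ m = of_int a / of_int b ^ m"
    using assms by (simp add: box_def)
  then show ?thesis by blast
qed

theorem theorem4p3:
  fixes f g :: "rat poly" and n m :: nat and \<beta> :: real
  assumes "coprime f g"
    and "n > 0" and "m > 0" and "m = 1 \<or> n = 1"
    and "max (real (Polynomial.degree f) / 4) (real (Polynomial.degree g) / 6) = real n / real m"
    and "\<beta> > kappa1 n m f g"
  shows "\<exists>C>0. \<forall>H::real. H \<ge> 3 \<longrightarrow>
    1 / H powr ((real m + 1) / (12 * real n)) *
      real (card {t::rat. \<exists>a b::int. b \<noteq> 0 \<and> t = of_int a / of_int b ^ m \<and>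
        \<bar>real_of_int a\<bar> \<le> H powr (real m / (12 * real n)) \<and>
        \<bar>real_of_int b\<bar> \<le> H powr (1 / (12 * real n)) \<and>
        disc (fibre f g t) \<noteq> 0 \<and> szpiro_ratio (fibre f g t) \<ge> \<beta>})
    \<le> C * ((ln (ln H)) ^ 2 / (ln H) powr (1 / 2))"
proof -
  have degs: "m * degree f \<le> 4 * n" "m * degree g \<le> 6 * n"
    "m * degree f = 4 * n \<or> m * degree g = 6 * n"
  proof -
    have "real (degree f) / 4 \<le> real n / real m" "real (degree g) / 6 \<le> real n / real m"
      using assms(5) by linarith+
    then have "real (m * degree f) \<le> real (4 * n)" "real (m * degree g) \<le> real (6 * n)"
      using assms(3) by (simp_all add: field_simps)
    then show "m * degree f \<le> 4 * n" "m * degree g \<le> 6 * n"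
      by (simp_all only: of_nat_le_iff)
    have "real (degree f) / 4 = real n / real m \<or> real (degree g) / 6 = real n / real m"
      using assms(5) by linarith
    then have "real (m * degree f) = real (4 * n) \<or> real (m * degree g) = real (6 * n)"
      using assms(3) by (auto simp: field_simps)
    then show "m * degree f = 4 * n \<or> m * degree g = 6 * n" by (simp only: of_nat_eq_iff)
  qed
  define k where "k = 12 * n div m"
  \<comment> \<open>For \<open>n = 1\<close> the equality in \<open>degs\<close> makes
    \<open>m\<close> a divisor of 4 or of 6.\<close>
  have "m dvd 12 * n"
    using assms(4)
  proof
    assume n1: "n = 1"
    from degs(3) n1 have "m dvd 4 \<or> m dvd 6" by (auto simp: dvd_def)
    then show ?thesis using n1 dvd_trans[of m 4 12] dvd_trans[of m 6 12] by auto
  qed simp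
  then have k: "m * k = 12 * n" by (simp add: k_def)
  have disc_nz: "disc_poly f g \<noteq> 0"
  proof (rule disc_poly_nonzero[OF assms(1)])
    show "degree f > 0 \<or> degree g > 0" 
    proof (rule ccontr)
      assume "\<not> ?thesis"
      with degs(3) assms(2) show False by simp
    qed
  qed
  have deg_disc: "degree (disc_poly f g) \<le> k"
  proof -
    have "m * (3 * degree f) \<le> m * k" "m * (2 * degree g) \<le> m * k" using degs k by linarith+
    then have "3 * degree f \<le> k" "2 * degree g \<le> k" using assms(3) by simp_all
    moreover have "degree (4 * f ^ 3) \<le> 3 * degree f"
      using degree_mult_le[of 4 "f ^ 3"] degree_power_le[of f 3] by (simp add: mult.commute)
    moreover have "degree (27 * g ^ 2) \<le> 2 * degree g"
      using degree_mult_le[of 27 "g ^ 2"] degree_power_le[of g 2] by (simp add: mult.commute)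
    ultimately show ?thesis unfolding disc_poly_def by (intro degree_add_le) auto
  qed
  from kappa1_factorization[OF disc_nz deg_disc[unfolded k_def]]
  obtain c0 e0 \<psi> F e where fact: "form_factorization (homogenize k (disc_poly f g)) c0 e0 \<psi> F e"
    and kappa: "kappa1 n m f g = 12 * real n / ((if e0 \<ge> 1 then 1 else 0) +
        (\<Sum>i=1..\<psi>. real (m * total_degree (F i)) / form_weight m (F i)))"
    unfolding k_def[symmetric] by (elim exE conjE)
  from common_denominator[of f g] obtain s f0 g0 where s: "s \<noteq> 0"
    and f0: "smult (of_int s) f = map_poly of_int f0" and g0: "smult (of_int s) g = map_poly of_int g0"
    by (elim exE conjE)
  have deg0: "degree f0 = degree f" "degree g0 = degree g"
    using arg_cong[OF f0, of degree] arg_cong[OF g0, of degree] s by (simp_all add: degree_map_poly)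
  have "is_unit [:rat_of_int s:]" using s by (simp add: is_unit_iff_degree)
  then have "coprime ([:rat_of_int s:] * f) ([:rat_of_int s:] * g)"
    using assms(1) by (simp only: coprime_mult_left_iff coprime_mult_right_iff is_unit_left_imp_coprime is_unit_right_imp_coprime simp_thms)
  then have "coprime (map_poly rat_of_int f0) (map_poly rat_of_int g0)" by (simp flip: f0 g0)
  from coprime_rat_imp_int_bezout[OF this] obtain R u v where R: "R \<noteq> 0" "[:R:] = u * f0 + v * g0"
    by (elim exE conjE)
  interpret factored_family f g n m s f0 g0 R u v c0 e0 \<psi> k F e
    using assms(2,3) s f0 g0 degs R k disc_nz deg_disc fact by unfold_locales (simp_all add: deg0)
  have "12 * real n < \<beta> * (\<Sum>i\<in>idx. real (dl i) / real (wt i))"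
    using assms(6) weight_sum_pos unfolding kappa kappa_denominator by (simp add: pos_divide_less_eq)
  from eventually_szpiro_ratio_less[OF this] obtain \<epsilon> where \<epsilon>: "0 < \<epsilon>" "\<epsilon> < 1"
    and good: "\<forall>\<^sub>F B in at_top. \<forall>a b. (a, b) \<in> box m B \<longrightarrow> (a, b) \<notin> bad \<epsilon> B \<longrightarrow> (m = 1 \<longrightarrow> coprime a b) \<longrightarrow>
      disc (fibre f g (of_int a / of_int b ^ m)) \<noteq> 0 \<longrightarrow> szpiro_ratio (fibre f g (of_int a / of_int b ^ m)) < \<beta>"
    by (elim exE conjE)
  from negligible_bad[OF \<epsilon>] obtain K where K: "\<forall>\<^sub>F B in at_top. real (card (bad \<epsilon> B)) \<le> B ^ (m + 1) * (K / sqrt (ln B))"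
    unfolding negligible_def by (elim exE)
  define \<Phi> where "\<Phi> = (\<lambda>H::real. H powr (1 / (12 * real n)))"
  define T where "T = (\<lambda>H. {t::rat. \<exists>a b::int. b \<noteq> 0 \<and> t = of_int a / of_int b ^ m \<and>
        \<bar>real_of_int a\<bar> \<le> H powr (real m / (12 * real n)) \<and>
        \<bar>real_of_int b\<bar> \<le> H powr (1 / (12 * real n)) \<and>
        disc (fibre f g t) \<noteq> 0 \<and> szpiro_ratio (fibre f g t) \<ge> \<beta>})"
  define quot where "quot = (\<lambda>(a, b). rat_of_int a / of_int b ^ m)"
  define L where "L = (\<lambda>H. 1 / H powr ((real m + 1) / (12 * real n)) * real (card (T H)))"
  have \<Phi>_power: "\<Phi> H ^ j = H powr (real j / (12 * real n))" if "H > 0" for H j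
    using that unfolding \<Phi>_def by (subst powr_realpow[symmetric]) (auto simp: powr_powr)
  have \<Phi>_pow: "H powr ((real m + 1) / (12 * real n)) = \<Phi> H ^ (m + 1)" if "H > 0" for H
    using \<Phi>_power[OF that, of "m + 1"] by (simp add: add.commute)
  have rep: "\<exists>ab\<in>box m (\<Phi> H). t = quot ab \<and> (m = 1 \<longrightarrow> coprime (fst ab) (snd ab)) \<and> disc (fibre f g t) \<noteq> 0 \<and> szpiro_ratio (fibre f g t) \<ge> \<beta>"
    if tH: "t \<in> T H" "H > 0" for t H
  proof -
    from tH(1) obtain a b where t: "b \<noteq> 0" "t = of_int a / of_int b ^ m"
      "\<bar>real_of_int a\<bar> \<le> H powr (real m / (12 * real n))" "\<bar>real_of_int b\<bar> \<le> H powr (1 / (12 * real n))"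
      "disc (fibre f g t) \<noteq> 0" "szpiro_ratio (fibre f g t) \<ge> \<beta>"
      unfolding T_def mem_Collect_eq by (elim exE conjE)
    have bounds: "\<bar>real_of_int a\<bar> \<le> \<Phi> H ^ m" "\<bar>real_of_int b\<bar> \<le> \<Phi> H"
      using t(3,4) \<Phi>_power[OF tH(2), of m] by (simp_all add: \<Phi>_def)
    from box_representative[OF t(1) bounds] obtain a' b' where ab: "(a', b') \<in> box m (\<Phi> H)" "m = 1 \<longrightarrow> coprime a' b'"
      "rat_of_int a / of_int b ^ m = of_int a' / of_int b' ^ m" by (elim exE conjE)
    show ?thesis
      using ab t by (intro bexI[OF _ ab(1)]) (simp add: quot_def)
  qed
  \<comment> \<open>Covers the bounded range of \<open>H\<close> that the asymptotic estimate leaves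
    open.\<close>
  have trivial: "L H \<le> 6" if "H \<ge> 3" for H
  proof -
    have H0: "H > 0" using that by simp
    have \<Phi>1: "\<Phi> H \<ge> 1" using that by (simp add: \<Phi>_def ge_one_powr_ge_zero)
    have "T H \<subseteq> quot ` box m (\<Phi> H)" using rep H0 by blast
    then have "card (T H) \<le> card (box m (\<Phi> H))"
      by (rule order.trans[OF card_mono[OF finite_imageI[OF finite_box]] card_image_le[OF finite_box]])
    also have "real \<dots> \<le> 6 * \<Phi> H ^ (m + 1)" by (rule card_box_le[OF \<Phi>1])
    finally show ?thesis unfolding L_def \<Phi>_pow[OF H0] using \<Phi>1 by (simp add: pos_divide_le_eq)
  qed
  have lim: "filterlim \<Phi> at_top at_top"
    unfolding \<Phi>_def using assms(2) by real_asymp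
  from eventually_compose_filterlim[OF good lim] eventually_compose_filterlim[OF K lim]
    \<comment> \<open>From here on \<open>ln (ln H) \<ge> 1\<close>, so a bound by a multiple of
      \<open>1 / sqrt (ln H)\<close> implies the stated one.\<close>
    eventually_ge_at_top[of "exp (exp (1::real))"] eventually_ge_at_top[of "3::real"]
  have "\<forall>\<^sub>F H in at_top. L H \<le> (\<bar>K\<bar> * sqrt (12 * real n)) * ((ln (ln H)) ^ 2 / (ln H) powr (1 / 2))"
  proof eventually_elim
    case (elim H)
    have H0: "H > 0" using elim by simp
    have \<Phi>1: "\<Phi> H \<ge> 1" using elim by (simp add: \<Phi>_def ge_one_powr_ge_zero)
    have "T H \<subseteq> quot ` bad \<epsilon> (\<Phi> H)"
    proof
      fix t assume t: "t \<in> T H"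
      from rep[OF t H0] obtain a b where ab: "(a, b) \<in> box m (\<Phi> H)" "t = of_int a / of_int b ^ m" "m = 1 \<longrightarrow> coprime a b"
        "disc (fibre f g t) \<noteq> 0" "szpiro_ratio (fibre f g t) \<ge> \<beta>"
        by (auto simp: quot_def)
      have "(a, b) \<in> bad \<epsilon> (\<Phi> H)"
      proof (rule ccontr)
        assume "(a, b) \<notin> bad \<epsilon> (\<Phi> H)"
        then have "szpiro_ratio (fibre f g t) < \<beta>" using elim(1) ab unfolding ab(2) by blast
        with ab(5) show False by simp
      qed
      then show "t \<in> quot ` bad \<epsilon> (\<Phi> H)" using ab(2) by (auto simp: quot_def image_iff intro!: bexI[of _ "(a, b)"])
    qed
    moreover have fin: "finite (bad \<epsilon> (\<Phi> H))"
      by (rule finite_subset[OF _ finite_box[of m "\<Phi> H"]]) (auto simp: bad_def bad_factor_def split: if_splits)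
    ultimately have "card (T H) \<le> card (bad \<epsilon> (\<Phi> H))"
      by (intro order.trans[OF card_mono[OF finite_imageI] card_image_le])
    then have "real (card (T H)) \<le> \<Phi> H ^ (m + 1) * (K / sqrt (ln (\<Phi> H)))" using elim(2) by linarith
    then have "L H \<le> K / sqrt (ln (\<Phi> H))"
      unfolding L_def \<Phi>_pow[OF H0] using \<Phi>1 by (simp add: pos_divide_le_eq mult.commute)
    also have "ln (\<Phi> H) = ln H / (12 * real n)" by (simp add: \<Phi>_def)
    also have "K / sqrt (ln H / (12 * real n)) = K * sqrt (12 * real n) / sqrt (ln H)"
      by (simp add: real_sqrt_divide)
    also have "\<dots> \<le> \<bar>K\<bar> * sqrt (12 * real n) / sqrt (ln H)"
      using elim by (intro divide_right_mono mult_right_mono) auto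
    also have "\<dots> = \<bar>K\<bar> * sqrt (12 * real n) * (1 / sqrt (ln H))" by simp
    also have "\<dots> \<le> \<bar>K\<bar> * sqrt (12 * real n) * ((ln (ln H)) ^ 2 / sqrt (ln H))"
    proof (intro mult_left_mono divide_right_mono)
      have "exp 1 \<le> ln H" using elim(3) H0 by (simp add: ln_ge_iff)
      moreover from this have "0 < ln H" using exp_gt_zero[of "1::real"] by linarith
      ultimately have "1 \<le> ln (ln H)" by (simp add: ln_ge_iff)
      then show "1 \<le> (ln (ln H)) ^ 2" by simp
    qed (use elim in auto)
    finally show ?case using elim by (simp add: powr_half_sqrt)
  qed
  then obtain H0 where H0: "\<And>H. H \<ge> H0 \<Longrightarrow> L H \<le> (\<bar>K\<bar> * sqrt (12 * real n)) * ((ln (ln H)) ^ 2 / (ln H) powr (1 / 2))"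
    unfolding eventually_at_top_linorder by blast
  define \<rho> where "\<rho> = (\<lambda>H::real. (ln (ln H)) ^ 2 / (ln H) powr (1 / 2))"
  \<comment> \<open>A lower bound for \<open>\<rho>\<close> between 3 and \<open>H0\<close>: the
    numerator at its smallest over the denominator at its largest. It is positive because
    \<open>3 > exp 1\<close> gives \<open>ln (ln 3) > 0\<close>.\<close>
  define c where "c = (ln (ln 3)) ^ 2 / (ln (max 3 H0)) powr (1 / 2)"
  have ln3: "ln (3::real) > 1" 
  proof -
    \<comment> \<open>The fourth power of \<open>21 / 16\<close> is just below 3.\<close>
    have "exp (1 / 4 :: real) \<le> 1 + 1 / 4 + (1 / 4) ^ 2" by (intro exp_bound) auto
    then have "exp (1 / 4 :: real) ^ 4 \<le> (1 + 1 / 4 + (1 / 4) ^ 2) ^ 4" by (intro power_mono) auto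
    also have "\<dots> < 3" by (simp add: eval_nat_numeral)
    finally have "exp 1 < (3::real)" by (simp flip: exp_of_nat_mult)
    then show ?thesis using ln_less_cancel_iff[of "exp 1" 3] by simp
  qed
  have c: "c > 0" using ln3 ln_gt_zero[OF ln3] by (auto simp: c_def intro!: divide_pos_pos)
  have \<rho>: "\<rho> H \<ge> 0" if "H \<ge> 3" for H unfolding \<rho>_def by simp
  have "L H \<le> (\<bar>K\<bar> * sqrt (12 * real n) + 6 / c) * \<rho> H" if H: "H \<ge> 3" for H
  proof (cases "H \<ge> H0")
    case True
    have "L H \<le> \<bar>K\<bar> * sqrt (12 * real n) * \<rho> H" using H0[OF True] by (simp add: \<rho>_def)
    also have "\<dots> \<le> (\<bar>K\<bar> * sqrt (12 * real n) + 6 / c) * \<rho> H" using c \<rho>[OF H] by (intro mult_right_mono) auto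
    finally show ?thesis .
  next
    case False
    have lnH: "ln 3 \<le> ln H" "ln H \<le> ln (max 3 H0)" using H False by auto
    have "ln (ln 3) \<le> ln (ln H)" using lnH ln3 by simp
    then have "(ln (ln 3)) ^ 2 \<le> (ln (ln H)) ^ 2" using ln_gt_zero[OF ln3] by (intro power_mono) auto
    moreover have "(ln H) powr (1 / 2) \<le> (ln (max 3 H0)) powr (1 / 2)" using lnH ln3 by (intro powr_mono2) auto
    ultimately have "c \<le> \<rho> H" unfolding c_def \<rho>_def using lnH ln3 by (intro frac_le) auto
    then have "6 \<le> 6 / c * \<rho> H" using c by (simp add: pos_le_divide_eq)
    also have "\<dots> \<le> (\<bar>K\<bar> * sqrt (12 * real n) + 6 / c) * \<rho> H" using \<rho>[OF H] by (intro mult_right_mono) auto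
    finally show ?thesis using trivial[OF H] by linarith
  qed
  moreover have "\<bar>K\<bar> * sqrt (12 * real n) + 6 / c > 0" using c by (intro add_nonneg_pos) auto
  ultimately show ?thesis unfolding L_def T_def \<rho>_def by blast
qed

end
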